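(* For $\vec{x}=(a,b,c,d,e,f,g)^T\in V$, $$A(1-a,e-a,f-a,g-a)\,A(b,1+b-e,1+b-f,1+b-g)\,B_5(e-a,b,1+b-f,g-a,1+b-a,1+b+c-f,1+b+d-f)\,K_{p_0}(\vec{x})$$ $$+\,A(a,1+a-e,f-d,g-d)\,A(b,1+b-e,f-c,g-c)\,B_5(1+b-e,b,f-c,g-c,1+a+b-e,1+b-c,1+b+d-e)\,K_{n_4}(\vec{x})$$ $$+\,A(a,b,c,d)\,A(e-a,e-b,e-c,e-d)\,B_5(\vec{x})\,K_{p_5}(\vec{x})=0.$$
   Context: $V=\{(a,b,c,d,e,f,g)^T\in\mathbb{C}^7: e+f+g-a-b-c-d=1\}$. ${}_4F_3\left[\begin{smallmatrix}a,b,c,d\\ e,f,g\end{smallmatrix};1\right]=\sum_{n\ge0}\frac{(a)_n(b)_n(c)_n(d)_n}{n!(e)_n(f)_n(g)_n}$, with $(a)_n$ the rising factorial. For $(a,b,c,d,e,f,g)^T\in V$, $$K(a;b,c,d;e,f,g)=\frac{{}_4F_3\left[\begin{smallmatrix}a,b,c,d\\ e,f,g\end{smallmatrix};1\right]}{\sin\pi a\,\Gamma(a)\Gamma(1+a-e)\Gamma(1+a-f)\Gamma(1+a-g)\Gamma(e)\Gamma(f)\Gamma(g)}+\frac{{}_4F_3\left[\begin{smallmatrix}a,1+a-e,1+a-f,1+a-g\\ 1+a-b,1+a-c,1+a-d\end{smallmatrix};1\right]}{\sin\pi a\,\Gamma(a)\Gamma(b)\Gamma(c)\Gamma(d)\Gamma(1+a-b)\Gamma(1+a-c)\Gamma(1+a-d)}.$$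 Notation: $S(a_1,\dots,a_n)=\sin\pi a_1\cdots\sin\pi a_n$; $A(x,y,z,w)=\frac{1}{\Gamma(x)\Gamma(y)\Gamma(z)\Gamma(w)}$ (with $1/\Gamma=0$ at nonpositive integers). The relation is asserted for those $\vec{x}\in V$ at which the $K$ functions occurring are defined (no lower parameter of an occurring series is a nonpositive integer, no sine in an occurring denominator vanishes). Here $K_{p_0}(\vec{x})=K(a;b,c,d;e,f,g)$, $K_{n_4}(\vec{x})=K(e-a;e-b,e-c,e-d;1+e-f,1+e-g,e)$, $K_{p_5}(\vec{x})=K(1+b-e;1+c-e,1+d-e,1+a-e;1+f-e,1+g-e,2-e)$, and, as a function of the seven coordinates of a point of $V$, $B_5(\vec{x})=B_5(a,b,c,d,e,f,g)=\pi^{-4}S(b,e-b)\,[S(b-a,c-a,d-a)+S(e-2a,f-a,g-a)]$. *)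

theory Defs
  imports "HOL-Analysis.Analysis"
begin

type_synonym params =
  "complex \<times> complex \<times> complex \<times> complex \<times> complex \<times> complex \<times> complex"

definition VV :: "params set" where
  "VV = {(a, b, c, d, e, f, g). e + f + g - a - b - c - d = 1}"

text \<open>The hypergeometric series with four upper and three lower parameters, at argument 1.
  It is only meaningful when no lower parameter is a nonpositive integer.\<close>

definition F43 :: "complex \<Rightarrow> complex \<Rightarrow> complex \<Rightarrow> complex \<Rightarrow> complex \<Rightarrow> complex \<Rightarrow> complex \<Rightarrow> complex" where
  "F43 a b c d e f g =
     (\<Sum>n. pochhammer a n * pochhammer b n * pochhammer c n * pochhammer d n /
           (fact n * pochhammer e n * pochhammer f n * pochhammer g n))"

definition Sin :: "complex list \<Rightarrow> complex" where
  "Sin xs = (\<Prod>x\<leftarrow>xs. sin (of_real pi * x))"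

text \<open>Reciprocals of Gamma factors are written with \<open>rGamma\<close>, the entire function
  that equals 1/Gamma and vanishes at the nonpositive integers.\<close>

definition A4 :: "complex \<Rightarrow> complex \<Rightarrow> complex \<Rightarrow> complex \<Rightarrow> complex" where
  "A4 x y z w = rGamma x * rGamma y * rGamma z * rGamma w"

fun KK :: "params \<Rightarrow> complex" where
  "KK (a, b, c, d, e, f, g) =
     F43 a b c d e f g / sin (of_real pi * a) *
       (rGamma a * rGamma (1 + a - e) * rGamma (1 + a - f) * rGamma (1 + a - g) *
        rGamma e * rGamma f * rGamma g)
   + F43 a (1 + a - e) (1 + a - f) (1 + a - g) (1 + a - b) (1 + a - c) (1 + a - d) /
         sin (of_real pi * a) *
       (rGamma a * rGamma b * rGamma c * rGamma d *
        rGamma (1 + a - b) * rGamma (1 + a - c) * rGamma (1 + a - d))"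

text \<open>Both series in the formula for \<open>KK\<close> are defined and its denominators
  contain no vanishing sine.\<close>

fun KK_defined :: "params \<Rightarrow> bool" where
  "KK_defined (a, b, c, d, e, f, g) \<longleftrightarrow>
     sin (of_real pi * a) \<noteq> 0 \<and>
     e \<notin> \<int>\<^sub>\<le>\<^sub>0 \<and> f \<notin> \<int>\<^sub>\<le>\<^sub>0 \<and> g \<notin> \<int>\<^sub>\<le>\<^sub>0 \<and>
     1 + a - b \<notin> \<int>\<^sub>\<le>\<^sub>0 \<and> 1 + a - c \<notin> \<int>\<^sub>\<le>\<^sub>0 \<and> 1 + a - d \<notin> \<int>\<^sub>\<le>\<^sub>0"

fun p0 :: "params \<Rightarrow> params" where
  "p0 (a, b, c, d, e, f, g) = (a, b, c, d, e, f, g)"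

fun n4 :: "params \<Rightarrow> params" where
  "n4 (a, b, c, d, e, f, g) = (e - a, e - b, e - c, e - d, 1 + e - f, 1 + e - g, e)"

fun p5 :: "params \<Rightarrow> params" where
  "p5 (a, b, c, d, e, f, g) =
     (1 + b - e, 1 + c - e, 1 + d - e, 1 + a - e, 1 + f - e, 1 + g - e, 2 - e)"

fun B5 :: "params \<Rightarrow> complex" where
  "B5 (a, b, c, d, e, f, g) =
     1 / of_real pi ^ 4 * Sin [b, e - b] *
       (Sin [b - a, c - a, d - a] + Sin [e - 2 * a, f - a, g - a])"

end

theory Submission
  imports Defs "HOL-Complex_Analysis.Complex_Analysis" "HOL-Real_Asymp.Real_Asymp"
begin

text \<open>One has $K = \sin(\pi a)^{-1}\,\Gamma(a)^{-1}$ \<open>rK\<close> with \<open>rK\<close> entire on V, so every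
  relation need only be proved at generic parameters in some open region. Two relations suffice: a
  nonterminating form of Whipple's transformation, \<open>rK_Whipple\<close>, under which \<open>rK\<close> is invariant, and a
  three-term relation \<open>rK_three_term\<close>, a limit of the vanishing of a sum of residues of a rational
  function. Together they give three-term relations with monomial coefficients between nearby
  members of the family; four of these eliminate everything but the three functions in question, and
  the coefficients that remain vanish by trigonometric identities.\<close>

text \<open>Without termination, Whipple's transformation of either series in K leaves a defect,
  which is a double series. K is the combination in which the two defects cancel; identifying them
  is what the nonterminating Saalschuetz theorem is for. The balance condition makes the terms of
  every series decay like n^(-2), locally uniformly, and with the Gamma regularisation this makes
  \<open>rK\<close> entire; the interchanges of limits, however, are justified only under a bound on
  a real part, such as Re (c + d - e) > 0. Continuation in six variables is reduced to one by
  restricting to a complex line through the given point, in a direction along which every linear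
  form that has to avoid the integers is nonconstant. The elimination leaves two functions over
  besides the three wanted, so the three coefficients have to satisfy two homogeneous linear
  equations. The expressions \<open>B5\<close> solve these, which explains why they are sums of two
  products although every relation used has monomial coefficients.\<close>

section \<open>Regularised balanced 4F3 series: locally uniform convergence and holomorphy\<close>

definition rF43_term ::
  "complex \<Rightarrow> complex \<Rightarrow> complex \<Rightarrow> complex \<Rightarrow> complex \<Rightarrow> complex \<Rightarrow> complex \<Rightarrow> nat \<Rightarrow> complex" where
  "rF43_term a b c d e f g n =
     pochhammer a n * pochhammer b n * pochhammer c n * pochhammer d n / fact n *
     (rGamma (e + of_nat n) * rGamma (f + of_nat n) * rGamma (g + of_nat n))"

definition rF43 ::
  "complex \<Rightarrow> complex \<Rightarrow> complex \<Rightarrow> complex \<Rightarrow> complex \<Rightarrow> complex \<Rightarrow> complex \<Rightarrow> complex" where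
  "rF43 a b c d e f g = (\<Sum>n. rF43_term a b c d e f g n)"

text \<open>In product form the term ratio stays valid where \<open>e + of_nat n\<close>,
  \<open>f + of_nat n\<close> or \<open>g + of_nat n\<close> vanishes, a case the regularised terms
  permit.\<close>

lemma rF43_term_Suc:
  "of_nat (Suc n) * (e + of_nat n) * (f + of_nat n) * (g + of_nat n) * rF43_term a b c d e f g (Suc n)
   = (a + of_nat n) * (b + of_nat n) * (c + of_nat n) * (d + of_nat n) * rF43_term a b c d e f g n"
proof -
  have r: "rGamma (z + of_nat n) = (z + of_nat n) * rGamma (z + of_nat (Suc n))" for z :: complex
    using rGamma_plus1[of "z + of_nat n"] by (simp add: add_ac)
  have "(of_nat (Suc n) :: complex) \<noteq> 0" by (simp only: of_nat_eq_0_iff nat.distinct simp_thms)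
  then show ?thesis
    unfolding rF43_term_def r[of e] r[of f] r[of g] pochhammer_Suc fact_Suc
    by (simp add: field_simps del: of_nat_Suc)
qed

text \<open>Induction step for a majorant proportional to (n-1)^(-3/2). The exponent 3/2 lies
  strictly between 1, needed for summability, and 2, the true rate of decay, which leaves room for
  error terms. Squaring reduces the claim to a cubic polynomial inequality in 1/n.\<close>

lemma raabe_step:
  fixes n :: nat
  assumes "n \<ge> 2"
  shows "(1 - 3 / 2 / real n) * (real n - 1) powr (-3/2) \<le> real n powr (-3/2)"
proof -
  define y where "y = 1 / real n"
  have y: "0 < y" "y \<le> 1/2" using assms by (auto simp: y_def field_simps)
  have "(1 - 3/2 * y)\<^sup>2 \<le> (1 - y) ^ 3"
  proof -
    have "(1 - y) ^ 3 - (1 - 3/2 * y)\<^sup>2 = y\<^sup>2 * (3/4 - y)" by (simp add: power2_eq_square power3_eq_cube algebra_simps)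
    also have "\<dots> \<ge> 0" using y by auto
    finally show ?thesis by simp
  qed
  also have "(1 - y) ^ 3 = ((1 - y) powr (3/2))\<^sup>2"
    using y by (simp add: powr_power powr_numeral)
  finally have le: "1 - 3/2 * y \<le> (1 - y) powr (3/2)"
    by (rule power2_le_imp_le) simp
  have n1: "real n - 1 > 0" using assms by simp
  have eq: "(real n - 1) = real n * (1 - y)" using assms by (simp add: y_def field_simps)
  have "(1 - 3 / 2 / real n) * (real n - 1) powr (-3/2) \<le> (1 - y) powr (3/2) * (real n - 1) powr (-3/2)"
    using le by (intro mult_right_mono) (auto simp: y_def)
  also have "\<dots> = (1 - y) powr (3/2) * (1 - y) powr (-3/2) * real n powr (-3/2)"
    using y by (simp add: eq powr_mult)
  also have "\<dots> = real n powr (-3/2)" using y by (simp add: powr_add [symmetric])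
  finally show ?thesis .
qed

text \<open>For x = 1/n the left side and the product of the first four factors on the right are
  numerator and denominator of the term ratio. Balance, in the form a + b + c + d = e + f + g - 1,
  makes the coefficients of x agree, so the ratio is 1 - 2/n + O(1/n^2). The remainder is spelled
  out as a polynomial to make its boundedness on compact sets evident.\<close>

lemma rF43_term_ratio:
  fixes a b c d e f g x :: complex
  assumes bal: "e + f + g - a - b - c - d = 1"
  shows "(1 + a * x) * (1 + b * x) * (1 + c * x) * (1 + d * x) =
     (1 + x) * (1 + e * x) * (1 + f * x) * (1 + g * x) * (1 - 2 * x) + x\<^sup>2 *
     ((a*b + a*c + a*d + b*c + b*d + c*d) + (a*b*c + a*b*d + a*c*d + b*c*d) * x + a*b*c*d * x\<^sup>2
      - ((e*f + e*g + f*g) - (e+f+g) - 2 + (e*f*g - (e*f + e*g + f*g) - 2 * (e+f+g)) * x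
         + (- e*f*g - 2 * (e*f + e*g + f*g)) * x\<^sup>2 - 2 * e*f*g * x^3))"
proof -
  have N: "(1 + a * x) * (1 + b * x) * (1 + c * x) * (1 + d * x) = 1 + (a + b + c + d) * x + x\<^sup>2 *
     ((a*b + a*c + a*d + b*c + b*d + c*d) + (a*b*c + a*b*d + a*c*d + b*c*d) * x + a*b*c*d * x\<^sup>2)"
    by (simp add: power2_eq_square algebra_simps)
  have D: "(1 + x) * (1 + e * x) * (1 + f * x) * (1 + g * x) * (1 - 2 * x) = 1 + (e + f + g - 1) * x + x\<^sup>2 *
     ((e*f + e*g + f*g) - (e+f+g) - 2 + (e*f*g - (e*f + e*g + f*g) - 2 * (e+f+g)) * x
         + (- e*f*g - 2 * (e*f + e*g + f*g)) * x\<^sup>2 - 2 * e*f*g * x^3)"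
    by (simp add: power2_eq_square power3_eq_cube algebra_simps)
  have s: "a + b + c + d = e + f + g - 1" using bal by (simp add: algebra_simps)
  show ?thesis unfolding N D s by (simp add: right_diff_distrib)
qed

text \<open>Raabe's test made uniform: from an index on that depends only on bounds for the
  parameters, one step multiplies the norm by at most 1 - (3/2)/n; the finitely many earlier terms
  are bounded by continuity. The parameters are functions of one complex variable because
  continuation later runs along complex lines.\<close>

lemma rF43_term_bound:
  fixes a b c d e f g :: "complex \<Rightarrow> complex"
  assumes K: "compact K"
    and cont: "continuous_on K a" "continuous_on K b" "continuous_on K c" "continuous_on K d"
      "continuous_on K e" "continuous_on K f" "continuous_on K g"
    and bal: "\<And>t. t \<in> K \<Longrightarrow> e t + f t + g t - a t - b t - c t - d t = 1"
  shows "\<exists>M. summable M \<and>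
    (\<forall>n. \<forall>t\<in>K. norm (rF43_term (a t) (b t) (c t) (d t) (e t) (f t) (g t) n) \<le> M n)"
proof -
  let ?T = "\<lambda>n t. rF43_term (a t) (b t) (c t) (d t) (e t) (f t) (g t) n"
  have "\<exists>R. \<forall>t\<in>K. norm (h t) \<le> R" if "continuous_on K h" for h :: "complex \<Rightarrow> complex"
    using compact_imp_bounded[OF compact_continuous_image[OF that K]] by (auto simp: bounded_iff)
  note bdd = this
  obtain R1 R2 R3 where R: "\<forall>t\<in>K. norm (e t) \<le> R1" "\<forall>t\<in>K. norm (f t) \<le> R2" "\<forall>t\<in>K. norm (g t) \<le> R3"
    using bdd[OF cont(5)] bdd[OF cont(6)] bdd[OF cont(7)] by blast
  define R where "R = 1 + \<bar>R1\<bar> + \<bar>R2\<bar> + \<bar>R3\<bar>"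
  have R: "norm (e t) \<le> R" "norm (f t) \<le> R" "norm (g t) \<le> R" if "t \<in> K" for t
    using R that unfolding R_def by fastforce+
  have R0: "R > 0" by (auto simp: R_def)
  define nu where "nu = (\<lambda>(t, x::real). 
     ((a t*b t + a t*c t + a t*d t + b t*c t + b t*d t + c t*d t) + (a t*b t*c t + a t*b t*d t + a t*c t*d t + b t*c t*d t) * x + a t*b t*c t*d t * x\<^sup>2
      - ((e t*f t + e t*g t + f t*g t) - (e t+f t+g t) - 2 + (e t*f t*g t - (e t*f t + e t*g t + f t*g t) - 2 * (e t+f t+g t)) * x
         + (- e t*f t*g t - 2 * (e t*f t + e t*g t + f t*g t)) * x\<^sup>2 - 2 * e t*f t*g t * x^3)))"
  have c': "continuous_on (K \<times> {0..1}) (\<lambda>p. h (fst p))" if "continuous_on K h" for h :: "complex \<Rightarrow> complex"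
    by (rule continuous_on_compose2[OF that continuous_on_fst[OF continuous_on_id]]) auto
  have "continuous_on (K \<times> {0..1}) nu"
    unfolding nu_def case_prod_beta by (intro continuous_intros c' cont)
  then have "bounded (nu ` (K \<times> {0..1}))"
    by (intro compact_imp_bounded compact_continuous_image compact_Times K) auto
  then obtain B where B: "\<And>t x. t \<in> K \<Longrightarrow> 0 \<le> x \<Longrightarrow> x \<le> 1 \<Longrightarrow> norm (nu (t, x)) \<le> B"
    by (fastforce simp: bounded_iff)
  \<comment> \<open>The summand 10 R gives |1 + e/n| \<ge> 9/10 for the lower parameters, so that
    \<open>?D\<close> has norm at least 1/2. Then 4 |B| makes the x^2 remainder at most |D| x/2,
    which lowers the rate from 2 to 3/2.\<close>
  define n0 where "n0 = nat \<lceil>10 * R + 4 * \<bar>B\<bar> + 2\<rceil>"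
  have n0: "real n0 \<ge> 10 * R + 4 * \<bar>B\<bar> + 2" unfolding n0_def by linarith
  have step: "norm (?T (Suc n) t) \<le> norm (?T n t) * (1 - 3/2 / real n)" if n: "n \<ge> n0" and t: "t \<in> K" for n t
  proof -
    define x where "x = 1 / real n"
    have nn: "real n \<ge> 10 * R + 4 * \<bar>B\<bar> + 2" using n n0 by linarith
    have npos: "real n > 0" using nn R0 by linarith
    have x: "0 < x" "x \<le> 1" "R * x \<le> 1/10" "4 * B * x \<le> 1"
      using nn R0 npos by (auto simp: x_def field_simps)
    have xn: "of_nat n = (1 / complex_of_real x)" 
    proof -
      have "real n = 1 / x" by (simp add: x_def)
      then have "complex_of_real (real n) = complex_of_real (1 / x)" by (rule arg_cong)
      then show ?thesis by (simp only: of_real_divide of_real_1 of_real_of_nat_eq)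
    qed
    have x0: "complex_of_real x \<noteq> 0" using x by simp
    let ?x = "complex_of_real x"
    let ?D = "(1 + ?x) * (1 + e t * ?x) * (1 + f t * ?x) * (1 + g t * ?x)"
    let ?N = "(1 + a t * ?x) * (1 + b t * ?x) * (1 + c t * ?x) * (1 + d t * ?x)"
    have rec: "?D * ?T (Suc n) t = ?N * ?T n t"
    proof -
      have sc: "(z + of_nat n) = (1 + z * ?x) / ?x" for z :: complex unfolding xn using x0 by (simp add: add_divide_distrib add.commute)
      have s1: "of_nat (Suc n) = (1 + ?x) / ?x" unfolding of_nat_Suc xn using x0 by (simp add: add_divide_distrib)
      have "(p1 / y) * (p2 / y) * (p3 / y) * (p4 / y) * T' = (q1 / y) * (q2 / y) * (q3 / y) * (q4 / y) * T \<Longrightarrow>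
          p1 * p2 * p3 * p4 * T' = q1 * q2 * q3 * q4 * T"
        if "y \<noteq> 0" for p1 p2 p3 p4 q1 q2 q3 q4 y T T' :: complex using that by simp
      from this[OF x0 rF43_term_Suc[of n "e t" "f t" "g t" "a t" "b t" "c t" "d t", unfolded sc s1]]
      show ?thesis .
    qed
    have low: "norm (1 + z * ?x) \<ge> 9/10" if "norm z \<le> R" for z :: complex
    proof -
      have "norm (z * ?x) \<le> R * x" using that x by (simp add: norm_mult mult_right_mono)
      then have "norm (z * ?x) \<le> 1/10" using x by linarith
      moreover have "norm (1 + z * ?x) \<ge> norm (1::complex) - norm (z * ?x)"
        by (rule norm_diff_ineq)
      ultimately show ?thesis by simp
    qed
    have "norm (1 + complex_of_real x) \<ge> 1"
      using x by (metis abs_of_pos add_pos_pos less_eq_real_def linorder_not_le norm_of_real of_real_1 of_real_add zero_less_one le_add_same_cancel1)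
    then have Dn: "norm ?D \<ge> 1 * (9/10) * (9/10) * (9/10)"
      unfolding norm_mult using low R[OF t] by (intro mult_mono) auto
    have "?N = ?D * (1 - 2 * ?x) + ?x\<^sup>2 * nu (t, x)"
      unfolding nu_def case_prod_conv by (rule rF43_term_ratio[OF bal[OF t]])
    then have "norm ?N \<le> norm (?D * (1 - 2 * ?x)) + norm (?x\<^sup>2 * nu (t, x))"
      by (metis norm_triangle_ineq)
    also have "\<dots> \<le> norm ?D * (1 - 2 * x) + x\<^sup>2 * B"
    proof (intro add_mono)
      have "1 - 2 * ?x = complex_of_real (1 - 2 * x)" by simp
      moreover have "1 - 2 * x \<ge> 0" using nn npos R0 by (auto simp: x_def field_simps)
      ultimately show "norm (?D * (1 - 2 * ?x)) \<le> norm ?D * (1 - 2 * x)"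
        by (simp only: norm_mult norm_of_real abs_of_nonneg order_refl)
      show "norm (?x\<^sup>2 * nu (t, x)) \<le> x\<^sup>2 * B"
        using B[OF t, of x] x by (simp add: norm_mult norm_power mult_left_mono)
    qed
    also have "x\<^sup>2 * B \<le> norm ?D * (x / 2)"
    proof -
      have "x\<^sup>2 * B = x * (B * x)" by (simp add: power2_eq_square)
      also have "\<dots> \<le> x * (1/4)" using x by (intro mult_left_mono) auto
      also have "\<dots> \<le> x / 2 * norm ?D"
      proof -
        have "norm ?D \<ge> 1/2" using Dn by simp
        then show ?thesis using x mult_left_mono[of "1/2" "norm ?D" "x/2"] by auto
      qed
      finally show ?thesis by (simp only: mult.commute)
    qed
    finally have "norm ?N \<le> norm ?D * (1 - 3/2 * x)" by (simp add: algebra_simps)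
    then have "norm ?N * norm (?T n t) \<le> norm ?D * (1 - 3/2 * x) * norm (?T n t)"
      by (intro mult_right_mono) auto
    moreover have "norm ?D * norm (?T (Suc n) t) = norm ?N * norm (?T n t)"
      using arg_cong[OF rec, of norm] by (simp only: norm_mult)
    ultimately have "norm ?D * norm (?T (Suc n) t) \<le> norm ?D * (norm (?T n t) * (1 - 3/2 * x))"
      by (simp only: mult_ac)
    moreover have "norm ?D > 0" using Dn by linarith
    ultimately show ?thesis by (simp add: x_def del: norm_mult)
  qed
  have contT: "continuous_on K (?T n)" for n
    unfolding rF43_term_def pochhammer_prod
    by (intro continuous_intros continuous_on_compose2[OF continuous_on_rGamma[of UNIV]] cont) auto
  define C where "C n = (SOME C. \<forall>t\<in>K. norm (?T n t) \<le> C)" for n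
  have C: "norm (?T n t) \<le> C n" if "t \<in> K" for n t
    using someI_ex[OF bdd[OF contT[of n]]] that unfolding C_def by blast
  have n02: "n0 \<ge> 2" using n0 R0 by linarith
  \<comment> \<open>Scaled so that the majorant takes the value |C n0| at n0. The base is n - 1
    rather than n because the factor leading from term n to term n + 1 contains 1/n, as in
    \<open>raabe_step\<close>.\<close>
  define C0 where "C0 = \<bar>C n0\<bar> * (real n0 - 1) powr (3/2)"
  have tail: "norm (?T n t) \<le> C0 * (real n - 1) powr (-3/2)" if "n \<ge> n0" "t \<in> K" for n t
    using that(1)
  proof (induction n rule: dec_induct)
    case base
    have "real n0 - 1 > 0" using n02 by simp
    then have "C0 * (real n0 - 1) powr (-3/2) = \<bar>C n0\<bar>" unfolding C0_def
      by (simp add: powr_add [symmetric] mult.assoc)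
    then show ?case using C[OF that(2), of n0] by linarith
  next
    case (step n)
    have n2: "n \<ge> 2" using step n02 by simp
    have C0: "C0 \<ge> 0" unfolding C0_def by simp
    have "norm (?T (Suc n) t) \<le> norm (?T n t) * (1 - 3/2 / real n)"
      by (rule \<open>\<And>n t. n0 \<le> n \<Longrightarrow> t \<in> K \<Longrightarrow> norm (?T (Suc n) t) \<le> norm (?T n t) * (1 - 3/2 / real n)\<close>) (use step that in auto)
    also have "\<dots> \<le> C0 * (real n - 1) powr (-3/2) * (1 - 3/2 / real n)"
      using step n2 by (intro mult_right_mono) (auto simp: field_simps)
    also have "\<dots> \<le> C0 * real n powr (-3/2)"
      using mult_left_mono[OF raabe_step[OF n2] C0] by (simp only: mult_ac)
    finally show ?case by simp
  qed
  define M where "M n = (if n \<ge> n0 then C0 * (real n - 1) powr (-3/2) else C n)" for n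
  have "summable (\<lambda>n. C0 * real n powr (-3/2))"
    by (intro summable_mult) (simp add: summable_real_powr_iff)
  then have "summable (\<lambda>n. M (n + (n0 + 1)))"
    by (subst (asm) summable_iff_shift[symmetric, of _ n0]) (simp add: M_def add_ac)
  then have "summable M" by (simp only: summable_iff_shift)
  moreover have "norm (?T n t) \<le> M n" if "t \<in> K" for n t
    using tail[of n t] C[of t n] that by (auto simp: M_def)
  ultimately show ?thesis by blast
qed

lemma summable_rF43_term:
  assumes "e + f + g - a - b - c - d = 1"
  shows "summable (rF43_term a b c d e f g)"
proof -
  have "\<exists>M. summable M \<and> (\<forall>n. \<forall>t\<in>{0::complex}. norm (rF43_term a b c d e f g n) \<le> M n)"
    by (rule rF43_term_bound) (use assms in \<open>simp_all only: continuous_on_const compact_sing\<close>)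
  then obtain M where "summable M" "\<And>n. norm (rF43_term a b c d e f g n) \<le> M n"
    by blast
  then show ?thesis by (rule summable_comparison_test'[of M 0])
qed

text \<open>The majorant on closed unit discs and Weierstrass's theorem. Composing with entire
  functions of a single variable covers every restriction of the series to a complex line.\<close>

lemma holomorphic_rF43:
  assumes hol: "a holomorphic_on UNIV" "b holomorphic_on UNIV" "c holomorphic_on UNIV" "d holomorphic_on UNIV"
      "e holomorphic_on UNIV" "f holomorphic_on UNIV" "g holomorphic_on UNIV"
    and bal: "\<And>t. e t + f t + g t - a t - b t - c t - d t = 1"
  shows "(\<lambda>t. rF43 (a t) (b t) (c t) (d t) (e t) (f t) (g t)) holomorphic_on UNIV"
proof (rule holomorphic_uniform_sequence[OF open_UNIV])
  let ?T = "\<lambda>n t. rF43_term (a t) (b t) (c t) (d t) (e t) (f t) (g t) n"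
  show "(\<lambda>t. \<Sum>n<N. ?T n t) holomorphic_on UNIV" for N
    unfolding rF43_term_def pochhammer_prod by (intro holomorphic_intros hol) auto
  fix x :: complex
  have cont: "continuous_on (cball x 1) h" if "h holomorphic_on UNIV" for h
    using holomorphic_on_imp_continuous_on[OF that] continuous_on_subset by blast
  have "\<exists>M. summable M \<and> (\<forall>n. \<forall>t\<in>cball x 1. norm (?T n t) \<le> M n)"
    by (rule rF43_term_bound[OF compact_cball]) (intro cont hol bal)+
  then obtain M where M: "summable M" "\<And>n t. t \<in> cball x 1 \<Longrightarrow> norm (?T n t) \<le> M n"
    by blast
  have "uniform_limit (cball x 1) (\<lambda>N t. \<Sum>n<N. ?T n t) (\<lambda>t. rF43 (a t) (b t) (c t) (d t) (e t) (f t) (g t)) sequentially"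
    unfolding rF43_def by (rule Weierstrass_m_test[OF M(2) M(1)])
  then show "\<exists>r. 0 < r \<and> cball x r \<subseteq> UNIV \<and> uniform_limit (cball x r) (\<lambda>N t. \<Sum>n<N. ?T n t)
              (\<lambda>t. rF43 (a t) (b t) (c t) (d t) (e t) (f t) (g t)) sequentially"
    by (intro exI[of _ 1]) auto
qed

lemma rF43_eq_F43:
  assumes "e \<notin> \<int>\<^sub>\<le>\<^sub>0" "f \<notin> \<int>\<^sub>\<le>\<^sub>0" "g \<notin> \<int>\<^sub>\<le>\<^sub>0" and bal: "e + f + g - a - b - c - d = 1"
  shows "rF43 a b c d e f g = F43 a b c d e f g * (rGamma e * rGamma f * rGamma g)"
proof -
  let ?R = "rGamma e * rGamma f * rGamma g"
  have R: "?R \<noteq> 0" using assms by (simp add: rGamma_eq_zero_iff)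
  have p: "pochhammer z n \<noteq> 0" if "z \<notin> \<int>\<^sub>\<le>\<^sub>0" for z :: complex and n
    using that pochhammer_eq_0_imp_nonpos_Int by blast
  have q: "rGamma (z + of_nat n) = rGamma z / pochhammer z n" if "z \<notin> \<int>\<^sub>\<le>\<^sub>0" for z :: complex and n
    using p[OF that, of n] pochhammer_rGamma[of z n] by (simp add: field_simps)
  have "pochhammer a n * pochhammer b n * pochhammer c n * pochhammer d n /
           (fact n * pochhammer e n * pochhammer f n * pochhammer g n) = rF43_term a b c d e f g n / ?R" for n
    unfolding rF43_term_def q[OF assms(1)] q[OF assms(2)] q[OF assms(3)]
    using R p[OF assms(1), of n] p[OF assms(2), of n] p[OF assms(3), of n] by (simp add: divide_simps)
  then have "F43 a b c d e f g = (\<Sum>n. rF43_term a b c d e f g n / ?R)"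
    unfolding F43_def by simp
  also have "\<dots> = rF43 a b c d e f g / ?R"
    unfolding rF43_def by (rule suminf_divide[OF summable_rF43_term[OF bal]])
  finally show ?thesis by (rule sym[OF iffD1[OF nonzero_eq_divide_eq[OF R]]])
qed

text \<open>The preimages of the integers under finitely many nonconstant affine maps form a closed
  countable set. What is left of \<open>U\<close> is therefore open and, as a disc is uncountable,
  nonempty, and the identity theorem applies. Expressing affinity through the values at 0 and 1
  avoids listing slopes.\<close>

lemma entire_zero_off_integers:
  fixes E :: "complex \<Rightarrow> complex" and \<Phi> :: "(complex \<Rightarrow> complex) list"
  assumes hol: "E holomorphic_on UNIV"
    and affine: "\<forall>\<phi>\<in>set \<Phi>. \<phi> 1 \<noteq> \<phi> 0 \<and> (\<forall>t. \<phi> t = \<phi> 0 + (\<phi> 1 - \<phi> 0) * t)"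
    and U: "open U" "u \<in> U"
    and zero: "\<And>t. t \<in> U \<Longrightarrow> \<forall>\<phi>\<in>set \<Phi>. \<phi> t \<notin> \<int> \<Longrightarrow> E t = 0"
  shows "E t = 0"
proof -
  define Z where "Z = (\<Union>\<phi>\<in>set \<Phi>. (\<lambda>t. \<phi> 0 + (\<phi> 1 - \<phi> 0) * t) -` \<int>)"
  have "closed Z" unfolding Z_def
    by (intro closed_UN finite_set closed_vimage ballI closed_Ints continuous_intros)
  then have op: "open (U - Z)" using U by (simp add: open_Diff)
  have "countable ((\<lambda>t. \<phi> 0 + (\<phi> 1 - \<phi> 0) * t) -` \<int>)" if "\<phi> \<in> set \<Phi>" for \<phi>
  proof (rule countable_subset)
    have "\<phi> 1 - \<phi> 0 \<noteq> 0" using affine that by simp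
    then show "(\<lambda>t. \<phi> 0 + (\<phi> 1 - \<phi> 0) * t) -` \<int> \<subseteq> (\<lambda>n. (of_int n - \<phi> 0) / (\<phi> 1 - \<phi> 0)) ` UNIV"
      by (auto elim!: Ints_cases simp: image_iff field_simps)
    show "countable ((\<lambda>n. (of_int n - \<phi> 0) / (\<phi> 1 - \<phi> 0)) ` (UNIV :: int set))" by simp
  qed
  then have "countable Z" unfolding Z_def by (intro countable_UN) (auto intro: countable_finite)
  moreover obtain r where r: "r > 0" "ball u r \<subseteq> U" using U openE by blast
  moreover have "uncountable (ball u r)" by (rule uncountable_ball[OF r(1)])
  ultimately have ne: "U - Z \<noteq> {}" by (metis Diff_eq_empty_iff countable_subset order_trans)
  have "E w = 0" if w: "w \<in> U - Z" for w
  proof (rule zero)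
    show "w \<in> U" using w by simp
    show "\<forall>\<phi>\<in>set \<Phi>. \<phi> w \<notin> \<int>"
    proof
      fix \<phi> assume \<phi>: "\<phi> \<in> set \<Phi>"
      then have "\<phi> w = \<phi> 0 + (\<phi> 1 - \<phi> 0) * w" using affine by blast
      moreover have "\<phi> 0 + (\<phi> 1 - \<phi> 0) * w \<notin> \<int>" using w \<phi> by (auto simp: Z_def)
      ultimately show "\<phi> w \<notin> \<int>" by simp
    qed
  qed
  then have "E t = (\<lambda>_. 0) t"
    by (rule analytic_continuation_open[OF op open_UNIV ne connected_UNIV subset_UNIV hol holomorphic_on_const _ UNIV_I])
  then show ?thesis .
qed

section \<open>Power asymptotics of Pochhammer symbols and Gamma functions\<close>

text \<open>Read as f(m) ~ l (m+1)^z. The value l = 0 is allowed and then gives only a little-o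
  estimate, which covers reciprocal Gamma factors that vanish. The base \<open>Suc m\<close> is
  never zero, so the bounds derived from it hold from m = 0 on.\<close>

definition asymp_powr :: "(nat \<Rightarrow> complex) \<Rightarrow> complex \<Rightarrow> complex \<Rightarrow> bool" where
  "asymp_powr f z l \<longleftrightarrow> (\<lambda>m. f m * of_nat (Suc m) powr (-z)) \<longlonglongrightarrow> l"

lemma asymp_powr_mult:
  assumes "asymp_powr f z l" "asymp_powr g w k"
  shows "asymp_powr (\<lambda>m. f m * g m) (z + w) (l * k)"
proof -
  have "(\<lambda>m. (f m * of_nat (Suc m) powr (-z)) * (g m * of_nat (Suc m) powr (-w))) \<longlonglongrightarrow> l * k"
    using assms unfolding asymp_powr_def by (rule tendsto_mult)
  moreover have "(f m * of_nat (Suc m) powr (-z)) * (g m * of_nat (Suc m) powr (-w))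
      = f m * g m * of_nat (Suc m) powr (-(z + w))" for m
  proof -
    have "of_nat (Suc m) powr (-z) * of_nat (Suc m) powr (-w) = (of_nat (Suc m) powr (-(z + w)) :: complex)"
      by (simp add: powr_add [symmetric] del: of_nat_Suc)
    then show ?thesis by (metis mult.assoc mult.left_commute)
  qed
  ultimately show ?thesis unfolding asymp_powr_def by (simp only:)
qed

lemma asymp_powr_cmult: "asymp_powr f z l \<Longrightarrow> asymp_powr (\<lambda>m. c * f m) z (c * l)"
  unfolding asymp_powr_def by (simp only: mult.assoc tendsto_mult_left)

lemma asymp_powr_cong: "(\<And>m. f m = g m) \<Longrightarrow> z = w \<Longrightarrow> l = k \<Longrightarrow> asymp_powr f z l \<Longrightarrow> asymp_powr g w k"
  by (simp add: asymp_powr_def)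

lemma asymp_powr_0_iff: "asymp_powr f 0 l \<longleftrightarrow> f \<longlonglongrightarrow> l"
  by (simp add: asymp_powr_def del: of_nat_Suc)

lemma asymp_powr_bound:
  assumes "asymp_powr f z l"
  obtains C where "C > 0" "\<And>m. norm (f m) \<le> C * real (Suc m) powr Re z"
proof -
  from assms have "Bseq (\<lambda>m. f m * of_nat (Suc m) powr (-z))"
    unfolding asymp_powr_def by (intro convergent_imp_Bseq) (auto simp: convergent_def)
  then obtain C where C: "C > 0" "\<And>m. norm (f m * of_nat (Suc m) powr (-z)) \<le> C"
    by (auto simp: Bseq_def)
  have "norm (f m) \<le> C * real (Suc m) powr Re z" for m
  proof -
    have "norm (of_nat (Suc m) powr (-z) :: complex) = real (Suc m) powr (- Re z)"
      using norm_powr_real_powr[of "of_nat (Suc m)" "-z"] by (simp del: of_nat_Suc)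
    then have "norm (f m) * real (Suc m) powr (- Re z) \<le> C" using C(2)[of m] by (simp only: norm_mult)
    then show ?thesis by (simp add: powr_minus field_simps del: of_nat_Suc)
  qed
  with C show ?thesis using that by blast
qed

lemma asymp_powr_linear: "asymp_powr (\<lambda>m. of_nat m + z) 1 1"
proof -
  have "(\<lambda>m. (of_nat m + z) * of_nat (Suc m) powr (-1)) = (\<lambda>m. 1 + (z - 1) * (1 / of_nat (Suc m)))"
  proof
    fix m
    have "(1::complex) + of_nat m \<noteq> 0" using of_nat_neq_0[of m] by simp
    then show "(of_nat m + z) * of_nat (Suc m) powr (-1) = 1 + (z - 1) * (1 / of_nat (Suc m))"
      by (simp add: powr_minus field_simps)
  qed
  moreover have "(\<lambda>m. 1 + (z - 1) * (1 / of_nat (Suc m))) \<longlonglongrightarrow> 1 + (z - 1) * 0"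
    by (intro tendsto_intros LIMSEQ_Suc[OF lim_1_over_n])
  ultimately show ?thesis unfolding asymp_powr_def by simp
qed

lemma asymp_powr_inverse:
  assumes "asymp_powr f z l" "l \<noteq> 0"
  shows "asymp_powr (\<lambda>m. inverse (f m)) (-z) (inverse l)"
proof -
  have "(\<lambda>m. inverse (f m * of_nat (Suc m) powr (-z))) \<longlonglongrightarrow> inverse l"
    using assms unfolding asymp_powr_def by (rule tendsto_inverse)
  then show ?thesis unfolding asymp_powr_def by (simp add: powr_minus del: of_nat_Suc)
qed

text \<open>Gauss's limit formula for 1/Gamma. Its base m may be replaced by m + 1 because ln m - ln
  (m + 1) tends to 0.\<close>

lemma asymp_powr_pochhammer_Suc:
  "asymp_powr (\<lambda>m. pochhammer x (Suc m) / fact m) x (rGamma x)"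
proof -
  have "(\<lambda>m. ln (real m) - ln (real (Suc m))) \<longlonglongrightarrow> 0" by real_asymp
  then have "(\<lambda>m. exp (x * of_real (ln (real m) - ln (real (Suc m))))) \<longlonglongrightarrow> exp (x * of_real 0)"
    by (intro tendsto_intros)
  then have "(\<lambda>m. rGamma_series x m * exp (x * of_real (ln (real m) - ln (real (Suc m))))) \<longlonglongrightarrow> rGamma x * 1"
    by (intro tendsto_mult rGamma_series_LIMSEQ) simp
  moreover have "rGamma_series x m * exp (x * of_real (ln (real m) - ln (real (Suc m))))
      = pochhammer x (Suc m) / fact m * of_nat (Suc m) powr (- x)" for m
  proof -
    have "of_nat (Suc m) powr (- x) = exp (- x * of_real (ln (real (Suc m))))"
      using Ln_of_real[of "real (Suc m)"] by (simp add: powr_def Ln_of_nat del: of_nat_Suc)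
    also have "\<dots> = exp (x * of_real (ln (real m) - ln (real (Suc m)))) / exp (x * of_real (ln (real m)))"
      by (simp add: exp_diff [symmetric] algebra_simps del: of_nat_Suc)
    finally show ?thesis by (simp add: rGamma_series_def field_simps del: of_nat_Suc)
  qed
  ultimately show ?thesis unfolding asymp_powr_def by simp
qed

lemma asymp_powr_pochhammer:
  "asymp_powr (\<lambda>m. pochhammer x m / fact m) (x - 1) (rGamma x)"
proof -
  have "asymp_powr (\<lambda>m. pochhammer x (Suc m) / fact m * inverse (of_nat m + x)) (x + - 1) (rGamma x * inverse 1)"
    by (intro asymp_powr_mult asymp_powr_pochhammer_Suc asymp_powr_inverse asymp_powr_linear) simp
  \<comment> \<open>If x is a nonpositive integer, m + x vanishes for one m, so the factor cancels
    only for large m.\<close>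
  moreover have "eventually (\<lambda>m. pochhammer x (Suc m) / fact m * inverse (of_nat m + x) * of_nat (Suc m) powr - (x + - 1)
      = pochhammer x m / fact m * of_nat (Suc m) powr - (x - 1)) sequentially"
    using eventually_gt_at_top[of "nat \<lceil>norm x\<rceil>"]
  proof eventually_elim
    case (elim m)
    then have "real m > norm x" by linarith
    then have "of_nat m + x \<noteq> 0"
      by (metis add_eq_0_iff less_irrefl norm_minus_cancel norm_of_nat)
    then show ?case by (simp add: pochhammer_Suc add.commute del: of_nat_Suc)
  qed
  ultimately have "(\<lambda>m. pochhammer x m / fact m * of_nat (Suc m) powr - (x - 1)) \<longlonglongrightarrow> rGamma x * inverse 1"
    unfolding asymp_powr_def by (rule Lim_transform_eventually)
  then show ?thesis unfolding asymp_powr_def by simp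
qed

lemma asymp_powr_inverse_pochhammer:
  assumes "x \<notin> \<int>\<^sub>\<le>\<^sub>0"
  shows "asymp_powr (\<lambda>m. fact m / pochhammer x m) (1 - x) (Gamma x)"
  using asymp_powr_inverse[OF asymp_powr_pochhammer[of x]] assms
  by (simp add: rGamma_eq_zero_iff Gamma_def)

lemma asymp_powr_Gamma:
  assumes "x \<notin> \<int>\<^sub>\<le>\<^sub>0"
  shows "asymp_powr (\<lambda>m. Gamma (x + of_nat m) / fact m) (x - 1) 1"
proof -
  have "asymp_powr (\<lambda>m. Gamma x * (pochhammer x m / fact m)) (x - 1) (Gamma x * rGamma x)"
    by (intro asymp_powr_cmult asymp_powr_pochhammer)
  then show ?thesis
    by (rule asymp_powr_cong[rotated 3]) (use assms in \<open>auto simp: pochhammer_Gamma Gamma_eq_zero_iff rGamma_inverse_Gamma\<close>)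
qed

lemma asymp_powr_rGamma:
  assumes "x \<notin> \<int>\<^sub>\<le>\<^sub>0"
  shows "asymp_powr (\<lambda>m. fact m * rGamma (x + of_nat m)) (1 - x) 1"
  using asymp_powr_inverse[OF asymp_powr_Gamma[OF assms]] by (simp add: rGamma_inverse_Gamma field_simps)

lemma summable_Suc_powr: "p < -1 \<Longrightarrow> summable (\<lambda>m. real (Suc m) powr p)"
  by (subst summable_Suc_iff) (simp add: summable_real_powr_iff)

lemma not_Ints_imp_not_nonpos_Ints: "z \<notin> \<int> \<Longrightarrow> z \<notin> \<int>\<^sub>\<le>\<^sub>0"
  using nonpos_Ints_subset_Ints by blast

lemma plus_of_nat_not_nonpos_Ints: "(z :: complex) \<notin> \<int>\<^sub>\<le>\<^sub>0 \<Longrightarrow> z + of_nat n \<notin> \<int>\<^sub>\<le>\<^sub>0"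
  using nonpos_Ints_diff_Nats[of "z + of_nat n" "of_nat n"] by auto

lemma plus_of_nat_nonzero: "(z :: complex) \<notin> \<int>\<^sub>\<le>\<^sub>0 \<Longrightarrow> z + of_nat n \<noteq> 0"
  using plus_of_nat_not_nonpos_Ints[of z n] by auto

lemma asymp_powr_summable:
  assumes "asymp_powr f z l" "Re z < -1"
  shows "summable (\<lambda>n. norm (f n))"
proof -
  obtain C where C: "\<And>m. norm (f m) \<le> C * real (Suc m) powr Re z"
    using asymp_powr_bound[OF assms(1)] by blast
  show ?thesis
  proof (rule summable_comparison_test'[of "\<lambda>m. C * real (Suc m) powr Re z" 0])
    show "summable (\<lambda>m. C * real (Suc m) powr Re z)"
      by (rule summable_mult[OF summable_Suc_powr[OF assms(2)]])
    show "norm (norm (f n)) \<le> C * real (Suc n) powr Re z" for n using C[of n] by simp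
  qed
qed

text \<open>Evaluates a series from a telescoping certificate \<open>G\<close>. In the applications
  the limit of \<open>G\<close> is read off from \<open>asymp_powr\<close> with exponent 0.\<close>

lemma sums_telescope_zero:
  fixes G :: "nat \<Rightarrow> complex"
  assumes "\<And>n. f n = G (Suc n) - G n" "G \<longlonglongrightarrow> l"
  shows "f sums (l - G 0)"
  using telescope_sums[OF assms(2)] assms(1) by presburger

section \<open>Euler's transformation on coefficients, and rearrangement of double series\<close>

text \<open>The coefficient of x^n in 2F1(c,d;e;x).\<close>

definition F21_coeff :: "complex \<Rightarrow> complex \<Rightarrow> complex \<Rightarrow> nat \<Rightarrow> complex" where
  "F21_coeff c d e n = pochhammer c n * pochhammer d n / (pochhammer e n * fact n)"

text \<open>The coefficient of x^n in (1-x)^(-\<gamma>).\<close>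

definition binom_coeff :: "complex \<Rightarrow> nat \<Rightarrow> complex" where
  "binom_coeff \<gamma> n = pochhammer \<gamma> n / fact n"

lemma F21_coeff_Suc:
  assumes "e \<notin> \<int>\<^sub>\<le>\<^sub>0"
  shows "of_nat (Suc n) * (e + of_nat n) * F21_coeff c d e (Suc n) = (c + of_nat n) * (d + of_nat n) * F21_coeff c d e n"
proof -
  have "pochhammer e n \<noteq> 0" "e + of_nat n \<noteq> 0" "(of_nat (Suc n) :: complex) \<noteq> 0"
    using assms plus_of_nat_nonzero by (auto simp: pochhammer_eq_0_iff simp del: of_nat_Suc)
  then show ?thesis unfolding F21_coeff_def pochhammer_Suc fact_Suc
    by (simp add: divide_simps del: of_nat_Suc)
qed

lemma binom_coeff_Suc: "of_nat (Suc n) * binom_coeff \<gamma> (Suc n) = (\<gamma> + of_nat n) * binom_coeff \<gamma> n"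
proof -
  have "(of_nat (Suc n) :: complex) \<noteq> 0" by (simp only: of_nat_eq_0_iff nat.distinct simp_thms)
  then show ?thesis unfolding binom_coeff_def pochhammer_Suc fact_Suc
    by (simp add: divide_simps del: of_nat_Suc)
qed

lemma asymp_powr_F21_coeff:
  assumes "e \<notin> \<int>\<^sub>\<le>\<^sub>0"
  shows "asymp_powr (F21_coeff c d e) (c + d - e - 1) (rGamma c * rGamma d * Gamma e)"
  by (rule asymp_powr_cong[OF _ _ _ asymp_powr_mult[OF asymp_powr_mult[OF
        asymp_powr_pochhammer[of c] asymp_powr_pochhammer[of d]] asymp_powr_inverse_pochhammer[OF assms]]])
     (auto simp: F21_coeff_def field_simps)

lemma asymp_powr_binom_coeff: "asymp_powr (binom_coeff \<gamma>) (\<gamma> - 1) (rGamma \<gamma>)"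
  unfolding binom_coeff_def by (rule asymp_powr_pochhammer)

text \<open>The coefficientwise form of $F(c,d;e;x) = (1-x)^{e-c-d} F(e-c,e-d;e;x)$.\<close>

lemma F21_coeff_Euler:
  assumes e: "e \<notin> \<int>\<^sub>\<le>\<^sub>0"
  shows "F21_coeff c d e n = (\<Sum>j\<le>n. F21_coeff (e - c) (e - d) e j * binom_coeff (c + d - e) (n - j))"
proof (induction n)
  case 0
  show ?case by (simp add: F21_coeff_def binom_coeff_def)
next
  case (Suc n)
  let ?f = "F21_coeff (e - c) (e - d) e" and ?p = "binom_coeff (c + d - e)"
  \<comment> \<open>A creative-telescoping certificate: the recurrence in n of
    \<open>F21_coeff_Suc\<close>, applied to the summand of the convolution, gives G (j+1) - G j.
    Summation over j then yields that recurrence for the convolution itself.\<close>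
  define G where "G j = - (of_nat j * (e + of_nat j - 1)) * ?f j * ?p (Suc n - j)" for j
  define S where "S m = (\<Sum>j\<le>m. ?f j * ?p (m - j))" for m
  have "of_nat (Suc n) * (e + of_nat n) * (?f j * ?p (Suc n - j)) - (c + of_nat n) * (d + of_nat n) * (?f j * ?p (n - j))
      = G (Suc j) - G j" if jn: "j \<le> n" for j
  proof -
    obtain k where n: "n = j + k" using le_Suc_ex[OF jn] by blast
    have 1: "G (Suc j) = - ((e - c + of_nat j) * (e - d + of_nat j)) * ?f j * ?p k"
    proof -
      have "e + of_nat (Suc j) - 1 = e + of_nat j" "Suc n - Suc j = k" using n by auto
      then have "G (Suc j) = - (of_nat (Suc j) * (e + of_nat j) * ?f (Suc j)) * ?p k"
        unfolding G_def by (simp only: minus_mult_left mult_ac)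
      then show ?thesis unfolding F21_coeff_Suc[OF e] by (simp only: minus_mult_left)
    qed
    have 2: "of_nat (Suc k) * ?p (Suc k) = (c + d - e + of_nat k) * ?p k" by (rule binom_coeff_Suc)
    have k: "(of_nat (Suc k) :: complex) \<noteq> 0" by (simp only: of_nat_eq_0_iff nat.distinct simp_thms)
    have s: "Suc (j + k) - j = Suc k" "j + k - j = k" by auto
    have "of_nat (Suc k) * (of_nat (Suc n) * (e + of_nat n) * (?f j * ?p (Suc n - j)) - (c + of_nat n) * (d + of_nat n) * (?f j * ?p (n - j)))
      = of_nat (Suc n) * (e + of_nat n) * ?f j * (of_nat (Suc k) * ?p (Suc k)) - of_nat (Suc k) * (c + of_nat n) * (d + of_nat n) * ?f j * ?p k"
      unfolding n s by (simp only: right_diff_distrib mult_ac)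
    also have "\<dots> = ?f j * ?p k * (of_nat (Suc n) * (e + of_nat n) * (c + d - e + of_nat k) - of_nat (Suc k) * (c + of_nat n) * (d + of_nat n))"
      unfolding 2 by (simp only: right_diff_distrib mult_ac)
    also have "of_nat (Suc n) * (e + of_nat n) * (c + d - e + of_nat k) - of_nat (Suc k) * (c + of_nat n) * (d + of_nat n)
       = - (of_nat (Suc k) * ((e - c + of_nat j) * (e - d + of_nat j))) + of_nat j * (e + of_nat j - 1) * (c + d - e + of_nat k)"
      unfolding n by (simp add: algebra_simps)
    also have "?f j * ?p k * \<dots> = - (of_nat (Suc k) * ((e - c + of_nat j) * (e - d + of_nat j))) * ?f j * ?p k
         + of_nat j * (e + of_nat j - 1) * ?f j * (of_nat (Suc k) * ?p (Suc k))"
      unfolding 2 by (simp add: algebra_simps del: of_nat_Suc)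
    also have "\<dots> = of_nat (Suc k) * (G (Suc j) - G j)"
      unfolding 1 unfolding G_def n s by (simp add: algebra_simps del: of_nat_Suc)
    finally show ?thesis using k by (simp del: of_nat_Suc)
  qed
  then have "(\<Sum>j\<le>n. of_nat (Suc n) * (e + of_nat n) * (?f j * ?p (Suc n - j)) - (c + of_nat n) * (d + of_nat n) * (?f j * ?p (n - j)))
     = (\<Sum>j\<le>n. G (Suc j) - G j)" by (intro sum.cong) auto
  also have "\<dots> = G (Suc n) - G 0" 
  proof -
    have "(\<Sum>j\<le>m. G (Suc j) - G j) = G (Suc m) - G 0" for m by (induction m) simp_all
    then show ?thesis .
  qed
  finally have "of_nat (Suc n) * (e + of_nat n) * (\<Sum>j\<le>n. ?f j * ?p (Suc n - j)) - (c + of_nat n) * (d + of_nat n) * S n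
     = G (Suc n) - G 0"
    by (simp only: sum_subtractf sum_distrib_left S_def)
  \<comment> \<open>The telescoped sum stops at j = n, whereas \<open>S (Suc n)\<close> has one more
    term, j = n + 1. The boundary value \<open>G (Suc n)\<close> accounts for exactly this
    term.\<close>
  moreover have "(\<Sum>j\<le>n. ?f j * ?p (Suc n - j)) = S (Suc n) - ?f (Suc n)"
    by (simp add: S_def binom_coeff_def)
  moreover have "G (Suc n) - G 0 = - (of_nat (Suc n) * (e + of_nat n)) * ?f (Suc n)"
    by (simp add: G_def binom_coeff_def add.assoc)
  ultimately have "of_nat (Suc n) * (e + of_nat n) * (S (Suc n) - ?f (Suc n)) - (c + of_nat n) * (d + of_nat n) * S n
     = - (of_nat (Suc n) * (e + of_nat n)) * ?f (Suc n)" by simp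
  then have "of_nat (Suc n) * (e + of_nat n) * S (Suc n) = (c + of_nat n) * (d + of_nat n) * S n"
    by (simp add: algebra_simps)
  also have "\<dots> = of_nat (Suc n) * (e + of_nat n) * F21_coeff c d e (Suc n)"
    unfolding F21_coeff_Suc[OF e] S_def Suc.IH ..
  finally have "S (Suc n) = F21_coeff c d e (Suc n)"
    using plus_of_nat_nonzero[OF e, of n] of_nat_neq_0[of n, where 'a = complex] by (simp del: of_nat_Suc)
  then show ?case by (simp only: S_def)
qed

text \<open>A product majorant gives absolute summability over pairs, where rearrangement is a
  matter of bijections; the results are then translated back to iterated \<open>suminf\<close>. The
  diagonal form is the one that fits a Cauchy product such as
  \<open>F21_coeff_Euler\<close>.\<close>

lemma double_suminf:
  fixes A :: "nat \<Rightarrow> nat \<Rightarrow> complex"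
  assumes le: "\<And>j k. norm (A j k) \<le> u j * v k" and u: "summable u" and v: "summable v"
    and nonneg: "\<And>j. u j \<ge> 0" "\<And>k. v k \<ge> 0"
  shows suminf_swap: "(\<Sum>j. \<Sum>k. A j k) = (\<Sum>k. \<Sum>j. A j k)"
    and suminf_diagonal: "(\<Sum>n. \<Sum>j\<le>n. A j (n - j)) = (\<Sum>j. \<Sum>k. A j k)"
    and summable_outer: "summable (\<lambda>j. \<Sum>k. A j k)"
proof -
  have us: "u summable_on UNIV" and vs: "v summable_on UNIV"
    using u v nonneg by (auto intro: summable_nonneg_imp_summable_on)
  have "(\<lambda>p. u (fst p) * v (snd p)) summable_on UNIV \<times> UNIV"
    by (rule summable_on_SigmaI[where g = "\<lambda>j. u j * infsum v UNIV"])
       (use us vs nonneg in \<open>auto intro!: has_sum_cmult_right summable_on_cmult_left\<close>)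
  then have "(\<lambda>p. norm (A (fst p) (snd p))) summable_on UNIV \<times> UNIV"
    by (rule summable_on_comparison_test) (rule le norm_ge_zero)+
  then have A: "(\<lambda>(j, k). A j k) summable_on UNIV \<times> UNIV"
    unfolding case_prod_beta by (rule abs_summable_summable)
  have row: "A j summable_on UNIV" for j
    using summable_on_SigmaD1[of "\<lambda>j k. A j k" UNIV "\<lambda>_. UNIV" j] A by simp
  have A': "(\<lambda>(k, j). A j k) summable_on UNIV \<times> UNIV"
    using A summable_on_reindex_bij_betw[of prod.swap "UNIV \<times> UNIV" "UNIV \<times> UNIV" "\<lambda>(j, k). A j k"]
    unfolding case_prod_beta by simp
  have col: "(\<lambda>j. A j k) summable_on UNIV" for k
    using summable_on_SigmaD1[of "\<lambda>k j. A j k" UNIV "\<lambda>_. UNIV" k] A' by simp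
  have suminf: "suminf h = infsum h UNIV" if "h summable_on UNIV" for h :: "nat \<Rightarrow> complex"
    using has_sum_imp_sums[OF has_sum_infsum[OF that]] by (simp add: sums_iff)
  have rows: "(\<lambda>j. \<Sum>\<^sub>\<infinity>k. A j k) summable_on UNIV" by (rule summable_on_Sigma_banach[OF A])
  have cols: "(\<lambda>k. \<Sum>\<^sub>\<infinity>j. A j k) summable_on UNIV" by (rule summable_on_Sigma_banach[OF A'])
  show "summable (\<lambda>j. \<Sum>k. A j k)" using summable_on_imp_summable[OF rows] by (simp add: suminf row)
  show "(\<Sum>j. \<Sum>k. A j k) = (\<Sum>k. \<Sum>j. A j k)"
    using infsum_swap_banach[OF A] by (simp add: suminf row col rows cols)
  have bij: "bij_betw (\<lambda>(n, j). (j, n - j)) (Sigma UNIV (\<lambda>n. {..n})) (UNIV \<times> (UNIV :: nat set))"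
    by (rule bij_betwI[where g = "\<lambda>(j, k). (j + k, j)"]) auto
  have D: "(\<lambda>(n, j). A j (n - j)) summable_on Sigma UNIV (\<lambda>n. {..n})"
    using summable_on_reindex_bij_betw[OF bij, of "\<lambda>(j, k). A j k"] A unfolding case_prod_beta by simp
  have "(\<Sum>n. \<Sum>j\<le>n. A j (n - j)) = (\<Sum>\<^sub>\<infinity>n. \<Sum>\<^sub>\<infinity>j\<in>{..n}. A j (n - j))"
    using suminf[OF summable_on_Sigma_banach[OF D]] by simp
  also have "\<dots> = infsum (\<lambda>(n, j). A j (n - j)) (Sigma UNIV (\<lambda>n. {..n}))"
    by (rule infsum_Sigma'_banach[OF D])
  also have "\<dots> = infsum (\<lambda>(j, k). A j k) (UNIV \<times> UNIV)"
    using infsum_reindex_bij_betw[OF bij, of "\<lambda>(j, k). A j k"] unfolding case_prod_beta by simp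
  also have "\<dots> = (\<Sum>j. \<Sum>k. A j k)"
    using infsum_Sigma'_banach[OF A] by (simp add: suminf row rows)
  finally show "(\<Sum>n. \<Sum>j\<le>n. A j (n - j)) = (\<Sum>j. \<Sum>k. A j k)" .
qed

section \<open>The nonterminating Saalschuetz theorem\<close>

lemma rGamma_Suc: "rGamma (z + of_nat n) = (z + of_nat n) * rGamma (z + of_nat (Suc n))" for z :: complex
  using rGamma_plus1[of "z + of_nat n"] by (simp add: add_ac)

lemma Gamma_Suc: "z \<notin> \<int>\<^sub>\<le>\<^sub>0 \<Longrightarrow> Gamma (z + of_nat (Suc n)) = (z + of_nat n) * Gamma (z + of_nat n)" for z :: complex
  using Gamma_plus1[OF plus_of_nat_not_nonpos_Ints[of z n]] by (simp add: add_ac)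

text \<open>At s = a + n this is the part of the n-th 4F3 term that carries two upper and two lower
  parameters, written as a function of one shifted variable.\<close>

definition gamma_quot :: "complex \<Rightarrow> complex \<Rightarrow> complex \<Rightarrow> complex \<Rightarrow> complex" where
  "gamma_quot r p q s = Gamma s * Gamma (s + 1 - r) * rGamma (s + 1 - p) * rGamma (s + 1 - q)"

text \<open>Formally Beta(s, 1-\<gamma>) / Gamma(1-\<gamma>), that is, up to a constant the integral
  of x^(s-1) (1-x)^(-\<gamma>) over [0,1].\<close>

definition beta_quot :: "complex \<Rightarrow> complex \<Rightarrow> complex" where
  "beta_quot \<gamma> s = Gamma s * rGamma (s + 1 - \<gamma>)"

lemma gamma_quot_Suc:
  assumes "s \<notin> \<int>\<^sub>\<le>\<^sub>0" "s + 1 - r \<notin> \<int>\<^sub>\<le>\<^sub>0"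
  shows "(s + of_nat (Suc k) - p) * (s + of_nat (Suc k) - q) * gamma_quot r p q (s + of_nat (Suc k))
       = (s + of_nat k) * (s + of_nat (Suc k) - r) * gamma_quot r p q (s + of_nat k)"
proof -
  have e: "s + of_nat (Suc k) + 1 - z = (s + 1 - z) + of_nat (Suc k)"
          "s + of_nat k + 1 - z = (s + 1 - z) + of_nat k"
          "s + of_nat (Suc k) - z = (s + 1 - z) + of_nat k" for z by simp_all
  show ?thesis
    unfolding gamma_quot_def e Gamma_Suc[OF assms(1)] Gamma_Suc[OF assms(2)] 
      rGamma_Suc[of "s + 1 - p" k] rGamma_Suc[of "s + 1 - q" k]
    by (simp only: mult_ac)
qed

lemma beta_quot_Suc:
  assumes "s \<notin> \<int>\<^sub>\<le>\<^sub>0"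
  shows "(s + of_nat (Suc k) - \<gamma>) * beta_quot \<gamma> (s + of_nat (Suc k)) = (s + of_nat k) * beta_quot \<gamma> (s + of_nat k)"
proof -
  have e: "s + of_nat (Suc k) + 1 - z = (s + 1 - z) + of_nat (Suc k)"
          "s + of_nat k + 1 - z = (s + 1 - z) + of_nat k"
          "s + of_nat (Suc k) - z = (s + 1 - z) + of_nat k" for z by simp_all
  show ?thesis
    unfolding beta_quot_def e Gamma_Suc[OF assms(1)] rGamma_Suc[of "s + 1 - \<gamma>" k]
    by (simp only: mult_ac)
qed

lemma asymp_powr_gamma_quot:
  assumes "s \<notin> \<int>\<^sub>\<le>\<^sub>0" "s + 1 - r \<notin> \<int>\<^sub>\<le>\<^sub>0" "s
        + 1 - p \<notin> \<int>\<^sub>\<le>\<^sub>0" "s + 1 - q \<notin> \<int>\<^sub>\<le>\<^sub>0"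
  shows "asymp_powr (\<lambda>k. gamma_quot r p q (s + of_nat k)) (p + q - r - 1) 1"
  by (rule asymp_powr_cong[OF _ _ _ asymp_powr_mult[OF asymp_powr_mult[OF
       asymp_powr_Gamma[OF assms(1)] asymp_powr_Gamma[OF assms(2)]] asymp_powr_mult[OF
       asymp_powr_rGamma[OF assms(3)] asymp_powr_rGamma[OF assms(4)]]]])
     (simp_all add: gamma_quot_def algebra_simps)

lemma asymp_powr_beta_quot:
  assumes "s \<notin> \<int>\<^sub>\<le>\<^sub>0" "s + 1 - \<gamma> \<notin> \<int>\<^sub>\<le>\<^sub>0"
  shows "asymp_powr (\<lambda>k. beta_quot \<gamma> (s + of_nat k)) (\<gamma> - 1) 1"
  by (rule asymp_powr_cong[OF _ _ _ asymp_powr_mult[OF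
       asymp_powr_Gamma[OF assms(1)] asymp_powr_rGamma[OF assms(2)]]])
     (simp_all add: beta_quot_def algebra_simps)

text \<open>\<open>Qsum\<close> and \<open>Ysum\<close> satisfy the same first-order recurrence in \<open>s\<close> up to the constants on the
  right-hand sides, so a suitable combination is a constant multiple of \<open>gamma_quot r (r - p) (r - q)\<close>;
  the constant is read off at \<open>s = r\<close>.\<close>

definition Qsum :: "complex \<Rightarrow> complex \<Rightarrow> complex \<Rightarrow> complex \<Rightarrow> complex" where
  "Qsum r p q s = (\<Sum>k. binom_coeff (r - p - q) k * gamma_quot r p q (s + of_nat k))"

definition Ysum :: "complex \<Rightarrow> complex \<Rightarrow> complex \<Rightarrow> complex \<Rightarrow> complex" where
  "Ysum r p q s = (\<Sum>m. F21_coeff p q r m * beta_quot (r - p - q) (s + of_nat m))"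

lemma summable_Qsum:
  assumes "s \<notin> \<int>\<^sub>\<le>\<^sub>0" "s + 1 - r \<notin> \<int>\<^sub>\<le>\<^sub>0" "s
        + 1 - p \<notin> \<int>\<^sub>\<le>\<^sub>0" "s + 1 - q \<notin> \<int>\<^sub>\<le>\<^sub>0"
  shows "summable (\<lambda>k. binom_coeff (r - p - q) k * gamma_quot r p q (s + of_nat k))"
  using asymp_powr_mult[OF asymp_powr_binom_coeff asymp_powr_gamma_quot[OF assms], of "r - p - q"]
  by (intro summable_norm_cancel[OF asymp_powr_summable[of _ "-2"]]) simp_all

lemma summable_Ysum:
  assumes "r \<notin> \<int>\<^sub>\<le>\<^sub>0" "s \<notin> \<int>\<^sub>\<le>\<^sub>0" "s + 1 - (r - p - q) \<notin> \<int>\<^sub>\<le>\<^sub>0"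
  shows "summable (\<lambda>m. F21_coeff p q r m * beta_quot (r - p - q) (s + of_nat m))"
  using asymp_powr_mult[OF asymp_powr_F21_coeff[OF assms(1), of p q] asymp_powr_beta_quot[OF assms(2,3)]]
  by (intro summable_norm_cancel[OF asymp_powr_summable[of _ "-2"]]) simp_all

text \<open>The terms are of order k^(-2) and the certificate multiplies them by a quadratic
  polynomial in k. It therefore starts at 0 and has a finite limit, and this limit is the
  inhomogeneity.\<close>

lemma Qsum_rec:
  assumes s: "s \<notin> \<int>\<^sub>\<le>\<^sub>0" "s + 1 - r \<notin> \<int>\<^sub>\<le>\<^sub>0" "s
        + 1 - p \<notin> \<int>\<^sub>\<le>\<^sub>0" "s + 1 - q \<notin> \<int>\<^sub>\<le>\<^sub>0"
  shows "s * (s + 1 - r) * Qsum r p q s - (s + 1 - r + p) * (s + 1 - r + q) * Qsum r p q (s + 1) = rGamma (r - p - q)"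
proof -
  let ?\<gamma> = "r - p - q"
  let ?T = "\<lambda>s k. binom_coeff ?\<gamma> k * gamma_quot r p q (s + of_nat k)"
  define G where "G k = of_nat k * (of_nat k + (2 * s + 1 - r)) * ?T s k" for k
  have "s * (s + 1 - r) * ?T s k - (s + 1 - r + p) * (s + 1 - r + q) * ?T (s + 1) k = G (Suc k) - G k" for k
  proof -
    \<comment> \<open>Taking a common factor out of two neighbouring values of
      \<open>gamma_quot\<close> leaves a purely polynomial identity, \<open>alg\<close>.\<close>
    define X where "X = gamma_quot r p q (s + of_nat k) / ((s + of_nat (Suc k) - p) * (s + of_nat (Suc k) - q))"
    have ne: "s + of_nat (Suc k) - p \<noteq> 0" "s + of_nat (Suc k) - q \<noteq> 0"
      using plus_of_nat_nonzero[OF s(3), of k] plus_of_nat_nonzero[OF s(4), of k] by (simp_all add: algebra_simps)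
    have q0: "gamma_quot r p q (s + of_nat k) = (s + of_nat (Suc k) - p) * (s + of_nat (Suc k) - q) * X"
      using ne by (simp add: X_def del: of_nat_Suc)
    have q1: "gamma_quot r p q (s + of_nat (Suc k)) = (s + of_nat k) * (s + of_nat (Suc k) - r) * X"
      using gamma_quot_Suc[OF s(1,2), of k p q] ne unfolding X_def
      by (metis nonzero_eq_divide_eq times_divide_eq_right mult.commute no_zero_divisors)
    have q1': "gamma_quot r p q (s + 1 + of_nat k) = (s + of_nat k) * (s + of_nat (Suc k) - r) * X"
      using q1 by (simp add: add_ac)
    have "G (Suc k) = (of_nat (Suc k) + (2 * s + 1 - r)) * (of_nat (Suc k) * binom_coeff ?\<gamma> (Suc k)) * gamma_quot r p q (s + of_nat (Suc k))"
      by (simp only: G_def mult_ac)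
    then have G1: "G (Suc k) = (of_nat (Suc k) + (2 * s + 1 - r)) * ((?\<gamma> + of_nat k) * binom_coeff ?\<gamma> k) * ((s + of_nat k) * (s + of_nat (Suc k) - r) * X)"
      by (simp only: binom_coeff_Suc q1)
    have alg: "s * (s + 1 - r) * (B * ((s + K1 - p) * (s + K1 - q) * Y)) - (s + 1 - r + p) * (s + 1 - r + q) * (B * ((s + K) * (s + K1 - r) * Y))
        = (K1 + (2 * s + 1 - r)) * ((?\<gamma> + K) * B) * ((s + K) * (s + K1 - r) * Y)
         - K * (K + (2 * s + 1 - r)) * (B * ((s + K1 - p) * (s + K1 - q) * Y))"
      if "K1 = 1 + K" for K K1 B Y :: complex
      unfolding that by algebra
    show ?thesis
      unfolding G1 unfolding G_def q0 q1' by (rule alg) simp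
  qed
  moreover have "G \<longlonglongrightarrow> rGamma ?\<gamma>"
    unfolding asymp_powr_0_iff [symmetric]
    by (rule asymp_powr_cong[OF _ _ _ asymp_powr_mult[OF asymp_powr_mult[OF
          asymp_powr_linear[of 0] asymp_powr_linear[of "2 * s + 1 - r"]] asymp_powr_mult[OF
          asymp_powr_binom_coeff[of ?\<gamma>] asymp_powr_gamma_quot[OF s]]]]) (simp_all add: G_def)
  ultimately have "(\<lambda>k. s * (s + 1 - r) * ?T s k - (s + 1 - r + p) * (s + 1 - r + q) * ?T (s + 1) k) sums (rGamma ?\<gamma> - G 0)"
    by (rule sums_telescope_zero)
  moreover have "(\<lambda>k. s * (s + 1 - r) * ?T s k - (s + 1 - r + p) * (s + 1 - r + q) * ?T (s + 1) k) sums
      (s * (s + 1 - r) * Qsum r p q s - (s + 1 - r + p) * (s + 1 - r + q) * Qsum r p q (s + 1))"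
    unfolding Qsum_def
    by (intro sums_diff sums_mult summable_sums summable_Qsum s)
       (use s plus_of_nat_not_nonpos_Ints[of _ 1] in \<open>force simp: algebra_simps\<close>)+
  moreover have "rGamma ?\<gamma> - G 0 = rGamma ?\<gamma>" by (simp add: G_def)
  ultimately show ?thesis using sums_unique2 by force
qed

lemma Ysum_rec:
  assumes r: "r \<notin> \<int>\<^sub>\<le>\<^sub>0" and s: "s \<notin> \<int>\<^sub>\<le>\<^sub>0" "s + 1 - (r - p - q) \<notin> \<int>\<^sub>\<le>\<^sub>0"
  shows "s * (s + 1 - r) * Ysum r p q s - (s + 1 - r + p) * (s + 1 - r + q) * Ysum r p q (s + 1)
     = - (Gamma r * rGamma p * rGamma q)"
proof -
  let ?\<gamma> = "r - p - q"
  let ?T = "\<lambda>s k. F21_coeff p q r k * beta_quot ?\<gamma> (s + of_nat k)"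
  \<comment> \<open>At k + 1 the factor k (k + r - 1) becomes the one on the left of
    \<open>F21_coeff_Suc\<close>, so \<open>G (Suc k)\<close> can be expressed through the k-th
    coefficient.\<close>
  define G where "G k = - (of_nat k * (of_nat k + (r - 1)) * ?T s k)" for k
  have "s * (s + 1 - r) * ?T s k - (s + 1 - r + p) * (s + 1 - r + q) * ?T (s + 1) k = G (Suc k) - G k" for k
  proof -
    define X where "X = beta_quot ?\<gamma> (s + of_nat k) / (s + of_nat (Suc k) - ?\<gamma>)"
    have ne: "s + of_nat (Suc k) - ?\<gamma> \<noteq> 0"
      using plus_of_nat_nonzero[OF s(2), of k] by (simp add: algebra_simps)
    have q0: "beta_quot ?\<gamma> (s + of_nat k) = (s + of_nat (Suc k) - ?\<gamma>) * X"
      using ne by (simp add: X_def del: of_nat_Suc)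
    have q1: "beta_quot ?\<gamma> (s + of_nat (Suc k)) = (s + of_nat k) * X"
      using beta_quot_Suc[OF s(1), of k ?\<gamma>] ne unfolding X_def by (metis nonzero_eq_divide_eq times_divide_eq_right mult.commute)
    have q1': "beta_quot ?\<gamma> (s + 1 + of_nat k) = (s + of_nat k) * X"
      using q1 by (simp add: add_ac)
    have "G (Suc k) = - ((of_nat (Suc k) * (r + of_nat k) * F21_coeff p q r (Suc k)) * beta_quot ?\<gamma> (s + of_nat (Suc k)))"
      by (simp add: G_def add_ac)
    then have G1: "G (Suc k) = - (((p + of_nat k) * (q + of_nat k) * F21_coeff p q r k) * ((s + of_nat k) * X))"
      by (simp only: F21_coeff_Suc[OF r] q1)
    have alg: "s * (s + 1 - r) * (F * ((s + K1 - ?\<gamma>) * Y)) - (s + 1 - r + p) * (s + 1 - r + q) * (F * ((s + K) * Y))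
        = - (((p + K) * (q + K) * F) * ((s + K) * Y)) - - (K * (K + (r - 1)) * (F * ((s + K1 - ?\<gamma>) * Y)))"
      if "K1 = 1 + K" for K K1 F Y :: complex
      unfolding that by algebra
    show ?thesis
      unfolding G1 unfolding G_def q0 q1' by (rule alg) simp
  qed
  moreover have "G \<longlonglongrightarrow> - (Gamma r * rGamma p * rGamma q)"
    unfolding asymp_powr_0_iff [symmetric]
    by (rule asymp_powr_cong[OF _ _ _ asymp_powr_cmult[of _ _ _ "-1", OF asymp_powr_mult[OF asymp_powr_mult[OF
          asymp_powr_linear[of 0] asymp_powr_linear[of "r - 1"]] asymp_powr_mult[OF
          asymp_powr_F21_coeff[OF r, of p q] asymp_powr_beta_quot[OF s]]]]]) (simp_all add: G_def)
  ultimately have "(\<lambda>k. s * (s + 1 - r) * ?T s k - (s + 1 - r + p) * (s + 1 - r + q) * ?T (s + 1) k) sums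
      (- (Gamma r * rGamma p * rGamma q) - G 0)"
    by (rule sums_telescope_zero)
  moreover have "(\<lambda>k. s * (s + 1 - r) * ?T s k - (s + 1 - r + p) * (s + 1 - r + q) * ?T (s + 1) k) sums
      (s * (s + 1 - r) * Ysum r p q s - (s + 1 - r + p) * (s + 1 - r + q) * Ysum r p q (s + 1))"
    unfolding Ysum_def
    by (intro sums_diff sums_mult summable_sums summable_Ysum r s)
       (use s plus_of_nat_not_nonpos_Ints[of _ 1] in \<open>force simp: algebra_simps\<close>)+
  moreover have "- (Gamma r * rGamma p * rGamma q) - G 0 = - (Gamma r * rGamma p * rGamma q)" by (simp add: G_def)
  ultimately show ?thesis using sums_unique2 by force
qed

text \<open>At s = r the factor Gamma(s + k + 1 - r) is k! and cancels the factorial in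
  \<open>binom_coeff\<close>. What remains can be summed in closed form by telescoping.\<close>

lemma Qsum_at_r:
  assumes r: "r \<notin> \<int>\<^sub>\<le>\<^sub>0" "r + 1 - p \<notin> \<int>\<^sub>\<le>\<^sub>0" "r + 1 - q \<notin> \<int>\<^sub>\<le>\<^sub>0"
  shows "- (p * q) * Qsum r p q r = rGamma (r - p - q) - Gamma r * rGamma (r - p) * rGamma (r - q)"
proof -
  let ?\<gamma> = "r - p - q"
  let ?T = "\<lambda>k. binom_coeff ?\<gamma> k * gamma_quot r p q (r + of_nat k)"
  have 1: "r + 1 - r \<notin> \<int>\<^sub>\<le>\<^sub>0" by simp
  define G where "G k = (of_nat k + (r - p)) * (of_nat k + (r - q)) * ?T k" for k
  have "- (p * q) * ?T k = G (Suc k) - G k" for k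
  proof -
    have "G (Suc k) = binom_coeff ?\<gamma> (Suc k) * ((r + of_nat (Suc k) - p) * (r + of_nat (Suc k) - q) * gamma_quot r p q (r + of_nat (Suc k)))"
      by (simp add: G_def algebra_simps)
    also have "\<dots> = (r + of_nat k) * (of_nat (Suc k) * binom_coeff ?\<gamma> (Suc k)) * gamma_quot r p q (r + of_nat k)"
      unfolding gamma_quot_Suc[OF r(1) 1] by (simp add: mult_ac)
    also have "\<dots> = (r + of_nat k) * (?\<gamma> + of_nat k) * ?T k"
      unfolding binom_coeff_Suc by (simp only: mult_ac)
    finally have "G (Suc k) - G k = ((r + of_nat k) * (?\<gamma> + of_nat k) - (of_nat k + (r - p)) * (of_nat k + (r - q))) * ?T k"
      by (simp only: G_def left_diff_distrib)
    also have "(r + of_nat k) * (?\<gamma> + of_nat k) - (of_nat k + (r - p)) * (of_nat k + (r - q)) = - (p * q)"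
      by (simp add: algebra_simps)
    finally show ?thesis by simp
  qed
  moreover have "G \<longlonglongrightarrow> rGamma ?\<gamma>"
    unfolding asymp_powr_0_iff [symmetric]
    by (rule asymp_powr_cong[OF _ _ _ asymp_powr_mult[OF asymp_powr_mult[OF
          asymp_powr_linear[of "r - p"] asymp_powr_linear[of "r - q"]] asymp_powr_mult[OF
          asymp_powr_binom_coeff[of ?\<gamma>] asymp_powr_gamma_quot[OF r(1) 1 r(2,3)]]]]) (simp_all add: G_def)
  ultimately have "(\<lambda>k. - (p * q) * ?T k) sums (rGamma ?\<gamma> - G 0)"
    by (rule sums_telescope_zero)
  moreover have "(\<lambda>k. - (p * q) * ?T k) sums (- (p * q) * Qsum r p q r)"
    unfolding Qsum_def by (intro sums_mult summable_sums summable_Qsum r 1)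
  moreover have "G 0 = Gamma r * rGamma (r - p) * rGamma (r - q)"
  proof -
    have "rGamma (r - z) = (r - z) * rGamma (r + 1 - z)" for z
      using rGamma_plus1[of "r - z"] by (simp add: algebra_simps)
    from this[of p] this[of q] show ?thesis
      by (simp add: G_def gamma_quot_def binom_coeff_def)
  qed
  ultimately show ?thesis using sums_unique2 by force
qed

lemma asymp_powr_tendsto_0:
  assumes "asymp_powr f z l" "Re z < 0"
  shows "f \<longlonglongrightarrow> 0"
proof -
  obtain C where C: "\<And>m. norm (f m) \<le> C * real (Suc m) powr Re z"
    using asymp_powr_bound[OF assms(1)] by blast
  have "(\<lambda>m. real (Suc m) powr Re z) \<longlonglongrightarrow> 0"
    using assms(2) by (intro tendsto_neg_powr filterlim_compose[OF filterlim_real_sequentially filterlim_Suc])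
  then have "(\<lambda>m. C * real (Suc m) powr Re z) \<longlonglongrightarrow> 0" by (rule tendsto_mult_right_zero)
  then show ?thesis by (rule Lim_null_comparison[rotated]) (simp add: C del: of_nat_Suc)
qed

text \<open>The majorant, uniform in n, for applying Tannery's theorem to the quotient of
  \<open>Qsum\<close> and \<open>gamma_quot\<close>. The exponent on the right is below -1 for every
  positive g; the two regimes meet at g = 1.\<close>

lemma powr_bound_Qsum:
  fixes g :: real
  assumes "g > 0"
  shows "real (Suc k) powr (g - 1) * real (Suc (n + k)) powr (- g - 1) * real (Suc n) powr (1 - g)
     \<le> real (Suc k) powr (- 2 + max 0 (1 - g))"
proof (cases "g \<ge> 1")
  case True
  have "real (Suc (n + k)) powr (- g - 1) * real (Suc n) powr (1 - g) \<le> real (Suc k) powr (- g - 1) * 1"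
  proof (intro mult_mono)
    show "real (Suc (n + k)) powr (- g - 1) \<le> real (Suc k) powr (- g - 1)"
      using True by (intro powr_mono2') auto
    show "real (Suc n) powr (1 - g) \<le> 1"
      using True powr_mono[of "1 - g" 0 "real (Suc n)"] by simp
  qed auto
  from mult_left_mono[OF this, of "real (Suc k) powr (g - 1)"] show ?thesis
    using True by (simp add: powr_add [symmetric] mult.assoc del: of_nat_Suc)
next
  case False
  have "real (Suc (n + k)) powr (- g - 1) * real (Suc n) powr (1 - g)
      \<le> real (Suc (n + k)) powr (- g - 1) * real (Suc (n + k)) powr (1 - g)"
    using False by (intro mult_left_mono powr_mono2) auto
  also have "\<dots> = real (Suc (n + k)) powr (- 2 * g)" by (simp add: powr_add [symmetric] del: of_nat_Suc)
  also have "\<dots> \<le> real (Suc k) powr (- 2 * g)" using assms by (intro powr_mono2') auto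
  finally have "real (Suc (n + k)) powr (- g - 1) * real (Suc n) powr (1 - g) \<le> real (Suc k) powr (- 2 * g)" .
  then have "real (Suc k) powr (g - 1) * (real (Suc (n + k)) powr (- g - 1) * real (Suc n) powr (1 - g)) \<le> real (Suc k) powr (g - 1) * real (Suc k) powr (- 2 * g)"
    by (rule mult_left_mono) simp
  moreover have "- 2 + max 0 (1 - g) = (g - 1) + - 2 * g" using False by simp
  ultimately show ?thesis by (simp only: powr_add mult.assoc)
qed

text \<open>The corresponding majorant for \<open>Ysum\<close>. If g is at least 1, the growth in n
  + m is split by n + m + 1 \<le> (n+1)(m+1) at the cost of a power of m; otherwise the shift by m
  can only decrease the power.\<close>

lemma powr_bound_Ysum:
  fixes g :: real
  shows "real (Suc m) powr (- g - 1) * real (Suc (n + m)) powr (g - 1) * real (Suc n) powr (1 - g)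
     \<le> real (Suc m) powr (- g - 1 + max 0 (g - 1))"
proof -
  have "real (Suc (n + m)) powr (g - 1) \<le> real (Suc m) powr max 0 (g - 1) * real (Suc n) powr (g - 1)"
  proof (cases "g \<ge> 1")
    case True
    have "real (Suc (n + m)) \<le> real (Suc m) * real (Suc n)"
      by (simp add: algebra_simps)
    then have "real (Suc (n + m)) powr (g - 1) \<le> (real (Suc m) * real (Suc n)) powr (g - 1)"
      using True by (intro powr_mono2) auto
    then show ?thesis using True by (simp add: powr_mult max_def del: of_nat_Suc)
  next
    case False
    then show ?thesis by (simp add: max_def powr_mono2' del: of_nat_Suc)
  qed
  then have "real (Suc m) powr (- g - 1) * (real (Suc (n + m)) powr (g - 1) * real (Suc n) powr (1 - g))
    \<le> real (Suc m) powr (- g - 1) * (real (Suc m) powr max 0 (g - 1) * real (Suc n) powr (g - 1) * real (Suc n) powr (1 - g))"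
    by (intro mult_left_mono mult_right_mono) auto
  then show ?thesis by (simp add: powr_add [symmetric] mult.assoc del: of_nat_Suc)
qed

lemma gamma_quot_nonzero:
  assumes "s \<notin> \<int>\<^sub>\<le>\<^sub>0" "s + 1 - r \<notin> \<int>\<^sub>\<le>\<^sub>0" "s
        + 1 - p \<notin> \<int>\<^sub>\<le>\<^sub>0" "s + 1 - q \<notin> \<int>\<^sub>\<le>\<^sub>0"
  shows "gamma_quot r p q s \<noteq> 0"
  using assms by (simp add: gamma_quot_def Gamma_eq_zero_iff rGamma_eq_zero_iff)

text \<open>With \<gamma> = r - p - q the numerators are of order n^(-\<gamma>-1) and the
  denominator of order n^(\<gamma>-1). Each term of the quotient is thus of order n^(-2\<gamma>) and
  disappears because Re \<gamma> > 0.\<close>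

lemma Qsum_over_gamma_quot_tendsto:
  assumes s: "s \<notin> \<int>\<^sub>\<le>\<^sub>0" "s + 1 - r \<notin> \<int>\<^sub>\<le>\<^sub>0" "s
        + 1 - p \<notin> \<int>\<^sub>\<le>\<^sub>0" "s + 1 - q \<notin> \<int>\<^sub>\<le>\<^sub>0"
    "s + 1 - (r - p) \<notin> \<int>\<^sub>\<le>\<^sub>0" "s + 1 - (r - q) \<notin> \<int>\<^sub>\<le>\<^sub>0"
    and re: "Re (r - p - q) > 0"
  shows "(\<lambda>n. Qsum r p q (s + of_nat n) / gamma_quot r (r - p) (r - q) (s + of_nat n)) \<longlonglongrightarrow> 0"
proof -
  let ?g = "Re (r - p - q)"
  let ?qt = "\<lambda>n. gamma_quot r (r - p) (r - q) (s + of_nat n)"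
  let ?q = "\<lambda>n. gamma_quot r p q (s + of_nat n)"
  have qt: "asymp_powr (\<lambda>n. inverse (?qt n)) (1 - (r - p - q)) 1"
    by (rule asymp_powr_cong[OF _ _ _ asymp_powr_inverse[OF asymp_powr_gamma_quot[OF s(1,2,5,6)]]]) simp_all
  have q: "asymp_powr ?q (- (r - p - q) - 1) 1"
    by (rule asymp_powr_cong[OF _ _ _ asymp_powr_gamma_quot[OF s(1-4)]]) simp_all
  obtain C1 where C1: "C1 > 0" "\<And>n. norm (inverse (?qt n)) \<le> C1 * real (Suc n) powr (1 - ?g)"
    using asymp_powr_bound[OF qt] by auto
  obtain C2 where C2: "C2 > 0" "\<And>n. norm (?q n) \<le> C2 * real (Suc n) powr (- ?g - 1)"
    using asymp_powr_bound[OF q] by auto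
  obtain C3 where C3: "C3 > 0" "\<And>n. norm (binom_coeff (r - p - q) n) \<le> C3 * real (Suc n) powr (?g - 1)"
    using asymp_powr_bound[OF asymp_powr_binom_coeff[of "r - p - q"]] by auto
  let ?a = "\<lambda>k n. binom_coeff (r - p - q) k * ?q (n + k) * inverse (?qt n)"
  have lim: "(\<lambda>n. ?a k n) \<longlonglongrightarrow> 0" for k
  proof -
    have qk: "asymp_powr (\<lambda>n. ?q (n + k)) (- (r - p - q) - 1) 1"
      using plus_of_nat_not_nonpos_Ints[OF s(1), of k] plus_of_nat_not_nonpos_Ints[OF s(2), of k]
        plus_of_nat_not_nonpos_Ints[OF s(3), of k] plus_of_nat_not_nonpos_Ints[OF s(4), of k]
      by (intro asymp_powr_cong[OF _ _ _ asymp_powr_gamma_quot[of "s + of_nat k" r p q]]) (simp_all add: algebra_simps)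
    have "asymp_powr (\<lambda>n. ?q (n + k) * inverse (?qt n)) (- (r - p - q) - 1 + (1 - (r - p - q))) (1 * 1)"
      by (rule asymp_powr_mult[OF qk qt])
    then have "(\<lambda>n. ?q (n + k) * inverse (?qt n)) \<longlonglongrightarrow> 0"
      by (rule asymp_powr_tendsto_0) (use re in simp)
    then show ?thesis using tendsto_mult_right_zero by (force simp: mult.assoc)
  qed
  have bound: "norm (?a k n) \<le> C3 * C2 * C1 * real (Suc k) powr (- 2 + max 0 (1 - ?g))" for k n
  proof -
    have "norm (?a k n) \<le> (C3 * real (Suc k) powr (?g - 1)) * (C2 * real (Suc (n + k)) powr (- ?g - 1)) * (C1 * real (Suc n) powr (1 - ?g))"
      unfolding norm_mult
      by (intro mult_mono C1(2) C2(2)[of "n + k"] C3(2)) (use C1(1) C2(1) C3(1) in auto)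
    also have "\<dots> = C3 * C2 * C1 * (real (Suc k) powr (?g - 1) * real (Suc (n + k)) powr (- ?g - 1) * real (Suc n) powr (1 - ?g))"
      by (simp only: mult_ac)
    also have "\<dots> \<le> C3 * C2 * C1 * real (Suc k) powr (- 2 + max 0 (1 - ?g))"
      using C1 C2 C3 powr_bound_Qsum[OF re, of k n] by (intro mult_left_mono) auto
    finally show ?thesis .
  qed
  have "summable (\<lambda>k. C3 * C2 * C1 * real (Suc k) powr (- 2 + max 0 (1 - ?g)))"
    using re by (intro summable_mult summable_Suc_powr) auto
  from tannerys_theorem[OF lim _ this]
  have "(\<lambda>n. \<Sum>k. ?a k n) \<longlonglongrightarrow> 0"
    using bound by (force intro!: always_eventually)
  moreover have "(\<Sum>k. ?a k n) = Qsum r p q (s + of_nat n) / ?qt n" for n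
  proof -
    have "summable (\<lambda>k. binom_coeff (r - p - q) k * gamma_quot r p q (s + of_nat n + of_nat k))"
      using plus_of_nat_not_nonpos_Ints[OF s(1), of n] plus_of_nat_not_nonpos_Ints[OF s(2), of n]
        plus_of_nat_not_nonpos_Ints[OF s(3), of n] plus_of_nat_not_nonpos_Ints[OF s(4), of n]
      by (intro summable_Qsum) (simp_all add: algebra_simps)
    from suminf_mult2[OF this, of "inverse (?qt n)"] show ?thesis
      by (simp add: Qsum_def divide_inverse add.assoc)
  qed
  ultimately show ?thesis by simp
qed

text \<open>Here numerator and denominator have the same order n^(\<gamma>-1) with leading
  coefficient 1, so every term tends to its own coefficient and the limit is a 2F1 at argument
  1.\<close>

lemma Ysum_over_gamma_quot_tendsto:
  assumes r: "r \<notin> \<int>\<^sub>\<le>\<^sub>0"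
    and s: "s \<notin> \<int>\<^sub>\<le>\<^sub>0" "s + 1 - r \<notin> \<int>\<^sub>\<le>\<^sub>0" "s + 1 - (r - p - q) \<notin> \<int>\<^sub>\<le>\<^sub>0"
    "s + 1 - (r - p) \<notin> \<int>\<^sub>\<le>\<^sub>0" "s + 1 - (r - q) \<notin> \<int>\<^sub>\<le>\<^sub>0"
    and re: "Re (r - p - q) > 0"
  shows "(\<lambda>n. Ysum r p q (s + of_nat n) / gamma_quot r (r - p) (r - q) (s + of_nat n))
    \<longlonglongrightarrow> (\<Sum>m. F21_coeff p q r m)"
proof -
  let ?g = "Re (r - p - q)"
  let ?qt = "\<lambda>n. gamma_quot r (r - p) (r - q) (s + of_nat n)"
  let ?b = "\<lambda>n. beta_quot (r - p - q) (s + of_nat n)"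
  have qt: "asymp_powr (\<lambda>n. inverse (?qt n)) (1 - (r - p - q)) 1"
    by (rule asymp_powr_cong[OF _ _ _ asymp_powr_inverse[OF asymp_powr_gamma_quot[OF s(1,2,4,5)]]]) simp_all
  have b: "asymp_powr ?b (r - p - q - 1) 1" by (rule asymp_powr_beta_quot[OF s(1,3)])
  have c: "asymp_powr (F21_coeff p q r) (- (r - p - q) - 1) (rGamma p * rGamma q * Gamma r)"
    by (rule asymp_powr_cong[OF _ _ _ asymp_powr_F21_coeff[OF r, of p q]]) simp_all
  obtain C1 where C1: "C1 > 0" "\<And>n. norm (inverse (?qt n)) \<le> C1 * real (Suc n) powr (1 - ?g)"
    using asymp_powr_bound[OF qt] by auto
  obtain C2 where C2: "C2 > 0" "\<And>n. norm (?b n) \<le> C2 * real (Suc n) powr (?g - 1)"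
    using asymp_powr_bound[OF b] by auto
  obtain C3 where C3: "C3 > 0" "\<And>n. norm (F21_coeff p q r n) \<le> C3 * real (Suc n) powr (- ?g - 1)"
    using asymp_powr_bound[OF c] by auto
  let ?a = "\<lambda>k n. F21_coeff p q r k * ?b (n + k) * inverse (?qt n)"
  have lim: "(\<lambda>n. ?a k n) \<longlonglongrightarrow> F21_coeff p q r k" for k
  proof -
    have bk: "asymp_powr (\<lambda>n. ?b (n + k)) (r - p - q - 1) 1"
      using plus_of_nat_not_nonpos_Ints[OF s(1), of k] plus_of_nat_not_nonpos_Ints[OF s(3), of k]
      by (intro asymp_powr_cong[OF _ _ _ asymp_powr_beta_quot[of "s + of_nat k" "r - p - q"]]) (simp_all add: algebra_simps)
    have "asymp_powr (\<lambda>n. ?b (n + k) * inverse (?qt n)) 0 1"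
      by (rule asymp_powr_cong[OF _ _ _ asymp_powr_mult[OF bk qt]]) simp_all
    then have "(\<lambda>n. F21_coeff p q r k * (?b (n + k) * inverse (?qt n))) \<longlonglongrightarrow> F21_coeff p q r k * 1"
      unfolding asymp_powr_0_iff by (rule tendsto_mult_left)
    then show ?thesis by (simp add: mult.assoc)
  qed
  have bound: "norm (?a k n) \<le> C3 * C2 * C1 * real (Suc k) powr (- ?g - 1 + max 0 (?g - 1))" for k n
  proof -
    have "norm (?a k n) \<le> (C3 * real (Suc k) powr (- ?g - 1)) * (C2 * real (Suc (n + k)) powr (?g - 1)) * (C1 * real (Suc n) powr (1 - ?g))"
      unfolding norm_mult
      by (intro mult_mono C1(2) C2(2)[of "n + k"] C3(2)) (use C1(1) C2(1) C3(1) in auto)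
    also have "\<dots> = C3 * C2 * C1 * (real (Suc k) powr (- ?g - 1) * real (Suc (n + k)) powr (?g - 1) * real (Suc n) powr (1 - ?g))"
      by (simp only: mult_ac)
    also have "\<dots> \<le> C3 * C2 * C1 * real (Suc k) powr (- ?g - 1 + max 0 (?g - 1))"
      using C1 C2 C3 powr_bound_Ysum[of k ?g n] by (intro mult_left_mono) auto
    finally show ?thesis .
  qed
  have "summable (\<lambda>k. C3 * C2 * C1 * real (Suc k) powr (- ?g - 1 + max 0 (?g - 1)))"
    using re by (intro summable_mult summable_Suc_powr) auto
  from tannerys_theorem[OF lim _ this]
  have "(\<lambda>n. \<Sum>k. ?a k n) \<longlonglongrightarrow> (\<Sum>m. F21_coeff p q r m)"
    using bound by (force intro!: always_eventually)
  moreover have "(\<Sum>k. ?a k n) = Ysum r p q (s + of_nat n) / ?qt n" for n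
  proof -
    have "summable (\<lambda>k. F21_coeff p q r k * beta_quot (r - p - q) (s + of_nat n + of_nat k))"
      using plus_of_nat_not_nonpos_Ints[OF s(1), of n] plus_of_nat_not_nonpos_Ints[OF s(3), of n]
      by (intro summable_Ysum r) (simp_all add: algebra_simps)
    from suminf_mult2[OF this, of "inverse (?qt n)"] show ?thesis
      by (simp add: Ysum_def divide_inverse add.assoc)
  qed
  ultimately show ?thesis by simp
qed

text \<open>The factor \<open>\<kappa>\<close> makes the inhomogeneous terms of
  \<open>Qsum_rec\<close> and \<open>Ysum_rec\<close> cancel. The combination divided by
  \<open>gamma_quot\<close> then does not change from s to s + 1, so it equals its limit along s +
  n. The 2F1 at argument 1 is left unevaluated at this stage.\<close>

lemma Saalschutz_defect_const:
  assumes r: "r \<notin> \<int>\<^sub>\<le>\<^sub>0" "p \<notin> \<int>\<^sub>\<le>\<^sub>0" "q \<notin> \<int>\<^sub>\<le>\<^sub>0" and re: "Re (r - p - q) > 0"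
    and s: "s \<notin> \<int>\<^sub>\<le>\<^sub>0" "s + 1 - r \<notin> \<int>\<^sub>\<le>\<^sub>0" "s
        + 1 - p \<notin> \<int>\<^sub>\<le>\<^sub>0" "s + 1 - q \<notin> \<int>\<^sub>\<le>\<^sub>0"
      "s + 1 - (r - p - q) \<notin> \<int>\<^sub>\<le>\<^sub>0" "s + 1 - (r - p) \<notin> \<int>\<^sub>\<le>\<^sub>0" "s
        + 1 - (r - q) \<notin> \<int>\<^sub>\<le>\<^sub>0"
  defines "\<kappa> \<equiv> rGamma (r - p - q) * Gamma p * Gamma q * rGamma r"
  shows "Qsum r p q s + \<kappa> * Ysum r p q s = \<kappa> * (\<Sum>m. F21_coeff p q r m) * gamma_quot r (r - p) (r - q) s"
proof -
  let ?qt = "gamma_quot r (r - p) (r - q)"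
  define D where "D s = Qsum r p q s + \<kappa> * Ysum r p q s" for s
  have sn: "s + of_nat n \<notin> \<int>\<^sub>\<le>\<^sub>0" "s + of_nat n + 1 - r \<notin> \<int>\<^sub>\<le>\<^sub>0" "s + of_nat n
        + 1 - p \<notin> \<int>\<^sub>\<le>\<^sub>0" "s + of_nat n + 1 - q \<notin> \<int>\<^sub>\<le>\<^sub>0"
      "s + of_nat n + 1 - (r - p - q) \<notin> \<int>\<^sub>\<le>\<^sub>0" "s + of_nat n + 1 - (r - p) \<notin> \<int>\<^sub>\<le>\<^sub>0" "s
        + of_nat n + 1 - (r - q) \<notin> \<int>\<^sub>\<le>\<^sub>0" for n
    using plus_of_nat_not_nonpos_Ints[OF s(1), of n] plus_of_nat_not_nonpos_Ints[OF s(2), of n]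
      plus_of_nat_not_nonpos_Ints[OF s(3), of n] plus_of_nat_not_nonpos_Ints[OF s(4), of n]
      plus_of_nat_not_nonpos_Ints[OF s(5), of n] plus_of_nat_not_nonpos_Ints[OF s(6), of n]
      plus_of_nat_not_nonpos_Ints[OF s(7), of n] by (simp_all add: algebra_simps)
  have qt0: "?qt (s + of_nat n) \<noteq> 0" for n
    by (rule gamma_quot_nonzero) (use sn in auto)
  have step: "D (s + of_nat (Suc n)) / ?qt (s + of_nat (Suc n)) = D (s + of_nat n) / ?qt (s + of_nat n)" for n
  proof -
    let ?s = "s + of_nat n"
    have G: "Gamma r * rGamma r = 1" "Gamma p * rGamma p = 1" "Gamma q * rGamma q = 1"
      using r by (simp_all add: rGamma_inverse_Gamma Gamma_eq_zero_iff)
    have "\<kappa> * (Gamma r * rGamma p * rGamma q) = rGamma (r - p - q) * (Gamma r * rGamma r) * (Gamma p * rGamma p) * (Gamma q * rGamma q)"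
      by (simp only: \<kappa>_def mult_ac)
    then have k: "\<kappa> * (Gamma r * rGamma p * rGamma q) = rGamma (r - p - q)" by (simp add: G)
    have "?s * (?s + 1 - r) * D ?s - (?s + 1 - r + p) * (?s + 1 - r + q) * D (?s + 1)
      = (?s * (?s + 1 - r) * Qsum r p q ?s - (?s + 1 - r + p) * (?s + 1 - r + q) * Qsum r p q (?s + 1))
       + \<kappa> * (?s * (?s + 1 - r) * Ysum r p q ?s - (?s + 1 - r + p) * (?s + 1 - r + q) * Ysum r p q (?s + 1))"
      by (simp add: D_def distrib_left right_diff_distrib mult_ac)
    also have "\<dots> = 0"
      unfolding Qsum_rec[OF sn(1-4)[of n]] Ysum_rec[OF r(1) sn(1,5)[of n]] using k by simp
    finally have 1: "?s * (?s + 1 - r) * D ?s = (?s + 1 - r + p) * (?s + 1 - r + q) * D (?s + 1)" by simp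
    have 2: "(?s + 1 - r + p) * (?s + 1 - r + q) * ?qt (?s + 1) = ?s * (?s + 1 - r) * ?qt ?s"
      using gamma_quot_Suc[OF s(1,2), of n "r - p" "r - q"] by (simp add: algebra_simps)
    have ne: "?s * (?s + 1 - r) \<noteq> 0" "(?s + 1 - r + p) * (?s + 1 - r + q) \<noteq> 0"
    proof -
      have z: "w \<noteq> 0" if "w \<notin> \<int>\<^sub>\<le>\<^sub>0" for w :: complex using that by auto
      have "?s + 1 - r + p \<noteq> 0" "?s + 1 - r + q \<noteq> 0"
        using z[OF sn(6)[of n]] z[OF sn(7)[of n]] by (simp_all add: algebra_simps)
      then show "?s * (?s + 1 - r) \<noteq> 0" "(?s + 1 - r + p) * (?s + 1 - r + q) \<noteq> 0"
        using z[OF sn(1)[of n]] z[OF sn(2)[of n]] by (simp_all only: mult_eq_0_iff de_Morgan_disj simp_thms)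
    qed
    have "x1 / y1 = x0 / y0" if "u * x0 = v * x1" "v * y1 = u * y0" "u \<noteq> 0" "v \<noteq> 0" "y0 \<noteq> 0" "y1 \<noteq> 0"
      for u v x0 x1 y0 y1 :: complex
    proof -
      have "v * (x1 * y0) = u * x0 * y0" using that(1) by simp
      also have "\<dots> = v * (x0 * y1)" using that(2) by (simp add: mult_ac)
      finally show ?thesis using that by (simp add: frac_eq_eq)
    qed
    from this[OF 1 2 ne qt0[of n]] qt0[of "Suc n"] show ?thesis by (simp add: add_ac)
  qed
  have "D (s + of_nat n) / ?qt (s + of_nat n) = D s / ?qt s" for n
    by (induction n) (use step in \<open>simp_all del: of_nat_Suc\<close>)
  moreover have "(\<lambda>n. D (s + of_nat n) / ?qt (s + of_nat n)) \<longlonglongrightarrow> 0 + \<kappa> * (\<Sum>m. F21_coeff p q r m)"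
    using tendsto_add[OF Qsum_over_gamma_quot_tendsto[OF s(1-4,6,7) re]
        tendsto_mult_left[OF Ysum_over_gamma_quot_tendsto[OF r(1) s(1,2,5-7) re], of \<kappa>]]
    by (simp add: D_def add_divide_distrib)
  ultimately have "(\<lambda>n. D s / ?qt s) \<longlonglongrightarrow> \<kappa> * (\<Sum>m. F21_coeff p q r m)" by simp
  then have "D s / ?qt s = \<kappa> * (\<Sum>m. F21_coeff p q r m)" by (simp add: LIMSEQ_const_iff)
  then show ?thesis using qt0[of 0] by (simp add: D_def field_simps)
qed

text \<open>Up to Gamma factors both sums are 3F2 series at 1 in which the lower parameters exceed
  the upper ones by 1 in total. At s = r each is known in closed form, one by telescoping and one by
  its recurrence. The comparison there determines the unknown constant, so that Gauss's evaluation
  of the 2F1 at 1 comes out as a by-product in \<open>F\<close>.\<close>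

theorem nonterminating_Saalschutz:
  assumes r: "r \<notin> \<int>\<^sub>\<le>\<^sub>0" "p \<notin> \<int>\<^sub>\<le>\<^sub>0" "q \<notin> \<int>\<^sub>\<le>\<^sub>0" and re: "Re (r - p - q) > 0"
    and r': "r + 1 - p \<notin> \<int>\<^sub>\<le>\<^sub>0" "r + 1 - q \<notin> \<int>\<^sub>\<le>\<^sub>0" "p
        + q \<notin> \<int>\<^sub>\<le>\<^sub>0" "r - 1 \<notin> \<int>\<^sub>\<le>\<^sub>0"
    and s: "s \<notin> \<int>\<^sub>\<le>\<^sub>0" "s + 1 - r \<notin> \<int>\<^sub>\<le>\<^sub>0" "s
        + 1 - p \<notin> \<int>\<^sub>\<le>\<^sub>0" "s + 1 - q \<notin> \<int>\<^sub>\<le>\<^sub>0"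
      "s + 1 - (r - p - q) \<notin> \<int>\<^sub>\<le>\<^sub>0" "s + 1 - (r - p) \<notin> \<int>\<^sub>\<le>\<^sub>0" "s
        + 1 - (r - q) \<notin> \<int>\<^sub>\<le>\<^sub>0"
  shows "rGamma p * rGamma q * Qsum r p q s =
    rGamma (r - p) * rGamma (r - q) * gamma_quot r (r - p) (r - q) s
    - rGamma (r - p - q) * rGamma r * Ysum r p q s"
proof -
  let ?\<kappa> = "rGamma (r - p - q) * Gamma p * Gamma q * rGamma r"
  let ?F = "\<Sum>m. F21_coeff p q r m"
  have G: "Gamma r * rGamma r = 1" "Gamma p * rGamma p = 1" "Gamma q * rGamma q = 1"
    using r by (simp_all add: rGamma_inverse_Gamma Gamma_eq_zero_iff)
  have p1: "rGamma p = p * rGamma (p + 1)" "rGamma q = q * rGamma (q + 1)"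
    using rGamma_plus1[of p] rGamma_plus1[of q] by simp_all
  have pq: "p + 1 \<notin> \<int>\<^sub>\<le>\<^sub>0" "q + 1 \<notin> \<int>\<^sub>\<le>\<^sub>0"
    using plus_of_nat_not_nonpos_Ints[OF r(2), of 1] plus_of_nat_not_nonpos_Ints[OF r(3), of 1] by simp_all
  have "Qsum r p q r + ?\<kappa> * Ysum r p q r = ?\<kappa> * ?F * gamma_quot r (r - p) (r - q) r"
    by (rule Saalschutz_defect_const[OF r re r(1) _ r'(1,2)]) (use plus_of_nat_not_nonpos_Ints[OF r'(3), of 1] r' pq in \<open>simp_all add: algebra_simps\<close>)
  then have "- (p * q) * Qsum r p q r + ?\<kappa> * (- (p * q) * Ysum r p q r) = - (?\<kappa> * ?F) * (p * q * gamma_quot r (r - p) (r - q) r)"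
    by algebra
  moreover have "- (p * q) * Ysum r p q r = - (Gamma r * rGamma p * rGamma q)"
  proof -
    \<comment> \<open>At s = r - 1 the factor s + 1 - r vanishes, and the recurrence isolates
      \<open>Ysum\<close> at r.\<close>
    have "(r - 1) * (r - 1 + 1 - r) * Ysum r p q (r - 1) - (r - 1 + 1 - r + p) * (r - 1 + 1 - r + q) * Ysum r p q (r - 1 + 1)
     = - (Gamma r * rGamma p * rGamma q)"
      by (rule Ysum_rec) (use r r' in \<open>simp_all add: algebra_simps\<close>)
    then show ?thesis by simp
  qed
  moreover have "p * q * gamma_quot r (r - p) (r - q) r = Gamma r * rGamma p * rGamma q"
    by (simp add: gamma_quot_def p1 add_ac)
  ultimately have "rGamma (r - p - q) - Gamma r * rGamma (r - p) * rGamma (r - q) - ?\<kappa> * (Gamma r * rGamma p * rGamma q)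
      = - (?\<kappa> * ?F) * (Gamma r * rGamma p * rGamma q)"
    using Qsum_at_r[OF r(1) r'(1,2)] by simp
  moreover have "?\<kappa> * (Gamma r * rGamma p * rGamma q) = rGamma (r - p - q)"
    using G by algebra
  ultimately have F: "?\<kappa> * ?F * (Gamma r * rGamma p * rGamma q) = Gamma r * rGamma (r - p) * rGamma (r - q)"
    by algebra
  have "rGamma p * rGamma q * (?\<kappa> * ?F) = rGamma (r - p) * rGamma (r - q)"
    using F G by algebra
  moreover have "rGamma p * rGamma q * (Qsum r p q s + ?\<kappa> * Ysum r p q s) = rGamma p * rGamma q * (?\<kappa> * ?F) * gamma_quot r (r - p) (r - q) s"
    using Saalschutz_defect_const[OF r re s] by simp
  moreover have "rGamma p * rGamma q * ?\<kappa> = rGamma (r - p - q) * rGamma r" using G by algebra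
  ultimately show ?thesis by algebra
qed

section \<open>Whipple's transformation\<close>

text \<open>Separates c, d, e, on which Euler's transformation acts, from the factors that depend on
  n only through a + n.\<close>

lemma rF43_term_eq_gamma_quot:
  assumes "a \<notin> \<int>\<^sub>\<le>\<^sub>0" "b \<notin> \<int>\<^sub>\<le>\<^sub>0" "e \<notin> \<int>\<^sub>\<le>\<^sub>0"
  shows "rF43_term a b c d e f g n = rGamma a * rGamma b * rGamma e *
     (F21_coeff c d e n * gamma_quot (1 + a - b) (1 + a - f) (1 + a - g) (a + of_nat n))"
proof -
  have p: "pochhammer z n = rGamma z * Gamma (z + of_nat n)" if "z \<notin> \<int>\<^sub>\<le>\<^sub>0" for z :: complex
    using pochhammer_Gamma[OF that] by (simp add: rGamma_inverse_Gamma divide_inverse mult.commute)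
  have q: "rGamma (e + of_nat n) = rGamma e / pochhammer e n"
  proof -
    have "pochhammer e n \<noteq> 0" using assms(3) pochhammer_eq_0_imp_nonpos_Int by blast
    then show ?thesis using pochhammer_rGamma[of e n] by (simp add: field_simps)
  qed
  have e: "a + of_nat n + 1 - (1 + a - z) = z + of_nat n" for z by simp
  show ?thesis
    unfolding rF43_term_def F21_coeff_def gamma_quot_def e q p[OF assms(1)] p[OF assms(2)]
    by (simp add: mult_ac)
qed

text \<open>Turns growth in j + m into a product of functions of j and of m, the form of majorant
  that \<open>double_suminf\<close> asks for.\<close>

lemma powr_add_index_le:
  fixes g :: real
  shows "real (Suc (j + m)) powr (g - 1) \<le> real (Suc j) powr max 0 (g - 1) * real (Suc m) powr max 0 (g - 1)"
proof (cases "g \<ge> 1")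
  case True
  have "real (Suc (j + m)) \<le> real (Suc j) * real (Suc m)" by (simp add: algebra_simps)
  then have "real (Suc (j + m)) powr (g - 1) \<le> (real (Suc j) * real (Suc m)) powr (g - 1)"
    using True by (intro powr_mono2) auto
  then show ?thesis using True by (simp add: powr_mult max_def del: of_nat_Suc)
next
  case False
  then show ?thesis using powr_mono[of "g - 1" 0 "real (Suc (j + m))"] by (simp add: max_def)
qed

lemma rF43_symms:
  "rF43 a b c d e f g = rF43 a b d c e f g" "rF43 a b c d e f g = rF43 a c b d e f g"
  "rF43 a b c d e f g = rF43 a b c d f e g" "rF43 a b c d e f g = rF43 a b c d e g f"
  by (simp_all add: rF43_def rF43_term_def mult_ac)

lemma F21_coeff_commute: "F21_coeff c d e n = F21_coeff d c e n"
  by (simp add: F21_coeff_def mult_ac)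

text \<open>Formally a multiple of the integral over [0,1] of x^(a-1) (1-x)^(-\<gamma>) F(c,d;e;x)
  F(p,q;r;x), with F the Gauss series.\<close>

definition Wsum :: "complex \<Rightarrow> complex \<Rightarrow> complex \<Rightarrow> complex \<Rightarrow> complex \<Rightarrow> complex \<Rightarrow> complex \<Rightarrow> complex \<Rightarrow> complex" where
  "Wsum \<gamma> a c d e p q r = (\<Sum>j. \<Sum>m. F21_coeff c d e j * (F21_coeff p q r m * beta_quot \<gamma> (a + of_nat (j + m))))"

text \<open>Both sequences of coefficients decay like n^(-Re \<gamma> - 1). The growth (j+m)^(Re
  \<gamma> - 1), distributed over the two indices, leaves exponents below -1 as long as Re \<gamma>
  > 0.\<close>

lemma Wsum_majorant:
  assumes er: "e \<notin> \<int>\<^sub>\<le>\<^sub>0" "r \<notin> \<int>\<^sub>\<le>\<^sub>0" and a: "a \<notin> \<int>\<^sub>\<le>\<^sub>0" "a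
        + 1 - \<gamma> \<notin> \<int>\<^sub>\<le>\<^sub>0"
    and \<gamma>: "e - c - d = \<gamma>" "r - p - q = \<gamma>" "Re \<gamma> > 0"
  obtains u v where "\<And>j m. norm (F21_coeff c d e j * (F21_coeff p q r m * beta_quot \<gamma> (a + of_nat (j + m)))) \<le> u j * v m"
     "summable u" "summable v" "\<And>j. u j \<ge> 0" "\<And>j. v j \<ge> (0::real)"
proof -
  let ?g = "Re \<gamma>"
  have re: "Re (c + d - e - 1) = - ?g - 1" "Re (p + q - r - 1) = - ?g - 1" "Re (\<gamma> - 1) = ?g - 1"
    using arg_cong[OF \<gamma>(1), of Re] arg_cong[OF \<gamma>(2), of Re] by auto
  obtain C1 where C1: "C1 > 0" "\<And>n. norm (F21_coeff c d e n) \<le> C1 * real (Suc n) powr (- ?g - 1)"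
    using asymp_powr_bound[OF asymp_powr_F21_coeff[OF er(1), of c d]] unfolding re by blast
  obtain C2 where C2: "C2 > 0" "\<And>n. norm (F21_coeff p q r n) \<le> C2 * real (Suc n) powr (- ?g - 1)"
    using asymp_powr_bound[OF asymp_powr_F21_coeff[OF er(2), of p q]] unfolding re by blast
  obtain C3 where C3: "C3 > 0" "\<And>n. norm (beta_quot \<gamma> (a + of_nat n)) \<le> C3 * real (Suc n) powr (?g - 1)"
    using asymp_powr_bound[OF asymp_powr_beta_quot[OF a]] unfolding re by blast
  define w where "w j = real (Suc j) powr (- ?g - 1 + max 0 (?g - 1))" for j
  have "summable w" unfolding w_def using \<gamma>(3) by (intro summable_Suc_powr) auto
  then have "summable (\<lambda>j. C1 * C3 * w j)" "summable (\<lambda>j. C2 * w j)" by (auto intro: summable_mult)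
  moreover have "norm (F21_coeff c d e j * (F21_coeff p q r m * beta_quot \<gamma> (a + of_nat (j + m)))) \<le> (C1 * C3 * w j) * (C2 * w m)" for j m
  proof -
    have "norm (F21_coeff c d e j * (F21_coeff p q r m * beta_quot \<gamma> (a + of_nat (j + m))))
      \<le> (C1 * real (Suc j) powr (- ?g - 1)) * ((C2 * real (Suc m) powr (- ?g - 1)) * (C3 * real (Suc (j + m)) powr (?g - 1)))"
      unfolding norm_mult by (intro mult_mono C1(2) C2(2) C3(2)) (use C1(1) C2(1) C3(1) in auto)
    also have "\<dots> \<le> (C1 * real (Suc j) powr (- ?g - 1)) * ((C2 * real (Suc m) powr (- ?g - 1)) *
        (C3 * (real (Suc j) powr max 0 (?g - 1) * real (Suc m) powr max 0 (?g - 1))))"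
      by (intro mult_left_mono powr_add_index_le) (use C1(1) C2(1) C3(1) in auto)
    also have "\<dots> = (C1 * C3 * w j) * (C2 * w m)"
      by (simp add: w_def powr_add mult_ac del: of_nat_Suc)
    finally show ?thesis .
  qed
  ultimately show ?thesis using C1(1) C2(1) C3(1) by (intro that[of "\<lambda>j. C1 * C3 * w j" "\<lambda>j. C2 * w j"]) (auto simp: w_def)
qed

lemma Wsum_swap:
  assumes "e \<notin> \<int>\<^sub>\<le>\<^sub>0" "r \<notin> \<int>\<^sub>\<le>\<^sub>0" "a \<notin> \<int>\<^sub>\<le>\<^sub>0" "a
        + 1 - \<gamma> \<notin> \<int>\<^sub>\<le>\<^sub>0"
    and "e - c - d = \<gamma>" "r - p - q = \<gamma>" "Re \<gamma> > 0"
  shows "Wsum \<gamma> a c d e p q r = Wsum \<gamma> a p q r c d e"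
proof -
  obtain u v where "\<And>j m. norm (F21_coeff c d e j * (F21_coeff p q r m * beta_quot \<gamma> (a + of_nat (j + m)))) \<le> u j * v m"
     "summable u" "summable v" "\<And>j. u j \<ge> 0" "\<And>j. v j \<ge> (0::real)"
    using Wsum_majorant[OF assms] by metis
  from suminf_swap[OF this] show ?thesis
    by (simp add: Wsum_def mult_ac add_ac)
qed

text \<open>Expand one 2F1 factor by \<open>F21_coeff_Euler\<close> and sum the inner series by \<open>nonterminating_Saalschutz\<close>.
  The double series \<open>Wsum\<close> that remains is symmetric in its two groups of parameters, so it cancels
  against the one produced by the second series of \<open>rK\<close>.\<close>

lemma rF43_Whipple_defect:
  assumes bal: "e + f + g - a - b - c - d = 1" and re: "Re (c + d - e) > 0"
    and gen: "\<forall>z\<in>{a, b, e, f, g, a - b, a - f, a - g, a + b - f, a + b - g, f - b, g - b, a + e - c - d, 2 * a - f - g}. z \<notin> \<int>"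
  shows "rF43 a b c d e f g * (rGamma (1 + a - f) * rGamma (1 + a - g))
       - rF43 a b (e - c) (e - d) e (1 + a + b - f) (1 + a + b - g) * (rGamma (f - b) * rGamma (g - b))
     = - (rGamma a * rGamma b * rGamma e * rGamma (c + d - e) * rGamma (1 + a - b)) *
         Wsum (c + d - e) a (e - c) (e - d) e (1 + a - f) (1 + a - g) (1 + a - b)"
proof -
  define p q r where "p = 1 + a - f" and "q = 1 + a - g" and "r = 1 + a - b"
  define \<gamma> where "\<gamma> = c + d - e"
  \<comment> \<open>Balance says precisely that the exponent c + d - e of Euler's transformation
    equals r - p - q. This is what makes the inner series a \<open>Qsum\<close>.\<close>
  have \<gamma>: "r - p - q = \<gamma>" using bal by (simp add: p_def q_def r_def \<gamma>_def algebra_simps)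
  have re': "Re \<gamma> > 0" using re by (simp add: \<gamma>_def)
  have nn: "z + of_nat n \<notin> \<int>\<^sub>\<le>\<^sub>0" if "z \<notin> \<int>" for z :: complex and n
    using that by (intro plus_of_nat_not_nonpos_Ints not_Ints_imp_not_nonpos_Ints)
  have int1: "1 + z \<notin> \<int>" if "z \<notin> \<int>" for z :: complex
    using that Ints_diff[of "1 + z" 1] by auto
  have r: "r \<notin> \<int>" "p \<notin> \<int>" "q \<notin> \<int>" "r - p - q
        = \<gamma>" "f \<notin> \<int>" "g \<notin> \<int>" "b \<notin> \<int>" "a \<notin> \<int>" "e \<notin> \<int>"
    "1 + a + b - f \<notin> \<int>" "1 + a + b - g \<notin> \<int>" "1 + a - \<gamma> \<notin> \<int>" "p + q \<notin> \<int>" "1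
        + (f - b) \<notin> \<int>" "1 + (g - b) \<notin> \<int>" "a - b \<notin> \<int>"
    using gen \<gamma> int1[of "a - b"] int1[of "a - f"] int1[of "a - g"] int1[of "f - b"] int1[of "g - b"] int1[of "a + b - f"] int1[of "a + b - g"]
      int1[of "a + e - c - d"] int1[OF int1[of "2 * a - f - g"]]
    by (simp_all add: p_def q_def r_def \<gamma>_def algebra_simps)
  have nz: "a \<notin> \<int>\<^sub>\<le>\<^sub>0" "b \<notin> \<int>\<^sub>\<le>\<^sub>0" "e \<notin> \<int>\<^sub>\<le>\<^sub>0" "r \<notin> \<int>\<^sub>\<le>\<^sub>0" "p \<notin> \<int>\<^sub>\<le>\<^sub>0" "q \<notin> \<int>\<^sub>\<le>\<^sub>0" "p + q \<notin> \<int>\<^sub>\<le>\<^sub>0"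
    using r by (simp_all add: not_Ints_imp_not_nonpos_Ints)
  have Saal: "rGamma p * rGamma q * Qsum r p q (a + of_nat j) =
    rGamma (r - p) * rGamma (r - q) * gamma_quot r (r - p) (r - q) (a + of_nat j)
    - rGamma \<gamma> * rGamma r * Ysum r p q (a + of_nat j)" for j
  proof -
    have "a + of_nat j \<notin> \<int>\<^sub>\<le>\<^sub>0" "a + of_nat j + 1 - r \<notin> \<int>\<^sub>\<le>\<^sub>0" "a + of_nat j
        + 1 - p \<notin> \<int>\<^sub>\<le>\<^sub>0" "a + of_nat j + 1 - q \<notin> \<int>\<^sub>\<le>\<^sub>0"
      "a + of_nat j + 1 - (r - p - q) \<notin> \<int>\<^sub>\<le>\<^sub>0" "a + of_nat j + 1 - (r - p) \<notin> \<int>\<^sub>\<le>\<^sub>0" "a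
        + of_nat j + 1 - (r - q) \<notin> \<int>\<^sub>\<le>\<^sub>0"
      using nn[OF r(8), of j] nn[OF r(7), of j] nn[OF r(5), of j] nn[OF r(6), of j] nn[OF r(12), of j]
        nn[OF r(10), of j] nn[OF r(11), of j] unfolding \<gamma> by (simp_all add: p_def q_def r_def algebra_simps)
    moreover have "r + 1 - p \<notin> \<int>\<^sub>\<le>\<^sub>0" "r + 1 - q \<notin> \<int>\<^sub>\<le>\<^sub>0" "r - 1 \<notin> \<int>\<^sub>\<le>\<^sub>0"
      using r(14-16) by (simp_all add: p_def q_def r_def not_Ints_imp_not_nonpos_Ints algebra_simps)
    ultimately show ?thesis
      using nonterminating_Saalschutz[OF nz(4-6) _ _ _ nz(7), of "a + of_nat j"] re' unfolding \<gamma> by blast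
  qed
  let ?f = "F21_coeff c d e" and ?f' = "F21_coeff (e - c) (e - d) e"
  let ?q = "\<lambda>n. gamma_quot r p q (a + of_nat n)" and ?q' = "\<lambda>n. gamma_quot r (r - p) (r - q) (a + of_nat n)"
  let ?C = "rGamma a * rGamma b * rGamma e"
  have C: "?C \<noteq> 0" using nz by (simp add: rGamma_eq_zero_iff)
  have F: "rF43 a b c d e f g = ?C * (\<Sum>n. ?f n * ?q n)"
  proof -
    have t: "rF43_term a b c d e f g n = ?C * (?f n * ?q n)" for n
      using rF43_term_eq_gamma_quot[OF nz(1-3)] by (simp add: p_def q_def r_def)
    have "summable (\<lambda>n. ?f n * ?q n)"
      using summable_rF43_term[OF bal] C unfolding t by (simp add: summable_cmult_iff)
    then show ?thesis unfolding rF43_def t by (rule suminf_mult)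
  qed
  have bal': "e + (1 + a + b - f) + (1 + a + b - g) - a - b - (e - c) - (e - d) = 1"
    using bal by (simp add: algebra_simps)
  have t': "rF43_term a b (e - c) (e - d) e (1 + a + b - f) (1 + a + b - g) n = ?C * (?f' n * ?q' n)" for n
  proof -
    have "1 + a - (1 + a + b - f) = r - p" "1 + a - (1 + a + b - g) = r - q"
      by (simp_all add: p_def q_def r_def)
    then show ?thesis using rF43_term_eq_gamma_quot[OF nz(1-3), of "e - c" "e - d" "1 + a + b - f" "1 + a + b - g" n]
      by (simp only: r_def)
  qed
  have sq': "summable (\<lambda>n. ?f' n * ?q' n)"
    using summable_rF43_term[OF bal'] C unfolding t' by (simp add: summable_cmult_iff)
  then have F': "rF43 a b (e - c) (e - d) e (1 + a + b - f) (1 + a + b - g) = ?C * (\<Sum>n. ?f' n * ?q' n)"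
    unfolding rF43_def t' by (rule suminf_mult)

  have ref: "Re (e - c + (e - d) - e - 1) = - Re \<gamma> - 1" "Re (\<gamma> - 1) = Re \<gamma> - 1" "Re (p + q - r - 1) = - Re \<gamma> - 1"
    using arg_cong[OF \<gamma>, of Re] by (auto simp: \<gamma>_def)
  obtain C1 where C1: "C1 > 0" "\<And>n. norm (?f' n) \<le> C1 * real (Suc n) powr (- Re \<gamma> - 1)"
    using asymp_powr_bound[OF asymp_powr_F21_coeff[OF nz(3), of "e - c" "e - d"]] unfolding ref by blast
  obtain C2 where C2: "C2 > 0" "\<And>n. norm (binom_coeff \<gamma> n) \<le> C2 * real (Suc n) powr (Re \<gamma> - 1)"
    using asymp_powr_bound[OF asymp_powr_binom_coeff[of \<gamma>]] unfolding ref by blast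
  obtain C3 where C3: "C3 > 0" "\<And>n. norm (?q n) \<le> C3 * real (Suc n) powr (- Re \<gamma> - 1)"
  proof -
    have "asymp_powr ?q (p + q - r - 1) 1"
      using r by (intro asymp_powr_gamma_quot not_Ints_imp_not_nonpos_Ints) (simp_all add: p_def q_def r_def)
    from asymp_powr_bound[OF this] show ?thesis unfolding ref using that by blast
  qed
  let ?A = "\<lambda>j k. ?f' j * (binom_coeff \<gamma> k * ?q (j + k))"
  define u where "u j = C1 * real (Suc j) powr (- Re \<gamma> - 1)" for j
  define v where "v k = C2 * C3 * real (Suc k) powr (-2)" for k
  have A: "norm (?A j k) \<le> u j * v k" for j k
  proof -
    have "norm (?A j k) \<le> u j * ((C2 * real (Suc k) powr (Re \<gamma> - 1)) * (C3 * real (Suc (j + k)) powr (- Re \<gamma> - 1)))"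
      unfolding norm_mult u_def by (intro mult_mono C1(2) C2(2) C3(2)) (use C1(1) C2(1) C3(1) in auto)
    also have "\<dots> \<le> u j * ((C2 * real (Suc k) powr (Re \<gamma> - 1)) * (C3 * real (Suc k) powr (- Re \<gamma> - 1)))"
      unfolding u_def by (intro mult_left_mono powr_mono2') (use C1(1) C2(1) C3(1) re' in auto)
    also have "\<dots> = u j * v k"
      by (simp add: v_def powr_add [symmetric] mult_ac del: of_nat_Suc)
    finally show ?thesis .
  qed
  have u: "summable u" unfolding u_def using re' by (intro summable_mult summable_Suc_powr) auto
  have v: "summable v" unfolding v_def by (intro summable_mult summable_Suc_powr) auto
  have uv: "u j \<ge> 0" "v j \<ge> 0" for j unfolding u_def v_def using C1(1) C2(1) C3(1) by auto
  \<comment> \<open>Each term becomes a sum along a diagonal. Reordered by j, the sum over k = n - j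
    is a \<open>Qsum\<close> at a + j, to which \<open>Saal\<close> applies.\<close>
  have Euler: "?f n * ?q n = (\<Sum>j\<le>n. ?A j (n - j))" for n
    unfolding F21_coeff_Euler[OF nz(3), of c d n] sum_distrib_right \<gamma>_def
    by (intro sum.cong) (auto simp: mult_ac)
  have inner: "(\<Sum>k. ?A j k) = ?f' j * Qsum r p q (a + of_nat j)" for j
  proof -
    have "a + of_nat j \<notin> \<int>\<^sub>\<le>\<^sub>0" "a + of_nat j + 1 - r \<notin> \<int>\<^sub>\<le>\<^sub>0" "a + of_nat j
        + 1 - p \<notin> \<int>\<^sub>\<le>\<^sub>0" "a + of_nat j + 1 - q \<notin> \<int>\<^sub>\<le>\<^sub>0"
      using nn[OF r(8), of j] nn[OF r(7), of j] nn[OF r(5), of j] nn[OF r(6), of j]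
      by (simp_all add: p_def q_def r_def add_ac)
    from suminf_mult[OF summable_Qsum[OF this], of "?f' j"] show ?thesis
      by (simp add: Qsum_def \<gamma> add.assoc)
  qed
  have Q: "(\<Sum>n. ?f n * ?q n) = (\<Sum>j. ?f' j * Qsum r p q (a + of_nat j))"
    using suminf_diagonal[OF A u v uv] by (simp only: Euler inner)
  have sQ: "summable (\<lambda>j. ?f' j * Qsum r p q (a + of_nat j))"
    using summable_outer[OF A u v uv] by (simp only: inner)

  have W: "e - (e - c) - (e - d) = \<gamma>" by (simp add: \<gamma>_def)
  have a1: "a + 1 - \<gamma> \<notin> \<int>\<^sub>\<le>\<^sub>0" using r(12) by (simp add: not_Ints_imp_not_nonpos_Ints algebra_simps)
  obtain u' v' where uv': "\<And>j m. norm (?f' j * (F21_coeff p q r m * beta_quot \<gamma> (a + of_nat (j + m)))) \<le> u' j * v' m"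
     "summable u'" "summable v'" "\<And>j. u' j \<ge> 0" "\<And>j. v' j \<ge> (0::real)"
    using Wsum_majorant[OF nz(3,4,1) a1 W \<gamma> re'] by metis
  have innerY: "(\<Sum>m. ?f' j * (F21_coeff p q r m * beta_quot \<gamma> (a + of_nat (j + m)))) = ?f' j * Ysum r p q (a + of_nat j)" for j
  proof -
    have "a + of_nat j \<notin> \<int>\<^sub>\<le>\<^sub>0" "a + of_nat j + 1 - (r - p - q) \<notin> \<int>\<^sub>\<le>\<^sub>0"
      using nn[OF r(8), of j] nn[OF r(12), of j] unfolding \<gamma> by (simp_all add: algebra_simps)
    from suminf_mult[OF summable_Ysum[OF nz(4) this], of "?f' j"] show ?thesis
      by (simp add: Ysum_def \<gamma> add.assoc)
  qed
  have Y: "Wsum \<gamma> a (e - c) (e - d) e p q r = (\<Sum>j. ?f' j * Ysum r p q (a + of_nat j))"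
    unfolding Wsum_def innerY ..
  have sY: "summable (\<lambda>j. ?f' j * Ysum r p q (a + of_nat j))"
    using summable_outer[OF uv'] by (simp only: innerY)

  have "rGamma p * rGamma q * (\<Sum>j. ?f' j * Qsum r p q (a + of_nat j))
      = (\<Sum>j. ?f' j * (rGamma p * rGamma q * Qsum r p q (a + of_nat j)))"
    by (subst suminf_mult[OF sQ, symmetric]) (simp add: mult_ac)
  also have "\<dots> = (\<Sum>j. rGamma (r - p) * rGamma (r - q) * (?f' j * ?q' j) - rGamma \<gamma> * rGamma r * (?f' j * Ysum r p q (a + of_nat j)))"
    unfolding Saal by (simp add: algebra_simps)
  also have "\<dots> = rGamma (r - p) * rGamma (r - q) * (\<Sum>j. ?f' j * ?q' j) - rGamma \<gamma> * rGamma r * Wsum \<gamma> a (e - c) (e - d) e p q r"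
    unfolding Y by (subst suminf_diff [symmetric]) (simp_all add: suminf_mult sq' sY summable_mult del: mult.assoc)
  finally have "rGamma p * rGamma q * (\<Sum>n. ?f n * ?q n)
     = rGamma (r - p) * rGamma (r - q) * (\<Sum>j. ?f' j * ?q' j) - rGamma \<gamma> * rGamma r * Wsum \<gamma> a (e - c) (e - d) e p q r"
    unfolding Q .
  then have "?C * (rGamma p * rGamma q * (\<Sum>n. ?f n * ?q n)) - ?C * (rGamma (r - p) * rGamma (r - q) * (\<Sum>j. ?f' j * ?q' j))
    = - (?C * (rGamma \<gamma> * rGamma r * Wsum \<gamma> a (e - c) (e - d) e p q r))"
    by (simp add: right_diff_distrib)
  moreover have "f - b = r - p" "g - b = r - q" by (simp_all add: p_def q_def r_def)
  ultimately show ?thesis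
    unfolding F F' by (simp add: p_def [symmetric] q_def [symmetric] r_def [symmetric] \<gamma>_def [symmetric] mult_ac)
qed


definition rK :: "complex \<Rightarrow> complex \<Rightarrow> complex \<Rightarrow> complex \<Rightarrow> complex \<Rightarrow> complex \<Rightarrow> complex \<Rightarrow> complex" where
  "rK a b c d e f g =
     rF43 a b c d e f g * (rGamma (1 + a - e) * rGamma (1 + a - f) * rGamma (1 + a - g)) +
     rF43 a (1 + a - e) (1 + a - f) (1 + a - g) (1 + a - b) (1 + a - c) (1 + a - d) *
       (rGamma b * rGamma c * rGamma d)"

lemma holomorphic_rK:
  assumes "a holomorphic_on UNIV" "b holomorphic_on UNIV" "c holomorphic_on UNIV" "d holomorphic_on UNIV"
      "e holomorphic_on UNIV" "f holomorphic_on UNIV" "g holomorphic_on UNIV"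
    and bal: "\<And>t. e t + f t + g t - a t - b t - c t - d t = 1"
  shows "(\<lambda>t. rK (a t) (b t) (c t) (d t) (e t) (f t) (g t)) holomorphic_on UNIV"
  unfolding rK_def
proof (intro holomorphic_intros holomorphic_rF43 assms)
  show "1 + a t - b t + (1 + a t - c t) + (1 + a t - d t) - a t - (1 + a t - e t) - (1 + a t - f t) - (1 + a t - g t) = 1" for t
    using bal[of t] by (simp add: algebra_simps)
qed

lemma rK_symms:
  "rK a b c d e f g = rK a b d c e f g" "rK a b c d e f g = rK a c b d e f g"
  "rK a b c d e f g = rK a b c d f e g" "rK a b c d e f g = rK a b c d e g f"
  using rF43_symms by (simp_all add: rK_def mult_ac)

text \<open>The substitution exchanges the two series of \<open>rK\<close> together with their Gamma
  factors. It gives every relation a second form, with 1 + a - e, 1 + a - f, 1 + a - g in upper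
  position.\<close>

lemma rK_swap: "rK a b c d e f g = rK a (1 + a - e) (1 + a - f) (1 + a - g) (1 + a - b) (1 + a - c) (1 + a - d)"
  by (simp add: rK_def add.commute)

text \<open>The defect formula is applied to the first series of the left-hand side and to the
  second series of the right-hand side. Multiplied by \<open>rGamma (1 + a - e)\<close> and
  \<open>rGamma b\<close> respectively, the two defects are the same multiple of the same
  \<open>Wsum\<close> once its two groups of parameters are exchanged.\<close>

lemma rK_Whipple_generic:
  assumes bal: "e + f + g - a - b - c - d = 1" and re: "Re (c + d - e) > 0"
    and gen: "\<forall>z\<in>{a, b, e, f, g, a - b, a - f, a - g, a + b - f, a + b - g, f - b, g - b, a + e - c - d, 2 * a - f - g}. z \<notin> \<int>"
     "\<forall>z\<in>{a, 1 + a - e, 1 + a - b, 1 + a - e + c, 1 + a - e + d, a - (1 + a - e), a - (1 + a - e + c), a - (1 + a - e + d),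
        a + (1 + a - e) - (1 + a - e + c), a + (1 + a - e) - (1 + a - e + d), 1 + a - e + c - (1 + a - e), 1 + a - e + d - (1 + a - e),
        a + (1 + a - b) - (g - b) - (f - b), 2 * a - (1 + a - e + c) - (1 + a - e + d)}. z \<notin> \<int>"
  shows "rK a b c d e f g = rK a b (e - c) (e - d) e (1 + a + b - f) (1 + a + b - g)"
proof -
  let ?\<gamma> = "c + d - e"
  let ?W = "Wsum ?\<gamma> a (e - c) (e - d) e (1 + a - f) (1 + a - g) (1 + a - b)"
  have g1: "g - b + (f - b) - (1 + a - b) = ?\<gamma>" using bal by (simp add: algebra_simps)
  have 1: "rF43 a b c d e f g * (rGamma (1 + a - f) * rGamma (1 + a - g))
       - rF43 a b (e - c) (e - d) e (1 + a + b - f) (1 + a + b - g) * (rGamma (f - b) * rGamma (g - b))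
     = - (rGamma a * rGamma b * rGamma e * rGamma ?\<gamma> * rGamma (1 + a - b)) * ?W"
    by (rule rF43_Whipple_defect[OF bal re gen(1)])
  have "(1 + a - b) + (1 + a - e + c) + (1 + a - e + d) - a - (1 + a - e) - (g - b) - (f - b) = 1"
    using bal by (simp add: algebra_simps)
  from rF43_Whipple_defect[OF this _ gen(2)]
  have 2: "rF43 a (1 + a - e) (g - b) (f - b) (1 + a - b) (1 + a - e + c) (1 + a - e + d) * (rGamma (e - c) * rGamma (e - d))
     - rF43 a (1 + a - e) (1 + a - g) (1 + a - f) (1 + a - b) (1 + a - c) (1 + a - d) * (rGamma c * rGamma d)
     = - (rGamma a * rGamma (1 + a - e) * rGamma (1 + a - b) * rGamma ?\<gamma> * rGamma e)
        * Wsum ?\<gamma> a (1 + a - g) (1 + a - f) (1 + a - b) (e - c) (e - d) e"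
    unfolding g1 using re by (simp add: algebra_simps)
  have W: "Wsum ?\<gamma> a (1 + a - g) (1 + a - f) (1 + a - b) (e - c) (e - d) e = ?W"
  proof -
    have "Wsum ?\<gamma> a (e - c) (e - d) e (1 + a - f) (1 + a - g) (1 + a - b)
        = Wsum ?\<gamma> a (1 + a - f) (1 + a - g) (1 + a - b) (e - c) (e - d) e"
    proof (rule Wsum_swap)
      have nn: "z + 1 \<notin> \<int>\<^sub>\<le>\<^sub>0" if "z \<notin> \<int>" for z :: complex
        using plus_of_nat_not_nonpos_Ints[OF not_Ints_imp_not_nonpos_Ints[OF that], of 1] by simp
      show "1 + a - b \<notin> \<int>\<^sub>\<le>\<^sub>0" "e \<notin> \<int>\<^sub>\<le>\<^sub>0" "a \<notin> \<int>\<^sub>\<le>\<^sub>0" using gen by (simp_all add: not_Ints_imp_not_nonpos_Ints)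
      show "a + 1 - (c + d - e) \<notin> \<int>\<^sub>\<le>\<^sub>0" using nn[of "a + e - c - d"] gen by (simp add: algebra_simps)
      show "e - (e - c) - (e - d) = c + d - e" by simp
      show "1 + a - b - (1 + a - f) - (1 + a - g) = c + d - e" using bal by (simp add: algebra_simps)
    qed (rule re)
    then show ?thesis unfolding Wsum_def F21_coeff_commute[of "1 + a - g"] by simp
  qed
  have e: "1 + a - (1 + a + b - f) = f - b" "1 + a - (1 + a + b - g) = g - b" "1 + a - (e - c) = 1 + a - e + c" "1 + a - (e - d) = 1 + a - e + d"
    by simp_all
  have "rF43 a (1 + a - e) (g - b) (f - b) (1 + a - b) (1 + a - e + c) (1 + a - e + d)
      = rF43 a (1 + a - e) (f - b) (g - b) (1 + a - b) (1 + a - e + c) (1 + a - e + d)"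
    "rF43 a (1 + a - e) (1 + a - g) (1 + a - f) (1 + a - b) (1 + a - c) (1 + a - d)
      = rF43 a (1 + a - e) (1 + a - f) (1 + a - g) (1 + a - b) (1 + a - c) (1 + a - d)"
    by (rule rF43_symms)+
  moreover have "F1 * (e1 * f1 * g1) + F2 * (rb * rc * rd) = F1' * (e1 * fb * gb) + F2' * (rb * ec * ed)"
    if "F1 * (f1 * g1) - F1' * (fb * gb) = - (ra * rb * re * r\<gamma> * rr) * w"
       "F2' * (ec * ed) - F2 * (rc * rd) = - (ra * e1 * rr * r\<gamma> * re) * w"
    for F1 F1' F2 F2' e1 f1 g1 fb gb ra rb rc rd re ec ed r\<gamma> rr w :: complex
    using that by algebra
  ultimately show ?thesis
    using 1 2 unfolding rK_def e W by presburger
qed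

lemma rK_Whipple:
  assumes bal: "e + f + g - a - b - c - d = 1"
  shows "rK a b c d e f g = rK a b (e - c) (e - d) e (1 + a + b - f) (1 + a + b - g)"
proof -
  \<comment> \<open>A complex line in V through the given point: the slope -108889 of
    \<open>G\<close> preserves balance, as 10000 + 100000 - 108889 = 1111 = 1 + 10 + 100 + 1000.
    With powers of ten as the other slopes, no form in \<open>\<Phi>\<close> is constant.\<close>
  define A B C D E F G where
    "A t = a + t" and "B t = b + 10 * t" and "C t = c + 100 * t" and "D t = d + 1000 * t"
    and "E t = e + 10000 * t" and "F t = f + 100000 * t" and "G t = g - 108889 * t" for t
  note defs = A_def B_def C_def D_def E_def F_def G_def
  have bal': "E t + F t + G t - A t - B t - C t - D t = 1" for t
    using bal by (simp add: defs algebra_simps)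
  have hol: "A holomorphic_on UNIV" "B holomorphic_on UNIV" "C holomorphic_on UNIV" "D holomorphic_on UNIV"
    "E holomorphic_on UNIV" "F holomorphic_on UNIV" "G holomorphic_on UNIV"
    unfolding defs by (intro holomorphic_intros)+
  define H where "H t = rK (A t) (B t) (C t) (D t) (E t) (F t) (G t)
     - rK (A t) (B t) (E t - C t) (E t - D t) (E t) (1 + A t + B t - F t) (1 + A t + B t - G t)" for t
  define \<Phi> where "\<Phi> = [A, B, E, F, G, \<lambda>t. A t - B t, \<lambda>t. A t - F t, \<lambda>t. A t - G t, \<lambda>t. A t
        + B t - F t, \<lambda>t. A t + B t - G t,
     \<lambda>t. F t - B t, \<lambda>t. G t - B t, \<lambda>t. A t + E t - C t - D t, \<lambda>t. 2 * A t - F t - G t, 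
     \<lambda>t. 1 + A t - E t, \<lambda>t. 1 + A t - B t, \<lambda>t. 1 + A t - E t + C t, \<lambda>t. 1 + A t - E t + D t, \<lambda>t. A t - (1 + A t - E t),
     \<lambda>t. A t - (1 + A t - E t + C t), \<lambda>t. A t - (1 + A t - E t + D t),
     \<lambda>t. A t + (1 + A t - E t) - (1 + A t - E t + C t), \<lambda>t. A t + (1 + A t - E t) - (1 + A t - E t + D t),
     \<lambda>t. 1 + A t - E t + C t - (1 + A t - E t), \<lambda>t. 1 + A t - E t + D t - (1 + A t - E t),
     \<lambda>t. A t + (1 + A t - B t) - (G t - B t) - (F t - B t), \<lambda>t. 2 * A t - (1 + A t - E t + C t) - (1 + A t - E t + D t)]"
  define U where "U = {t. Re (C t + D t - E t) > 0}"
  have "H 0 = 0"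
  proof (rule entire_zero_off_integers[where E = H and t = 0 and \<Phi> = \<Phi> and U = U])
    show "H holomorphic_on UNIV"
      unfolding H_def
      by (intro holomorphic_intros holomorphic_rK hol bal') (use bal' in \<open>simp_all add: algebra_simps\<close>)
    show "\<forall>\<phi>\<in>set \<Phi>. \<phi> 1 \<noteq> \<phi> 0 \<and> (\<forall>t. \<phi> t = \<phi> 0 + (\<phi> 1 - \<phi> 0) * t)"
      unfolding \<Phi>_def by (simp add: defs algebra_simps)
    show "open U" unfolding U_def defs by (intro open_Collect_less continuous_intros)
    \<comment> \<open>Along the line C + D - E has slope 100 + 1000 - 10000 = -8900, so a negative
      real t of size |Re (c + d - e)| + 1 makes its real part positive.\<close>
    have "x + 8900 * (\<bar>x\<bar> + 1) > 0" for x :: real by (cases "x \<ge> 0") auto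
    from this[of "Re (c + d - e)"]
    show "of_real (- (\<bar>Re (c + d - e)\<bar> + 1)) \<in> U"
      unfolding U_def defs by (simp add: algebra_simps)
    show "H t = 0" if "t \<in> U" "\<forall>\<phi>\<in>set \<Phi>. \<phi> t \<notin> \<int>" for t
      using rK_Whipple_generic[OF bal', of t] that unfolding H_def U_def \<Phi>_def by simp
  qed
  then show ?thesis by (simp add: H_def defs)
qed

section \<open>Vanishing sums of residues of a rational function\<close>

text \<open>The sum is the coefficient of degree card I - 1 in the polynomial interpolating P at the
  nodes. By the degree bound this polynomial is P, which has no such coefficient. In other words, P
  / \<Prod>(x - t i) has no residue at infinity.\<close>

lemma Lagrange_sum_eq_0:
  fixes t :: "'i \<Rightarrow> 'a :: field" and P :: "'a poly"
  assumes fin: "finite I" and inj: "inj_on t I" and deg: "Suc (degree P) < card I"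
  shows "(\<Sum>i\<in>I. poly P (t i) / (\<Prod>j\<in>I-{i}. t i - t j)) = 0"
proof -
  define w where "w i = poly P (t i) / (\<Prod>j\<in>I-{i}. t i - t j)" for i
  define M where "M i = (\<Prod>j\<in>I-{i}. [:- t j, 1:])" for i
  define L where "L = (\<Sum>i\<in>I. smult (w i) (M i))"
  have degM: "degree (M i) = card I - 1" and leadM: "coeff (M i) (card I - 1) = 1" if "i \<in> I" for i
  proof -
    have "degree (M i) = (\<Sum>j\<in>I-{i}. degree [:- t j, 1:])"
      unfolding M_def by (rule degree_prod_eq_sum_degree) simp
    then show d: "degree (M i) = card I - 1" using that by simp
    have "lead_coeff (M i) = 1" unfolding M_def lead_coeff_prod by simp
    then show "coeff (M i) (card I - 1) = 1" by (simp add: d)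
  qed
  have "degree L \<le> card I - 1" unfolding L_def
    by (intro degree_sum_le fin order.trans[OF degree_smult_le]) (simp add: degM)
  then have "L = P"
  proof (intro poly_eqI_degree[of "t ` I"])
    fix x assume "x \<in> t ` I"
    then obtain i where i: "i \<in> I" "x = t i" by blast
    have "poly L x = (\<Sum>k\<in>I. w k * (\<Prod>j\<in>I-{k}. t i - t j))"
      by (simp add: L_def M_def poly_sum poly_prod i)
    also have "\<dots> = (\<Sum>k\<in>I. if k = i then w i * (\<Prod>j\<in>I-{i}. t i - t j) else 0)"
    proof (intro sum.cong refl)
      fix k assume "k \<in> I"
      have "(\<Prod>j\<in>I-{k}. t i - t j) = 0" if "k \<noteq> i"
        using fin i that by (intro prod_zero) auto
      then show "w k * (\<Prod>j\<in>I-{k}. t i - t j) = (if k = i then w i * (\<Prod>j\<in>I-{i}. t i - t j) else 0)" by simp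
    qed
    also have "\<dots> = w i * (\<Prod>j\<in>I-{i}. t i - t j)" using i fin by simp
    also have "\<dots> = poly P x"
    proof -
      have "(\<Prod>j\<in>I-{i}. t i - t j) \<noteq> 0" using fin i inj by (auto simp: inj_on_def)
      then show ?thesis by (simp add: w_def i)
    qed
    finally show "poly L x = poly P x" .
  qed (use deg card_image[OF inj] in auto)
  then have "coeff L (card I - 1) = 0" using deg by (simp add: coeff_eq_0)
  moreover have "coeff L (card I - 1) = (\<Sum>i\<in>I. w i)"
    unfolding L_def coeff_sum coeff_smult by (intro sum.cong refl) (simp only: leadM mult_1_right)
  ultimately show ?thesis by (simp add: w_def)
qed

text \<open>The nodes will be arranged in rows: the denominator at one node splits into the rest of
  its own row and the other rows.\<close>

lemma prod_Times_remove:
  assumes "finite A" "finite B" "i \<in> A" "k \<in> B"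
  shows "(\<Prod>p\<in>A \<times> B - {(i, k)}. f p) = (\<Prod>l\<in>B-{k}. f (i, l)) * (\<Prod>j\<in>A-{i}. \<Prod>l\<in>B. f (j, l))"
proof -
  have eq: "A \<times> B - {(i, k)} = Pair i ` (B - {k}) \<union> (A - {i}) \<times> B" using assms by auto
  have "(\<Prod>p\<in>A \<times> B - {(i, k)}. f p) = prod f (Pair i ` (B - {k})) * prod f ((A - {i}) \<times> B)"
    unfolding eq using assms by (intro prod.union_disjoint) auto
  also have "prod f (Pair i ` (B - {k})) = (\<Prod>l\<in>B-{k}. f (i, l))"
    by (subst prod.reindex) (auto simp: inj_on_def)
  also have "prod f ((A - {i}) \<times> B) = (\<Prod>j\<in>A-{i}. \<Prod>l\<in>B. f (j, l))"
    by (simp add: prod.cartesian_product)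
  finally show ?thesis .
qed

lemma poly_pochhammer: "poly (pochhammer p n) x = pochhammer (poly p x) n"
  by (simp add: pochhammer_prod poly_prod)

lemma degree_pochhammer_le:
  assumes "degree p \<le> 1"
  shows "degree (pochhammer p n) \<le> n"
proof (induction n)
  case (Suc n)
  have "degree (pochhammer p n * (p + of_nat n)) \<le> degree (pochhammer p n) + degree (p + of_nat n)"
    by (rule degree_mult_le)
  also have "degree (p + of_nat n) \<le> 1" using assms by (intro degree_add_le) auto
  finally show ?case using Suc by (simp add: pochhammer_Suc)
qed simp

lemma pochhammer_shift_down:
  fixes x :: complex
  assumes "k \<le> n"
  shows "pochhammer (x - of_nat k) n = (-1) ^ k * pochhammer (1 - x) k * pochhammer x (n - k)"
  using assms pochhammer_product[of k n "x - of_nat k"] pochhammer_minus[of "of_nat k - x" k]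
  by simp

lemma pochhammer_shift_up:
  fixes x :: complex
  assumes "x \<notin> \<int>\<^sub>\<le>\<^sub>0"
  shows "pochhammer (x + of_nat k) n = pochhammer x (k + n) / pochhammer x k"
proof -
  have "pochhammer x k \<noteq> 0" using assms pochhammer_eq_0_imp_nonpos_Int by blast
  then show ?thesis by (simp add: pochhammer_product')
qed

lemma prod_diff_remove:
  assumes "k \<le> N"
  shows "(\<Prod>l\<in>{..N}-{k}. of_nat l - of_nat k :: complex) = (-1) ^ k * fact k * fact (N - k)"
proof -
  have eq: "{..N} - {k} = {..<k} \<union> {Suc k..N}" using assms by auto
  have "(\<Prod>l\<in>{..N}-{k}. of_nat l - of_nat k :: complex) = (\<Prod>l<k. of_nat l - of_nat k) * (\<Prod>l=Suc k..N. of_nat l - of_nat k)"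
    unfolding eq by (rule prod.union_disjoint) auto
  also have "(\<Prod>l<k. of_nat l - of_nat k :: complex) = (\<Prod>l<k. - of_nat (k - l))"
    by (intro prod.cong) (auto simp: of_nat_diff)
  also have "\<dots> = (-1) ^ k * (\<Prod>l<k. of_nat (k - l))" 
    unfolding prod_uminus by simp
  also have "(\<Prod>l<k. of_nat (k - l) :: complex) = fact k"
    by (simp add: fact_prod_rev atLeast0LessThan)
  also have "(\<Prod>l=Suc k..N. of_nat l - of_nat k :: complex) = (\<Prod>l=1..N-k. of_nat l)"
    by (rule prod.reindex_bij_witness[of _ "\<lambda>l. l + k" "\<lambda>l. l - k"]) (auto simp: of_nat_diff)
  also have "\<dots> = fact (N - k)" by (simp add: fact_prod)
  finally show ?thesis .
qed

lemma asymp_powr_shift: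
  assumes "asymp_powr f z l"
  shows "asymp_powr (\<lambda>n. f (n + k)) z l"
proof -
  have "(\<lambda>n. ln (real (Suc (n + k))) - ln (real (Suc n))) \<longlonglongrightarrow> 0" by real_asymp
  then have "(\<lambda>n. exp (z * of_real (ln (real (Suc (n + k))) - ln (real (Suc n))))) \<longlonglongrightarrow> exp (z * of_real 0)"
    by (intro tendsto_intros)
  moreover have "(\<lambda>n. f (n + k) * of_nat (Suc (n + k)) powr (-z)) \<longlonglongrightarrow> l"
    using LIMSEQ_ignore_initial_segment[OF assms[unfolded asymp_powr_def], of k] by simp
  ultimately have "(\<lambda>n. f (n + k) * of_nat (Suc (n + k)) powr (-z) * exp (z * of_real (ln (real (Suc (n
        + k))) - ln (real (Suc n))))) \<longlonglongrightarrow> l * exp (z * of_real 0)"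
    by (rule_tac tendsto_mult)
  moreover have "of_nat (Suc (n + k)) powr (-z) * exp (z * of_real (ln (real (Suc (n + k))) - ln (real (Suc n)))) = of_nat (Suc n) powr (-z)" for n
    by (simp add: powr_def Ln_of_nat exp_add [symmetric] algebra_simps del: of_nat_Suc)
  ultimately show ?thesis unfolding asymp_powr_def by (simp only: mult.assoc) simp
qed

text \<open>Cutting the sum off at N costs at most the power |\<rho>| of k, uniformly in N. For
  negative \<rho> this rests on N + k + 1 \<le> 2 (k+1) (N-k+1), valid for k \<le> N.\<close>

lemma powr_ratio_bound:
  fixes \<rho> :: real
  assumes "k \<le> N" "\<bar>\<rho>\<bar> \<le> 1"
  shows "real (Suc (N - k)) powr \<rho> * real (Suc (N + k)) powr (- \<rho>) \<le> 2 * real (Suc k) powr \<bar>\<rho>\<bar>"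
proof (cases "\<rho> \<ge> 0")
  case True
  have "real (Suc (N - k)) powr \<rho> * real (Suc (N + k)) powr (- \<rho>) \<le> real (Suc (N + k)) powr \<rho> * real (Suc (N + k)) powr (- \<rho>)"
    using True by (intro mult_right_mono powr_mono2) auto
  also have "\<dots> = 1" by (simp add: powr_add [symmetric] del: of_nat_Suc)
  also have "1 \<le> 2 * real (Suc k) powr \<bar>\<rho>\<bar>"
    using ge_one_powr_ge_zero[of "real (Suc k)" "\<bar>\<rho>\<bar>"] by (auto simp del: of_nat_Suc)
  finally show ?thesis .
next
  case False
  have "Suc (N + k) \<le> 2 * (Suc k * Suc (N - k))"
  proof -
    obtain m where "N = k + m" using assms(1) le_Suc_ex by blast
    then show ?thesis by simp
  qed
  then have "real (Suc (N + k)) \<le> real (2 * (Suc k * Suc (N - k)))" by (rule of_nat_mono)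
  then have "real (Suc (N + k)) \<le> 2 * (real (Suc k) * real (Suc (N - k)))"
    by (simp only: of_nat_mult of_nat_numeral)
  then have "real (Suc (N + k)) powr (- \<rho>) \<le> (2 * (real (Suc k) * real (Suc (N - k)))) powr (- \<rho>)"
    using False by (intro powr_mono2) (auto simp del: of_nat_Suc)
  also have "\<dots> = 2 powr (- \<rho>) * (real (Suc k) powr (- \<rho>) * real (Suc (N - k)) powr (- \<rho>))"
    by (simp add: powr_mult del: of_nat_Suc)
  finally have "real (Suc (N - k)) powr \<rho> * real (Suc (N + k)) powr (- \<rho>)
     \<le> real (Suc (N - k)) powr \<rho> * (2 powr (- \<rho>) * (real (Suc k) powr (- \<rho>) * real (Suc (N - k)) powr (- \<rho>)))"
    by (rule mult_left_mono) simp
  also have "\<dots> = 2 powr (- \<rho>) * real (Suc k) powr (- \<rho>) * (real (Suc (N - k)) powr \<rho> * real (Suc (N - k)) powr (- \<rho>))"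
    by (simp only: mult_ac)
  also have "real (Suc (N - k)) powr \<rho> * real (Suc (N - k)) powr (- \<rho>) = 1"
    by (simp add: powr_add [symmetric] del: of_nat_Suc)
  also have "2 powr (- \<rho>) * real (Suc k) powr (- \<rho>) * 1 \<le> 2 * real (Suc k) powr \<bar>\<rho>\<bar>"
  proof -
    have "2 powr (- \<rho>) \<le> (2::real) powr 1" using assms False by (intro powr_mono) auto
    then show ?thesis using False by (auto intro!: mult_right_mono simp del: of_nat_Suc)
  qed
  finally show ?thesis .
qed

text \<open>For fixed k the powers N^\<rho> and N^(-\<rho>) cancel in the limit. Tannery's theorem
  then uses a multiple of k^(-2 + |Re \<rho>|) as majorant, which is summable for |Re \<rho>| < 1;
  this is the origin of the condition on Re (1 - d) further on.\<close>

lemma truncated_sum_tendsto: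
  assumes \<sigma>: "asymp_powr \<sigma> \<rho> l1" and \<tau>: "asymp_powr \<tau> (- \<rho>) l2" and \<rho>: "\<bar>Re \<rho>\<bar> < 1"
    and h: "asymp_powr h (-2) l3"
  shows "(\<lambda>N. \<Sum>k\<le>N. h k * (\<sigma> (N - k) * \<tau> (N + k))) \<longlonglongrightarrow> (\<Sum>k. h k) * (l1 * l2)"
proof -
  obtain C1 where C1: "C1 > 0" "\<And>n. norm (\<sigma> n) \<le> C1 * real (Suc n) powr Re \<rho>"
    using asymp_powr_bound[OF \<sigma>] by blast
  obtain C2 where C2: "C2 > 0" "\<And>n. norm (\<tau> n) \<le> C2 * real (Suc n) powr (- Re \<rho>)"
    using asymp_powr_bound[OF \<tau>] by auto
  obtain C3 where C3: "C3 > 0" "\<And>n. norm (h n) \<le> C3 * real (Suc n) powr (-2)"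
    using asymp_powr_bound[OF h] by auto
  let ?a = "\<lambda>k N. if k \<le> N then h k * (\<sigma> (N - k) * \<tau> (N + k)) else 0"
  have lim: "(\<lambda>N. ?a k N) \<longlonglongrightarrow> h k * (l1 * l2)" for k
  proof -
    have "asymp_powr (\<lambda>n. \<sigma> n * \<tau> (n + 2 * k)) (\<rho> + - \<rho>) (l1 * l2)"
      by (intro asymp_powr_mult \<sigma> asymp_powr_shift \<tau>)
    then have "(\<lambda>n. h k * (\<sigma> n * \<tau> (n + 2 * k))) \<longlonglongrightarrow> h k * (l1 * l2)"
      by (intro tendsto_mult_left) (simp add: asymp_powr_0_iff)
    then have "(\<lambda>n. ?a k (n + k)) \<longlonglongrightarrow> h k * (l1 * l2)" by (simp add: mult_2 add_ac)
    then show ?thesis by (rule LIMSEQ_offset)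
  qed
  have bound: "norm (?a k N) \<le> C3 * C1 * C2 * 2 * real (Suc k) powr (-2 + \<bar>Re \<rho>\<bar>)" for k N
  proof (cases "k \<le> N")
    case True
    then have "norm (?a k N) \<le> (C3 * real (Suc k) powr (-2)) * ((C1 * real (Suc (N - k)) powr Re \<rho>) * (C2 * real (Suc (N + k)) powr (- Re \<rho>)))"
      unfolding norm_mult if_P[OF True] by (intro mult_mono C1(2) C2(2) C3(2)) (use C1(1) C2(1) C3(1) in auto)
    also have "\<dots> = C3 * C1 * C2 * real (Suc k) powr (-2) * (real (Suc (N - k)) powr Re \<rho> * real (Suc (N + k)) powr (- Re \<rho>))"
      by (simp only: mult_ac)
    also have "\<dots> \<le> C3 * C1 * C2 * real (Suc k) powr (-2) * (2 * real (Suc k) powr \<bar>Re \<rho>\<bar>)"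
      using True \<rho> C1(1) C2(1) C3(1) by (intro mult_left_mono powr_ratio_bound) auto
    also have "\<dots> = C3 * C1 * C2 * 2 * real (Suc k) powr (-2 + \<bar>Re \<rho>\<bar>)"
      by (simp only: powr_add mult_ac)
    finally show ?thesis .
  qed (use C1(1) C2(1) C3(1) in simp)
  have "summable (\<lambda>k. C3 * C1 * C2 * 2 * real (Suc k) powr (-2 + \<bar>Re \<rho>\<bar>))"
    using \<rho> by (intro summable_mult summable_Suc_powr) auto
  from tannerys_theorem[OF lim _ this]
  have "(\<lambda>N. \<Sum>k. ?a k N) \<longlonglongrightarrow> (\<Sum>k. h k * (l1 * l2))"
    using bound by (force intro!: always_eventually)
  moreover have "(\<Sum>k. ?a k N) = (\<Sum>k\<le>N. h k * (\<sigma> (N - k) * \<tau> (N + k)))" for N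
    by (subst suminf_finite[of "{..N}"]) auto
  moreover have "summable h"
    by (intro summable_norm_cancel[OF asymp_powr_summable[OF h]]) simp
  then have "(\<Sum>k. h k * (l1 * l2)) = (\<Sum>k. h k) * (l1 * l2)" by (rule suminf_mult2 [symmetric])
  ultimately show ?thesis by simp
qed

definition F43_coeff ::
  "complex \<Rightarrow> complex \<Rightarrow> complex \<Rightarrow> complex \<Rightarrow> complex \<Rightarrow> complex \<Rightarrow> complex \<Rightarrow> nat \<Rightarrow> complex" where
  "F43_coeff a b c d e f g n = pochhammer a n * pochhammer b n * pochhammer c n * pochhammer d n /
           (fact n * pochhammer e n * pochhammer f n * pochhammer g n)"

lemma asymp_powr_F43_coeff:
  assumes "e + f + g - a - b - c - d = 1" "e \<notin> \<int>\<^sub>\<le>\<^sub>0" "f \<notin> \<int>\<^sub>\<le>\<^sub>0" "g \<notin> \<int>\<^sub>\<le>\<^sub>0"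
  shows "asymp_powr (F43_coeff a b c d e f g) (-2) (rGamma a * rGamma b * rGamma c * rGamma d * (Gamma e * Gamma f * Gamma g))"
proof -
  have "(a - 1) + (b - 1) + (c - 1) + (d - 1) + ((1 - e) + (1 - f) + (1 - g)) = -2"
    using assms(1) by (simp add: algebra_simps)
  then show ?thesis
    by (intro asymp_powr_cong[OF _ _ _ asymp_powr_mult[OF
        asymp_powr_mult[OF asymp_powr_mult[OF asymp_powr_mult[OF asymp_powr_pochhammer[of a] asymp_powr_pochhammer[of b]]
          asymp_powr_pochhammer[of c]] asymp_powr_pochhammer[of d]]
        asymp_powr_mult[OF asymp_powr_mult[OF asymp_powr_inverse_pochhammer[OF assms(2)] asymp_powr_inverse_pochhammer[OF assms(3)]]
          asymp_powr_inverse_pochhammer[OF assms(4)]]]])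
       (simp_all add: F43_coeff_def)
qed

text \<open>The residues of the rational function
  $(1-d-t)_{N+1} (e+t)_N (f+t)_N (g+t)_{N+1} / (t(t-1)\cdots(t-N) (a+t)_{N+1} (b+t)_{N+1} (c+t)_{N+1})$
  at $t = -a-k$ and at $t = k$. The denominator exceeds the numerator by two in degree, so they sum to zero.\<close>

definition residue_left :: "complex \<Rightarrow> complex \<Rightarrow> complex \<Rightarrow> complex \<Rightarrow> complex \<Rightarrow> complex \<Rightarrow> complex \<Rightarrow> nat \<Rightarrow> nat \<Rightarrow> complex" where
  "residue_left a b c d e f g N k =
     pochhammer (1 - d + a + of_nat k) (Suc N) * pochhammer (e - a - of_nat k) N * pochhammer (f - a - of_nat k) N * pochhammer (g - a - of_nat k) (Suc N) /
     ((-1) ^ k * fact k * fact (N - k) * ((-1) ^ Suc N * pochhammer (a + of_nat k) (Suc N)) *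
      pochhammer (b - a - of_nat k) (Suc N) * pochhammer (c - a - of_nat k) (Suc N))"

text \<open>Separates a factor in k alone, one in N - k and one in N + k, the shape required by
  \<open>truncated_sum_tendsto\<close>; \<open>residue_right_eq\<close> does the same for the other
  poles.\<close>

lemma residue_left_eq:
  assumes "k \<le> N" "a \<notin> \<int>\<^sub>\<le>\<^sub>0" "1 + a - d \<notin> \<int>\<^sub>\<le>\<^sub>0"
  shows "residue_left a b c d e f g N k = (-1) ^ Suc N *
     (F43_coeff a (1 + a - e) (1 + a - f) (1 + a - g) (1 + a - b) (1 + a - c) (1 + a - d) k *
     ((pochhammer (e - a) (N - k) * pochhammer (f - a) (N - k) * pochhammer (g - a) (Suc (N - k)) /
       (fact (N - k) * pochhammer (b - a) (Suc (N - k)) * pochhammer (c - a) (Suc (N - k)))) *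
      (pochhammer (1 + a - d) (Suc (N + k)) / pochhammer a (Suc (N + k)))))"
proof -
  have s: "Suc N - k = Suc (N - k)" "k + Suc N = Suc (N + k)" using assms(1) by auto
  have k: "k \<le> Suc N" using assms(1) by simp
  have e: "1 - (z - a) = 1 + a - z" for z by simp
  have ad: "1 - d + a + of_nat k = (1 + a - d) + of_nat k" by simp
  show ?thesis
    unfolding residue_left_def ad F43_coeff_def
      pochhammer_shift_up[OF assms(2)] pochhammer_shift_up[OF assms(3)]
      pochhammer_shift_down[OF assms(1)] pochhammer_shift_down[OF k] s e
    by (cases "even k"; cases "even N") (simp_all add: divide_inverse mult_ac del: pochhammer_Suc)
qed

definition residue_right :: "complex \<Rightarrow> complex \<Rightarrow> complex \<Rightarrow> complex \<Rightarrow> complex \<Rightarrow> complex \<Rightarrow> complex \<Rightarrow> nat \<Rightarrow> nat \<Rightarrow> complex" where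
  "residue_right a b c d e f g N n =
     pochhammer (1 - d - of_nat n) (Suc N) * pochhammer (e + of_nat n) N * pochhammer (f + of_nat n) N * pochhammer (g + of_nat n) (Suc N) /
     ((-1) ^ N * ((-1) ^ n * fact n * fact (N - n)) * pochhammer (a + of_nat n) (Suc N) *
      pochhammer (b + of_nat n) (Suc N) * pochhammer (c + of_nat n) (Suc N))"

lemma residue_right_eq:
  assumes "n \<le> N" "a \<notin> \<int>\<^sub>\<le>\<^sub>0" "b \<notin> \<int>\<^sub>\<le>\<^sub>0" "c \<notin> \<int>\<^sub>\<le>\<^sub>0" "e \<notin> \<int>\<^sub>\<le>\<^sub>0" "f \<notin> \<int>\<^sub>\<le>\<^sub>0" "g \<notin> \<int>\<^sub>\<le>\<^sub>0"
  shows "residue_right a b c d e f g N n = (-1) ^ N *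
     (F43_coeff a b c d e f g n *
     ((pochhammer (1 - d) (Suc (N - n)) / fact (N - n)) *
      (pochhammer e (N + n) * pochhammer f (N + n) * pochhammer g (Suc (N + n)) /
        (pochhammer a (Suc (N + n)) * pochhammer b (Suc (N + n)) * pochhammer c (Suc (N + n))))))"
proof -
  have s: "Suc N - n = Suc (N - n)" "n + Suc N = Suc (N + n)" "n + N = N + n" using assms(1) by auto
  have n: "n \<le> Suc N" using assms(1) by simp
  have d: "1 - (1 - d) = d" by simp
  show ?thesis
    unfolding residue_right_def F43_coeff_def
      pochhammer_shift_up[OF assms(2)] pochhammer_shift_up[OF assms(3)] pochhammer_shift_up[OF assms(4)]
      pochhammer_shift_up[OF assms(5)] pochhammer_shift_up[OF assms(6)] pochhammer_shift_up[OF assms(7)]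
      pochhammer_shift_down[OF n] s d
    by (cases "even n"; cases "even N") (simp_all add: divide_inverse mult_ac del: pochhammer_Suc)
qed

lemma prod_pochhammer: "(\<Prod>l\<le>N. x + of_nat l) = pochhammer x (Suc N)" for x :: complex
  by (simp add: pochhammer_prod atLeast0LessThan lessThan_Suc_atMost del: pochhammer_Suc)

lemma residue_sum_eq_0:
  assumes gen: "a \<notin> \<int>" "b \<notin> \<int>" "c \<notin> \<int>" "a - b \<notin> \<int>" "a - c \<notin> \<int>" "b - c \<notin> \<int>"
  shows "(\<Sum>k\<le>N. residue_right a b c d e f g N k) + (\<Sum>k\<le>N. residue_left a b c d e f g N k)
     + (\<Sum>k\<le>N. residue_left b a c d e f g N k) + (\<Sum>k\<le>N. residue_left c a b d e f g N k) = 0"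
proof -
  \<comment> \<open>Row 0 of the nodes holds the poles t = k, and rows 1, 2, 3 hold -a - k, -b - k,
    -c - k. This makes 4 N + 4 nodes against a numerator of degree at most 4 N + 2.\<close>
  define \<alpha> where "\<alpha> i = (if i = 1 then a else if i = 2 then b else c)" for i :: nat
  define t where "t p = (if fst p = 0 then of_nat (snd p) else - \<alpha> (fst p) - of_nat (snd p))" for p :: "nat \<times> nat"
  let ?A = "{0, 1, 2, 3 :: nat}"
  let ?I = "?A \<times> {..N}"
  define P where "P = pochhammer [:1 - d, -1:] (Suc N) * pochhammer [:e, 1:] N * pochhammer [:f, 1:] N * pochhammer [:g, 1:] (Suc N)"
  have "degree P \<le> Suc N + N + N + Suc N" unfolding P_def
    by (intro order.trans[OF degree_mult_le] add_mono degree_pochhammer_le) auto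
  then have deg: "Suc (degree P) < card ?I" by simp
  have int: "\<alpha> i \<notin> \<int>" if "i \<in> {1, 2, 3}" for i using gen that by (auto simp: \<alpha>_def)
  have sym: "b - a \<notin> \<int>" "c - a \<notin> \<int>" "c - b \<notin> \<int>"
    using gen(4-6) Ints_minus by (metis minus_diff_eq)+
  have int2: "\<alpha> i - \<alpha> j \<notin> \<int>" if "i \<in> {1, 2, 3}" "j \<in> {1, 2, 3}" "i \<noteq> j" for i j
    using gen(4-6) sym that by (auto simp: \<alpha>_def)
  have inj: "inj_on t ?I"
  proof (rule inj_onI)
    fix p q assume pq: "p \<in> ?I" "q \<in> ?I" and eq: "t p = t q"
    obtain i k j l where p: "p = (i, k)" "q = (j, l)" by (cases p, cases q)
    have ij: "i = 0 \<or> i \<in> {1,2,3}" "j = 0 \<or> j \<in> {1,2,3}" using pq p by auto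
    show "p = q"
    proof (cases "i = 0"; cases "j = 0")
      assume "i = 0" "j = 0"
      then show ?thesis using eq p by (simp add: t_def)
    next
      assume *: "i = 0" "j \<noteq> 0"
      then have e: "of_nat k = - \<alpha> j - of_nat l" using eq p by (simp add: t_def)
      have "\<alpha> j = of_int (- int k - int l)" by (simp add: e)
      then show ?thesis using int[of j] ij * by (metis Ints_of_int)
    next
      assume *: "i \<noteq> 0" "j = 0"
      then have e: "of_nat l = - \<alpha> i - of_nat k" using eq p by (simp add: t_def)
      have "\<alpha> i = of_int (- int k - int l)" by (simp add: e)
      then show ?thesis using int[of i] ij * by (metis Ints_of_int)
    next
      assume *: "i \<noteq> 0" "j \<noteq> 0"
      then have e: "\<alpha> i - \<alpha> j = of_int (int l - int k)" using eq p by (simp add: t_def algebra_simps)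
      then have "i = j" using int2[of i j] ij * by (metis Ints_of_int)
      then show ?thesis using e p by (simp add: of_int_eq_0_iff[symmetric])
    qed
  qed
  let ?w = "\<lambda>p. poly P (t p) / (\<Prod>j\<in>?I-{p}. t p - t j)"
  have "(\<Sum>p\<in>?I. ?w p) = 0" by (rule Lagrange_sum_eq_0[OF _ inj deg]) simp
  then have "(\<Sum>k\<le>N. ?w (0, k)) + (\<Sum>k\<le>N. ?w (1, k)) + (\<Sum>k\<le>N. ?w (2, k)) + (\<Sum>k\<le>N. ?w (3, k)) = 0"
  proof -
    have "(\<Sum>p\<in>?I. F p) = (\<Sum>k\<le>N. F (0, k)) + (\<Sum>k\<le>N. F (1, k)) + (\<Sum>k\<le>N. F (2, k)) + (\<Sum>k\<le>N. F (3, k))"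
      for F :: "nat \<times> nat \<Rightarrow> complex"
      unfolding sum.cartesian_product' by (simp add: add.assoc)
    from this[of ?w] show ?thesis using \<open>(\<Sum>p\<in>?I. ?w p) = 0\<close> by (simp only:)
  qed
  moreover have "?w (0, k) = residue_right a b c d e f g N k" if k: "k \<le> N" for k
  proof -
    have "(\<Prod>l\<in>{..N}-{k}. t (0, k) - t (0, l)) = (\<Prod>l\<in>{..N}-{k}. - (of_nat l - of_nat k))"
      by (simp add: t_def)
    also have "\<dots> = (-1) ^ N * ((-1) ^ k * fact k * fact (N - k))"
      unfolding prod_uminus prod_diff_remove[OF k] using k by simp
    finally have 1: "(\<Prod>l\<in>{..N}-{k}. t (0, k) - t (0, l)) = (-1) ^ N * ((-1) ^ k * fact k * fact (N - k))" .
    have 2: "(\<Prod>l\<le>N. t (0, k) - t (i, l)) = pochhammer (\<alpha> i + of_nat k) (Suc N)" if "i \<noteq> 0" for i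
      unfolding prod_pochhammer [symmetric] using that by (simp add: t_def algebra_simps)
    have 3: "?A - {0} = {1, 2, 3}" by auto
    have "(\<Prod>j\<in>?I-{(0, k)}. t (0, k) - t j) = (-1) ^ N * ((-1) ^ k * fact k * fact (N - k)) *
       (pochhammer (\<alpha> 1 + of_nat k) (Suc N) * (pochhammer (\<alpha> 2 + of_nat k) (Suc N) * pochhammer (\<alpha> 3 + of_nat k) (Suc N)))"
      using k by (subst prod_Times_remove) (simp_all add: 1 2 3 del: pochhammer_Suc)
    moreover have "poly P (t (0, k)) = pochhammer (1 - d - of_nat k) (Suc N) * pochhammer (e + of_nat k) N * pochhammer (f + of_nat k) N
        * pochhammer (g + of_nat k) (Suc N)"
      unfolding P_def poly_mult poly_pochhammer by (simp add: t_def del: pochhammer_Suc)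
    ultimately show ?thesis
      unfolding residue_right_def by (simp add: \<alpha>_def mult.assoc del: pochhammer_Suc)
  qed
  \<comment> \<open>One computation serves rows 1, 2 and 3; j and m stand for the remaining two of
    them.\<close>
  moreover have left: "?w (i, k) = residue_left (\<alpha> i) (\<alpha> j) (\<alpha> m) d e f g N k" if k: "k \<le> N" and ijm: "?A - {i}
        = {0, j, m}" "i \<in> {1, 2, 3}" "j \<noteq> 0" "m \<noteq> 0" "j \<noteq> m" for i j m k
  proof -
    have i0: "i \<noteq> 0" using ijm(2) by auto
    have 1: "(\<Prod>l\<in>{..N}-{k}. t (i, k) - t (i, l)) = (-1) ^ k * fact k * fact (N - k)"
      unfolding prod_diff_remove[OF k, symmetric] using i0 by (simp add: t_def)
    have "(\<Prod>l\<le>N. t (i, k) - t (0, l)) = (\<Prod>l\<le>N. - (\<alpha> i + of_nat k + of_nat l))"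
      using i0 by (intro prod.cong refl) (simp add: t_def)
    also have "\<dots> = (-1) ^ Suc N * pochhammer (\<alpha> i + of_nat k) (Suc N)"
      unfolding prod_uminus prod_pochhammer by simp
    finally have 2: "(\<Prod>l\<le>N. t (i, k) - t (0, l)) = (-1) ^ Suc N * pochhammer (\<alpha> i + of_nat k) (Suc N)" .
    have 3: "(\<Prod>l\<le>N. t (i, k) - t (j, l)) = pochhammer (\<alpha> j - \<alpha> i - of_nat k) (Suc N)" if "j \<noteq> 0" for j
      unfolding prod_pochhammer [symmetric] using i0 that by (simp add: t_def algebra_simps)
    have "(\<Prod>q\<in>?I-{(i, k)}. t (i, k) - t q) = (-1) ^ k * fact k * fact (N - k) *
       (((-1) ^ Suc N * pochhammer (\<alpha> i + of_nat k) (Suc N)) * (pochhammer (\<alpha> j - \<alpha> i - of_nat k) (Suc N) * pochhammer (\<alpha> m - \<alpha> i - of_nat k) (Suc N)))"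
    proof -
      have iA: "i \<in> ?A" and kN: "k \<in> {..N}" using ijm(2) k by auto
      have "(\<Prod>j\<in>{0, j, m}. F j) = F 0 * (F j * F m)" for F :: "nat \<Rightarrow> complex"
        using ijm(3-5) by simp
      then show ?thesis
        unfolding prod_Times_remove[OF finite.intros(2)[OF finite.intros(2)[OF finite.intros(2)[OF finite.intros(2)[OF finite.intros(1)]]]] finite_atMost iA kN] ijm(1)
        by (simp only: 1 2 3[OF ijm(3)] 3[OF ijm(4)])
    qed
    moreover have "poly P (t (i, k)) = pochhammer (1 - d + \<alpha> i + of_nat k) (Suc N) * pochhammer (e - \<alpha> i - of_nat k) N
        * pochhammer (f - \<alpha> i - of_nat k) N * pochhammer (g - \<alpha> i - of_nat k) (Suc N)"
      unfolding P_def poly_mult poly_pochhammer using i0 by (simp add: t_def algebra_simps del: pochhammer_Suc)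
    ultimately show ?thesis
      unfolding residue_left_def by (simp add: mult.assoc del: pochhammer_Suc power_Suc)
  qed
  have "?w (1, k) = residue_left a b c d e f g N k" if "k \<le> N" for k
    using left[OF that, of 1 2 3] by (force simp: \<alpha>_def)
  moreover have "?w (2, k) = residue_left b a c d e f g N k" if "k \<le> N" for k
    using left[OF that, of 2 1 3] by (force simp: \<alpha>_def)
  moreover have "?w (3, k) = residue_left c a b d e f g N k" if "k \<le> N" for k
    using left[OF that, of 3 1 2] by (force simp: \<alpha>_def)
  ultimately show ?thesis by simp
qed


section \<open>Passage to the limit: the four-term relation\<close>

abbreviation sinpi :: "complex \<Rightarrow> complex" where "sinpi z \<equiv> sin (of_real pi * z)"

lemma sinpi_nonzero: "z \<notin> \<int> \<Longrightarrow> sinpi z \<noteq> 0"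
  using sin_eq_0[of "of_real pi * z"] by (auto simp: mult.commute)

lemma rF43_conv_suminf:
  assumes "e + f + g - a - b - c - d = 1" "e \<notin> \<int>\<^sub>\<le>\<^sub>0" "f \<notin> \<int>\<^sub>\<le>\<^sub>0" "g \<notin> \<int>\<^sub>\<le>\<^sub>0"
  shows "(\<Sum>n. F43_coeff a b c d e f g n) = rF43 a b c d e f g * (Gamma e * Gamma f * Gamma g)"
proof -
  have G: "Gamma e * rGamma e = 1" "Gamma f * rGamma f = 1" "Gamma g * rGamma g = 1"
    using assms by (simp_all add: rGamma_inverse_Gamma Gamma_eq_zero_iff)
  have "F43 a b c d e f g = rF43 a b c d e f g * (Gamma e * Gamma f * Gamma g)"
    unfolding rF43_eq_F43[OF assms(2-4,1)] using G by algebra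
  then show ?thesis by (simp add: F43_def F43_coeff_def)
qed

text \<open>The sign (-1)^(N+1) removes the alternation seen in \<open>residue_left_eq\<close>, and
  \<open>truncated_sum_tendsto\<close> applies with exponent d - 1. Gamma(b - a) and Gamma(c - a)
  from the cut-off factor meet Gamma(1 + a - b) and Gamma(1 + a - c) from the series, and reflection
  turns them into sines.\<close>

lemma left_sum_tendsto:
  assumes bal: "e + f + g - a - b - c - d = 1" and re: "\<bar>Re (1 - d)\<bar> < 1"
    and gen: "a \<notin> \<int>" "a - b \<notin> \<int>" "a - c \<notin> \<int>" "a - d \<notin> \<int>"
  shows "(\<lambda>N. (-1) ^ Suc N * (\<Sum>k\<le>N. residue_left a b c d e f g N k)) \<longlonglongrightarrow>
    (complex_of_real pi)\<^sup>2 * Gamma a * rGamma (e - a) * rGamma (f - a) * rGamma (g - a) / (sinpi (b - a) * sinpi (c - a)) *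
    rF43 a (1 + a - e) (1 + a - f) (1 + a - g) (1 + a - b) (1 + a - c) (1 + a - d)"
proof -
  have shift: "1 + z \<notin> \<int>\<^sub>\<le>\<^sub>0" if "z \<notin> \<int>" for z :: complex
    using plus_of_nat_not_nonpos_Ints[OF not_Ints_imp_not_nonpos_Ints[OF that], of 1] by (simp add: add.commute)
  have n: "a \<notin> \<int>\<^sub>\<le>\<^sub>0" "1 + a - b \<notin> \<int>\<^sub>\<le>\<^sub>0" "1
        + a - c \<notin> \<int>\<^sub>\<le>\<^sub>0" "1 + a - d \<notin> \<int>\<^sub>\<le>\<^sub>0"
    using gen shift[of "a - b"] shift[of "a - c"] shift[of "a - d"] by (simp_all add: not_Ints_imp_not_nonpos_Ints algebra_simps)
  have ba: "b - a \<notin> \<int>\<^sub>\<le>\<^sub>0" "c - a \<notin> \<int>\<^sub>\<le>\<^sub>0"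
    using gen Ints_minus not_Ints_imp_not_nonpos_Ints by (metis minus_diff_eq)+
  have bal': "1 + a - b + (1 + a - c) + (1 + a - d) - a - (1 + a - e) - (1 + a - f) - (1 + a - g) = 1"
    using bal by (simp add: algebra_simps)
  let ?h = "F43_coeff a (1 + a - e) (1 + a - f) (1 + a - g) (1 + a - b) (1 + a - c) (1 + a - d)"
  let ?\<sigma> = "\<lambda>m. pochhammer (e - a) m * pochhammer (f - a) m * pochhammer (g - a) (Suc m) /
       (fact m * pochhammer (b - a) (Suc m) * pochhammer (c - a) (Suc m))"
  let ?\<tau> = "\<lambda>m. pochhammer (1 + a - d) (Suc m) / pochhammer a (Suc m)"
  have inv_Suc: "asymp_powr (\<lambda>m. inverse (pochhammer z (Suc m) / fact m)) (- z) (Gamma z)" if "z \<notin> \<int>\<^sub>\<le>\<^sub>0" for z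
    using asymp_powr_inverse[OF asymp_powr_pochhammer_Suc[of z]] that by (simp add: Gamma_def rGamma_eq_zero_iff)
  have \<sigma>: "asymp_powr ?\<sigma> (d - 1) (rGamma (e - a) * rGamma (f - a) * rGamma (g - a) * (Gamma (b - a) * Gamma (c - a)))"
  proof -
    have 1: "(e - a - 1) + (f - a - 1) + (g - a) + (- (b - a) + - (c - a)) = d - 1"
      using bal by (simp add: algebra_simps)
    have 2: "x / F * (y / F) * (z / F) * (inverse (u / F) * inverse (v / F)) = x * y * z / (F * u * v)"
      if "F \<noteq> 0" for x y z u v F :: complex
      using that by (cases "u = 0"; cases "v = 0") (simp_all add: field_simps)
    show ?thesis
      by (intro asymp_powr_cong[OF _ _ _ asymp_powr_mult[OF asymp_powr_mult[OF asymp_powr_mult[OF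
           asymp_powr_pochhammer[of "e - a"] asymp_powr_pochhammer[of "f - a"]] asymp_powr_pochhammer_Suc[of "g - a"]]
           asymp_powr_mult[OF inv_Suc[OF ba(1)] inv_Suc[OF ba(2)]]]])
         (rule 1 2[OF fact_nonzero] | simp only: mult_ac)+
  qed
  have \<tau>: "asymp_powr ?\<tau> (- (d - 1)) (rGamma (1 + a - d) * Gamma a)"
    by (rule asymp_powr_cong[OF _ _ _ asymp_powr_mult[OF asymp_powr_pochhammer_Suc[of "1 + a - d"] inv_Suc[OF n(1)]]])
       (simp_all add: divide_inverse mult_ac del: pochhammer_Suc)
  have "\<bar>Re (d - 1)\<bar> < 1" using re by simp
  from truncated_sum_tendsto[OF \<sigma> \<tau> this asymp_powr_F43_coeff[OF bal' n(2-4)]]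
  have "(\<lambda>N. \<Sum>k\<le>N. ?h k * (?\<sigma> (N - k) * ?\<tau> (N + k))) \<longlonglongrightarrow>
     suminf ?h * (rGamma (e - a) * rGamma (f - a) * rGamma (g - a) * (Gamma (b - a) * Gamma (c - a)) * (rGamma (1 + a - d) * Gamma a))" .
  moreover have "(\<Sum>k\<le>N. ?h k * (?\<sigma> (N - k) * ?\<tau> (N + k))) = (-1) ^ Suc N * (\<Sum>k\<le>N. residue_left a b c d e f g N k)" for N
  proof -
    have "?h k * (?\<sigma> (N - k) * ?\<tau> (N + k)) = (-1) ^ Suc N * residue_left a b c d e f g N k" if "k \<le> N" for k
      unfolding residue_left_eq[OF that n(1,4)] mult.assoc [symmetric] power_mult_distrib [symmetric] by simp
    then show ?thesis by (simp add: sum_distrib_left del: pochhammer_Suc power_Suc)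
  qed
  moreover have "suminf ?h * (rGamma (e - a) * rGamma (f - a) * rGamma (g - a) * (Gamma (b - a) * Gamma (c - a)) * (rGamma (1 + a - d) * Gamma a))
    = (complex_of_real pi)\<^sup>2 * Gamma a * rGamma (e - a) * rGamma (f - a) * rGamma (g - a) / (sinpi (b - a) * sinpi (c - a)) *
      rF43 a (1 + a - e) (1 + a - f) (1 + a - g) (1 + a - b) (1 + a - c) (1 + a - d)"
  proof -
    have G: "Gamma (1 + a - d) * rGamma (1 + a - d) = 1"
      using n(4) by (simp add: rGamma_inverse_Gamma Gamma_eq_zero_iff)
    have R: "Gamma (z - a) * Gamma (1 + a - z) = pi / sinpi (z - a)" for z
      using Gamma_reflection_complex[of "z - a"] by (simp add: algebra_simps)
    let ?F = "rF43 a (1 + a - e) (1 + a - f) (1 + a - g) (1 + a - b) (1 + a - c) (1 + a - d)"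
    have "suminf ?h * (rGamma (e - a) * rGamma (f - a) * rGamma (g - a) * (Gamma (b - a) * Gamma (c - a)) * (rGamma (1 + a - d) * Gamma a))
      = ?F * (rGamma (e - a) * rGamma (f - a) * rGamma (g - a)) * (Gamma (b - a) * Gamma (1 + a - b)) * (Gamma (c - a) * Gamma (1 + a - c))
        * (Gamma (1 + a - d) * rGamma (1 + a - d)) * Gamma a"
      unfolding rF43_conv_suminf[OF bal' n(2-4)] by (simp only: mult_ac)
    then show ?thesis unfolding G R by (simp add: power2_eq_square)
  qed
  ultimately show ?thesis by (simp only:)
qed

text \<open>The exponent is now 1 - d. The minus sign in the limit comes from the factor (-1)^N in
  \<open>residue_right_eq\<close>, against (-1)^(N+1) for the other poles.\<close>

lemma right_sum_tendsto:
  assumes bal: "e + f + g - a - b - c - d = 1" and re: "\<bar>Re (1 - d)\<bar> < 1"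
    and gen: "a \<notin> \<int>\<^sub>\<le>\<^sub>0" "b \<notin> \<int>\<^sub>\<le>\<^sub>0" "c \<notin> \<int>\<^sub>\<le>\<^sub>0" "e \<notin> \<int>\<^sub>\<le>\<^sub>0" "f \<notin> \<int>\<^sub>\<le>\<^sub>0" "g \<notin> \<int>\<^sub>\<le>\<^sub>0"
  shows "(\<lambda>N. (-1) ^ Suc N * (\<Sum>k\<le>N. residue_right a b c d e f g N k)) \<longlonglongrightarrow>
    - (Gamma a * Gamma b * Gamma c * rGamma (1 - d) * rF43 a b c d e f g)"
proof -
  let ?h = "F43_coeff a b c d e f g"
  let ?\<sigma> = "\<lambda>m. pochhammer (1 - d) (Suc m) / fact m"
  let ?\<tau> = "\<lambda>m. pochhammer e m * pochhammer f m * pochhammer g (Suc m) /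
        (pochhammer a (Suc m) * pochhammer b (Suc m) * pochhammer c (Suc m))"
  have inv_Suc: "asymp_powr (\<lambda>m. inverse (pochhammer z (Suc m) / fact m)) (- z) (Gamma z)" if "z \<notin> \<int>\<^sub>\<le>\<^sub>0" for z
    using asymp_powr_inverse[OF asymp_powr_pochhammer_Suc[of z]] that by (simp add: Gamma_def rGamma_eq_zero_iff)
  have \<tau>: "asymp_powr ?\<tau> (- (1 - d)) (rGamma e * rGamma f * rGamma g * (Gamma a * Gamma b * Gamma c))"
  proof -
    have 1: "(e - 1) + (f - 1) + g + (- a + - b + - c) = - (1 - d)"
      using bal by (simp add: algebra_simps)
    have 2: "x / F * (y / F) * (z / F) * (inverse (u / F) * inverse (v / F) * inverse (w / F)) = x * y * z / (u * v * w)"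
      if "F \<noteq> 0" for x y z u v w F :: complex
      using that by (cases "u = 0"; cases "v = 0"; cases "w = 0") (simp_all add: field_simps)
    show ?thesis
      by (intro asymp_powr_cong[OF _ _ _ asymp_powr_mult[OF asymp_powr_mult[OF asymp_powr_mult[OF
           asymp_powr_pochhammer[of e] asymp_powr_pochhammer[of f]] asymp_powr_pochhammer_Suc[of g]]
           asymp_powr_mult[OF asymp_powr_mult[OF inv_Suc[OF gen(1)] inv_Suc[OF gen(2)]] inv_Suc[OF gen(3)]]]])
         (rule 1 2[OF fact_nonzero] | simp only: mult_ac)+
  qed
  from truncated_sum_tendsto[OF asymp_powr_pochhammer_Suc \<tau> re asymp_powr_F43_coeff[OF bal gen(4-6)]]
  have "(\<lambda>N. - (\<Sum>k\<le>N. ?h k * (?\<sigma> (N - k) * ?\<tau> (N + k)))) \<longlonglongrightarrow>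
     - (suminf ?h * (rGamma (1 - d) * (rGamma e * rGamma f * rGamma g * (Gamma a * Gamma b * Gamma c))))"
    by (rule tendsto_minus)
  moreover have "- (\<Sum>k\<le>N. ?h k * (?\<sigma> (N - k) * ?\<tau> (N + k))) = (-1) ^ Suc N * (\<Sum>k\<le>N. residue_right a b c d e f g N k)" for N
  proof -
    have "?h k * (?\<sigma> (N - k) * ?\<tau> (N + k)) = (-1) ^ N * residue_right a b c d e f g N k" if "k \<le> N" for k
      unfolding residue_right_eq[OF that gen] mult.assoc [symmetric] power_mult_distrib [symmetric] by simp
    then show ?thesis by (simp add: sum_distrib_left sum_negf [symmetric] del: pochhammer_Suc)
  qed
  moreover have "suminf ?h * (rGamma (1 - d) * (rGamma e * rGamma f * rGamma g * (Gamma a * Gamma b * Gamma c)))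
    = Gamma a * Gamma b * Gamma c * rGamma (1 - d) * rF43 a b c d e f g"
  proof -
    have G: "Gamma e * rGamma e = 1" "Gamma f * rGamma f = 1" "Gamma g * rGamma g = 1"
      using gen by (simp_all add: rGamma_inverse_Gamma Gamma_eq_zero_iff)
    show ?thesis unfolding rF43_conv_suminf[OF bal gen(4-6)] using G by algebra
  qed
  ultimately show ?thesis by (simp only:)
qed

text \<open>The limit of \<open>residue_sum_eq_0\<close>: the poles at the integers produce the
  series on the left, and the other three rows produce its complementary series built on a, b and
  c.\<close>

lemma rF43_four_term:
  assumes bal: "e + f + g - a - b - c - d = 1" and re: "\<bar>Re (1 - d)\<bar> < 1"
    and gen: "a \<notin> \<int>" "b \<notin> \<int>" "c \<notin> \<int>" "e \<notin> \<int>" "f \<notin> \<int>" "g \<notin> \<int>"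
      "a - b \<notin> \<int>" "a - c \<notin> \<int>" "b - c \<notin> \<int>" "a - d \<notin> \<int>" "b - d \<notin> \<int>" "c - d \<notin> \<int>"
  defines "w \<equiv> \<lambda>a b c. (complex_of_real pi)\<^sup>2 * Gamma a * rGamma (e - a) * rGamma (f - a) * rGamma (g - a) / (sinpi (b - a) * sinpi (c - a)) *
      rF43 a (1 + a - e) (1 + a - f) (1 + a - g) (1 + a - b) (1 + a - c) (1 + a - d)"
  shows "Gamma a * Gamma b * Gamma c * rGamma (1 - d) * rF43 a b c d e f g = w a b c + w b a c + w c a b"
proof -
  have sym: "b - a \<notin> \<int>" "c - a \<notin> \<int>" "c - b \<notin> \<int>"
    using gen Ints_minus by (metis minus_diff_eq)+
  have bals: "e + f + g - b - a - c - d = 1" "e + f + g - c - a - b - d = 1"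
    using bal by (simp_all add: algebra_simps)
  have "(\<lambda>N. (-1) ^ Suc N * (\<Sum>k\<le>N. residue_right a b c d e f g N k)
      + (-1) ^ Suc N * (\<Sum>k\<le>N. residue_left a b c d e f g N k)
      + (-1) ^ Suc N * (\<Sum>k\<le>N. residue_left b a c d e f g N k)
      + (-1) ^ Suc N * (\<Sum>k\<le>N. residue_left c a b d e f g N k))
    \<longlonglongrightarrow> - (Gamma a * Gamma b * Gamma c * rGamma (1 - d) * rF43 a b c d e f g) + w a b c + w b a c + w c a b"
    unfolding w_def
    by (intro tendsto_add left_sum_tendsto right_sum_tendsto bal bals re gen sym not_Ints_imp_not_nonpos_Ints)
  moreover have "(-1) ^ Suc N * (\<Sum>k\<le>N. residue_right a b c d e f g N k)
      + (-1) ^ Suc N * (\<Sum>k\<le>N. residue_left a b c d e f g N k)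
      + (-1) ^ Suc N * (\<Sum>k\<le>N. residue_left b a c d e f g N k)
      + (-1) ^ Suc N * (\<Sum>k\<le>N. residue_left c a b d e f g N k) = 0" for N
    unfolding distrib_left [symmetric] residue_sum_eq_0[OF gen(1-3,7-9)] by simp
  ultimately have "- (Gamma a * Gamma b * Gamma c * rGamma (1 - d) * rF43 a b c d e f g) + w a b c + w b a c + w c a b = 0"
    by (simp only: LIMSEQ_const_iff)
  then show ?thesis by algebra
qed

section \<open>Trigonometric identities as polynomial identities\<close>

text \<open>Once g is eliminated by balance, all sines are Laurent polynomials in
  \<open>expi\<close> of the six free parameters, and \<open>algebra\<close> can decide identities
  between them.\<close>

definition expi :: "complex \<Rightarrow> complex" where "expi z = exp (\<i> * of_real pi * z)"

lemma expi_nonzero [simp]: "expi z \<noteq> 0" by (simp add: expi_def)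

lemma expi_simps:
  "expi (x + y) = expi x * expi y" "expi (x - y) = expi x / expi y" "expi (- x) = 1 / expi x"
  "expi (2 * x) = expi x * expi x" "expi 1 = -1" "expi 2 = 1"
proof -
  have 1: "exp (\<i> * of_real pi) = -1" by (metis exp_pi_i mult.commute)
  show "expi (x + y) = expi x * expi y" "expi (x - y) = expi x / expi y" "expi (- x) = 1 / expi x" "expi 1 = -1"
    "expi (2 * x) = expi x * expi x"
    by (simp_all add: expi_def exp_add [symmetric] exp_diff [symmetric] exp_minus inverse_eq_divide 1 algebra_simps)
  have "expi (1 + 1) = expi 1 * expi 1" by (simp add: expi_def exp_add [symmetric] algebra_simps)
  then show "expi 2 = 1" by (simp add: expi_def 1)
qed

text \<open>Kept as an opaque constant: the identities below are homogeneous in the sines, so the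
  value 1/(2i) never enters.\<close>

definition sin_factor :: complex where "sin_factor = 1 / (2 * \<i>)"

lemma sinpi_conv_expi: "sinpi z = sin_factor * (expi z - 1 / expi z)"
  by (simp add: sin_exp_eq expi_def sin_factor_def exp_minus inverse_eq_divide mult_ac)

text \<open>Expresses that the multiples of the common series cancel in
  \<open>rK_three_term_generic\<close>.\<close>

lemma trig_four_term:
  assumes bal: "e + f + g - a - b - c - d = 1"
  shows "sinpi (e - a) * sinpi (f - a) * sinpi (g - a) * sinpi (b - c)
      + sinpi (e - b) * sinpi (f - b) * sinpi (g - b) * sinpi (c - a)
      + sinpi (e - c) * sinpi (f - c) * sinpi (g - c) * sinpi (a - b)
      - sinpi (d) * sinpi (a - b) * sinpi (b - c) * sinpi (c - a) = 0"
proof -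
  have g: "g = 1 + a + b + c + d - e - f" using bal by (simp add: algebra_simps)
  have nz: "expi a \<noteq> 0" "expi b \<noteq> 0" "expi c \<noteq> 0" "expi d \<noteq> 0" "expi e \<noteq> 0" "expi f \<noteq> 0" by simp_all
  show ?thesis using nz unfolding g sinpi_conv_expi expi_simps
    by (simp add: divide_simps) algebra
qed
text \<open>What the coefficient of \<open>W\<close> in the elimination of
  \<open>rK_B5_relation_generic\<close> amounts to, with \<open>B5\<close> expanded and the common
  factor sin(pi b) / pi^4 taken out.\<close>

lemma trig_B5_w:
  assumes bal: "e + f + g - a - b - c - d = 1"
  shows "sinpi (a - b) * sinpi (1 + b - a - b) * sinpi (b - (e - a)) * sinpi (1 + b - f - (e - a)) * sinpi (g - a - (e - a))
      + sinpi (a - b) * sinpi (1 + b - a - b) * sinpi (1 + b - a - 2 * (e - a)) * sinpi (1 + b + c - f - (e - a)) * sinpi (1 + b + d - f - (e - a))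
      - sinpi (e - 1) * sinpi (e - b) * sinpi (b - a) * sinpi (c - a) * sinpi (d - a)
      - sinpi (e - 1) * sinpi (e - b) * sinpi (e - 2 * a) * sinpi (f - a) * sinpi (g - a)
      - sinpi (a + b - e) * sinpi (1 + a + b - e - b) * sinpi (b - (1 + b - e)) * sinpi (f - c - (1 + b - e)) * sinpi (g - c - (1 + b - e))
      - sinpi (a + b - e) * sinpi (1 + a + b - e - b) * sinpi (1 + a + b - e - 2 * (1 + b - e)) * sinpi (1 + b - c - (1 + b - e)) * sinpi (1 + b + d - e - (1 + b - e)) = 0"
proof -
  have g: "g = 1 + a + b + c + d - e - f" using bal by (simp add: algebra_simps)
  have nz: "expi a \<noteq> 0" "expi b \<noteq> 0" "expi c \<noteq> 0" "expi d \<noteq> 0" "expi e \<noteq> 0" "expi f \<noteq> 0" by simp_all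
  show ?thesis using nz unfolding g sinpi_conv_expi expi_simps
    by (simp add: divide_simps) algebra
qed
text \<open>The analogue for the coefficient of \<open>V\<close>, after reflection has turned its
  reciprocal Gamma factors into sines.\<close>

lemma trig_B5_v:
  assumes bal: "e + f + g - a - b - c - d = 1"
  shows "- sinpi (e - b - c) * sinpi (e - a) * sinpi (g - a) * sinpi (f - b) * sinpi (f - a - c) * sinpi (1 + b - a - b) * sinpi (b - (e - a))
        * sinpi (1 + b - f - (e - a)) * sinpi (g - a - (e - a))
      - sinpi (e - b - c) * sinpi (e - a) * sinpi (g - a) * sinpi (f - b) * sinpi (f - a - c) * sinpi (1 + b - a - b) * sinpi (1 + b - a - 2 * (e - a)) * sinpi (1 + b + c - f - (e - a)) * sinpi (1 + b + d - f - (e - a))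
      + sinpi (e - b - c) * sinpi (c) * sinpi (e - a) * sinpi (e - d) * sinpi (1 + b + c - e - f) * sinpi (e - b) * sinpi (b - a) * sinpi (c - a) * sinpi (d - a)
      + sinpi (e - b - c) * sinpi (c) * sinpi (e - a) * sinpi (e - d) * sinpi (1 + b + c - e - f) * sinpi (e - b) * sinpi (e - 2 * a) * sinpi (f - a) * sinpi (g - a)
      + sinpi (g - d) * sinpi (c) * sinpi (g - a) * sinpi (a + b - e) * sinpi (f - e) * sinpi (1 + a + b - e - b) * sinpi (b - (1 + b - e)) * sinpi (f - c - (1 + b - e)) * sinpi (g - c - (1 + b - e))
      + sinpi (g - d) * sinpi (c) * sinpi (g - a) * sinpi (a + b - e) * sinpi (f - e) * sinpi (1 + a + b - e - b) * sinpi (1 + a + b - e - 2 * (1 + b - e)) * sinpi (1 + b - c - (1 + b - e)) * sinpi (1 + b + d - e - (1 + b - e))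
      - sinpi (b + c - f) * sinpi (f - d) * sinpi (g - d) * sinpi (e - b) * sinpi (c - a) * sinpi (1 + a + b - e - b) * sinpi (b - (1 + b - e)) * sinpi (f - c - (1 + b - e)) * sinpi (g - c - (1 + b - e))
      - sinpi (b + c - f) * sinpi (f - d) * sinpi (g - d) * sinpi (e - b) * sinpi (c - a) * sinpi (1 + a + b - e - b) * sinpi (1 + a + b - e - 2 * (1 + b - e)) * sinpi (1 + b - c - (1 + b - e)) * sinpi (1 + b + d - e - (1 + b - e)) = 0"
proof -
  have g: "g = 1 + a + b + c + d - e - f" using bal by (simp add: algebra_simps)
  have nz: "expi a \<noteq> 0" "expi b \<noteq> 0" "expi c \<noteq> 0" "expi d \<noteq> 0" "expi e \<noteq> 0" "expi f \<noteq> 0" by simp_all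
  show ?thesis using nz unfolding g sinpi_conv_expi expi_simps
    by (simp add: divide_simps) algebra
qed

section \<open>Three-term relations for rK\<close>

text \<open>The first series of the three functions coincide, by symmetry in the upper parameters,
  while their second series are those of \<open>rF43_four_term\<close>. That relation replaces the
  second series by a multiple of the first, and by \<open>trig_four_term\<close> the total multiple
  is zero.\<close>

lemma rK_three_term_generic:
  assumes bal: "e + f + g - a - b - c - d = 1" and re: "\<bar>Re (1 - d)\<bar> < 1"
    and gen: "\<forall>z\<in>{a, b, c, e, f, g, a - b, a - c, b - c, a - d, b - d, c - d}. z \<notin> \<int>"
  shows "sinpi (b - c) * (rGamma (e - a) * rGamma (f - a) * rGamma (g - a)) * rK a b c d e f g
       + sinpi (c - a) * (rGamma (e - b) * rGamma (f - b) * rGamma (g - b)) * rK b a c d e f g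
       + sinpi (a - b) * (rGamma (e - c) * rGamma (f - c) * rGamma (g - c)) * rK c a b d e f g = 0"
proof -
  let ?pi = "complex_of_real pi"
  define F where "F = rF43 a b c d e f g"
  define Fa where "Fa = rF43 a (1 + a - e) (1 + a - f) (1 + a - g) (1 + a - b) (1 + a - c) (1 + a - d)"
  define Fb where "Fb = rF43 b (1 + b - e) (1 + b - f) (1 + b - g) (1 + b - a) (1 + b - c) (1 + b - d)"
  define Fc where "Fc = rF43 c (1 + c - e) (1 + c - f) (1 + c - g) (1 + c - a) (1 + c - b) (1 + c - d)"
  have Fsym: "rF43 b a c d e f g = F" "rF43 c a b d e f g = F"
    unfolding F_def rF43_def rF43_term_def by (simp_all add: mult_ac)
  have p: "?pi \<noteq> 0" by simp
  have neg: "sinpi (y - x) = - sinpi (x - y)" for x y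
    using sin_minus[of "?pi * (x - y)"] by (simp add: algebra_simps)
  have s: "sinpi (a - b) \<noteq> 0" "sinpi (b - c) \<noteq> 0" "sinpi (c - a) \<noteq> 0"
    using sinpi_nonzero[of "a - b"] sinpi_nonzero[of "b - c"] sinpi_nonzero[of "a - c"] gen neg[of a c] by simp_all
  have G: "Gamma a * rGamma a = 1" "Gamma b * rGamma b = 1" "Gamma c * rGamma c = 1"
    using gen by (simp_all add: rGamma_inverse_Gamma Gamma_eq_zero_iff not_Ints_imp_not_nonpos_Ints)
  have S: "rGamma (z - x) * rGamma (1 + x - z) = sinpi (z - x) / ?pi" for x z
    using rGamma_reflection_complex[of "z - x"] by (simp add: algebra_simps)
  have D: "rGamma d * rGamma (1 - d) = sinpi d / ?pi" by (rule rGamma_reflection_complex)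
  define Xa where "Xa = rGamma (e - a) * rGamma (f - a) * rGamma (g - a) * Fa * (rGamma b * rGamma c * rGamma d)"
  define Xb where "Xb = rGamma (e - b) * rGamma (f - b) * rGamma (g - b) * Fb * (rGamma a * rGamma c * rGamma d)"
  define Xc where "Xc = rGamma (e - c) * rGamma (f - c) * rGamma (g - c) * Fc * (rGamma a * rGamma b * rGamma d)"
  have K: "rGamma (e - x) * rGamma (f - x) * rGamma (g - x) * (F * (rGamma (1 + x - e) * rGamma (1 + x - f) * rGamma (1 + x - g)) + Y)
     = F * (sinpi (e - x) * sinpi (f - x) * sinpi (g - x)) / ?pi ^ 3 + rGamma (e - x) * rGamma (f - x) * rGamma (g - x) * Y" for x Y
  proof -
    have "rGamma (e - x) * rGamma (f - x) * rGamma (g - x) * (F * (rGamma (1 + x - e) * rGamma (1 + x - f) * rGamma (1 + x - g)))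
       = F * ((rGamma (e - x) * rGamma (1 + x - e)) * (rGamma (f - x) * rGamma (1 + x - f)) * (rGamma (g - x) * rGamma (1 + x - g)))"
      by (simp only: mult_ac)
    also have "\<dots> = F * (sinpi (e - x) * sinpi (f - x) * sinpi (g - x)) / ?pi ^ 3"
      unfolding S by (simp add: power3_eq_cube)
    finally show ?thesis by (simp only: distrib_left)
  qed
  have Ka: "rGamma (e - a) * rGamma (f - a) * rGamma (g - a) * rK a b c d e f g = F * (sinpi (e - a) * sinpi (f - a) * sinpi (g - a)) / ?pi ^ 3 + Xa"
    unfolding rK_def F_def[symmetric] Fa_def[symmetric] K Xa_def by (simp only: mult_ac)
  have Kb: "rGamma (e - b) * rGamma (f - b) * rGamma (g - b) * rK b a c d e f g = F * (sinpi (e - b) * sinpi (f - b) * sinpi (g - b)) / ?pi ^ 3 + Xb"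
    unfolding rK_def Fsym Fb_def[symmetric] K Xb_def by (simp only: mult_ac)
  have Kc: "rGamma (e - c) * rGamma (f - c) * rGamma (g - c) * rK c a b d e f g = F * (sinpi (e - c) * sinpi (f - c) * sinpi (g - c)) / ?pi ^ 3 + Xc"
    unfolding rK_def Fsym Fc_def[symmetric] K Xc_def by (simp only: mult_ac)
  have "Gamma a * Gamma b * Gamma c * rGamma (1 - d) * F =
      ?pi\<^sup>2 * Gamma a * rGamma (e - a) * rGamma (f - a) * rGamma (g - a) / (sinpi (b - a) * sinpi (c - a)) * Fa
    + ?pi\<^sup>2 * Gamma b * rGamma (e - b) * rGamma (f - b) * rGamma (g - b) / (sinpi (a - b) * sinpi (c - b)) * Fb
    + ?pi\<^sup>2 * Gamma c * rGamma (e - c) * rGamma (f - c) * rGamma (g - c) / (sinpi (a - c) * sinpi (b - c)) * Fc"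
    unfolding F_def Fa_def Fb_def Fc_def by (rule rF43_four_term[OF bal re]) (use gen in simp_all)
  \<comment> \<open>The four reciprocal Gamma factors cancel Gamma at a, b and c and pair d with 1 -
    d, so that only a sine remains on the left.\<close>
  then have "(rGamma a * rGamma b * rGamma c * rGamma d) * (Gamma a * Gamma b * Gamma c * rGamma (1 - d) * F) =
      (rGamma a * rGamma b * rGamma c * rGamma d) * (
      ?pi\<^sup>2 * Gamma a * rGamma (e - a) * rGamma (f - a) * rGamma (g - a) / (sinpi (b - a) * sinpi (c - a)) * Fa
    + ?pi\<^sup>2 * Gamma b * rGamma (e - b) * rGamma (f - b) * rGamma (g - b) / (sinpi (a - b) * sinpi (c - b)) * Fb
    + ?pi\<^sup>2 * Gamma c * rGamma (e - c) * rGamma (f - c) * rGamma (g - c) / (sinpi (a - c) * sinpi (b - c)) * Fc)"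
    by (rule arg_cong)
  also have "(rGamma a * rGamma b * rGamma c * rGamma d) * (Gamma a * Gamma b * Gamma c * rGamma (1 - d) * F)
     = (Gamma a * rGamma a) * (Gamma b * rGamma b) * (Gamma c * rGamma c) * (rGamma d * rGamma (1 - d)) * F"
    by (simp only: mult_ac)
  also have "\<dots> = sinpi d / ?pi * F" unfolding G D by simp
  also have "(rGamma a * rGamma b * rGamma c * rGamma d) * (
      ?pi\<^sup>2 * Gamma a * rGamma (e - a) * rGamma (f - a) * rGamma (g - a) / (sinpi (b - a) * sinpi (c - a)) * Fa
    + ?pi\<^sup>2 * Gamma b * rGamma (e - b) * rGamma (f - b) * rGamma (g - b) / (sinpi (a - b) * sinpi (c - b)) * Fb
    + ?pi\<^sup>2 * Gamma c * rGamma (e - c) * rGamma (f - c) * rGamma (g - c) / (sinpi (a - c) * sinpi (b - c)) * Fc)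
    = ?pi\<^sup>2 * ((Gamma a * rGamma a) * Xa / (sinpi (b - a) * sinpi (c - a)) + (Gamma b * rGamma b) * Xb / (sinpi (a - b) * sinpi (c - b))
        + (Gamma c * rGamma c) * Xc / (sinpi (a - c) * sinpi (b - c)))"
    unfolding Xa_def Xb_def Xc_def distrib_left times_divide_eq_left times_divide_eq_right by (simp only: mult_ac)
  finally have E0: "sinpi d / ?pi * F = ?pi\<^sup>2 * (Xa / (- sinpi (a - b) * sinpi (c - a)) + Xb / (sinpi (a - b) * - sinpi (b - c))
        + Xc / (- sinpi (c - a) * sinpi (b - c)))"
    unfolding G neg[of b a] neg[of c b] neg[of a c] by simp
  then have "sinpi (b - c) * Xa + sinpi (c - a) * Xb + sinpi (a - b) * Xc
     = - (sinpi d * sinpi (a - b) * sinpi (b - c) * sinpi (c - a)) * F / ?pi ^ 3"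
  proof -
    have gl: "v * X + w * Y + u * Z = - (x * u * v * w) * f / p ^ 3"
      if eq: "x / p * f = p\<^sup>2 * (X / (- u * w) + Y / (u * - v) + Z / (- w * v))"
        and nz: "u \<noteq> 0" "v \<noteq> 0" "w \<noteq> 0" "p \<noteq> 0"
      for u v w x f p X Y Z :: complex
    proof -
      have "X / (- u * w) + Y / (u * - v) + Z / (- w * v) = - (v * X + w * Y + u * Z) / (u * v * w)"
        using nz by (simp add: field_simps)
      with eq have "x / p * f = p\<^sup>2 * (- (v * X + w * Y + u * Z) / (u * v * w))" by simp
      then show ?thesis
        using nz by (simp add: divide_simps power2_eq_square power3_eq_cube) algebra
    qed
    show ?thesis by (rule gl[OF E0 s p])
  qed
  moreover have "sinpi (b - c) * (rGamma (e - a) * rGamma (f - a) * rGamma (g - a) * rK a b c d e f g)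
       + sinpi (c - a) * (rGamma (e - b) * rGamma (f - b) * rGamma (g - b) * rK b a c d e f g)
       + sinpi (a - b) * (rGamma (e - c) * rGamma (f - c) * rGamma (g - c) * rK c a b d e f g)
     = F / ?pi ^ 3 * (sinpi (e - a) * sinpi (f - a) * sinpi (g - a) * sinpi (b - c)
         + sinpi (e - b) * sinpi (f - b) * sinpi (g - b) * sinpi (c - a) + sinpi (e - c) * sinpi (f - c) * sinpi (g - c) * sinpi (a - b))
       + (sinpi (b - c) * Xa + sinpi (c - a) * Xb + sinpi (a - b) * Xc)"
    unfolding Ka Kb Kc by (simp add: distrib_left mult_ac)
  moreover have "sinpi (e - a) * sinpi (f - a) * sinpi (g - a) * sinpi (b - c)
         + sinpi (e - b) * sinpi (f - b) * sinpi (g - b) * sinpi (c - a) + sinpi (e - c) * sinpi (f - c) * sinpi (g - c) * sinpi (a - b)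
      = sinpi d * sinpi (a - b) * sinpi (b - c) * sinpi (c - a)"
    using trig_four_term[OF bal] by simp
  ultimately show ?thesis by (simp add: mult.assoc)
qed

lemma rK_three_term:
  assumes bal: "e + f + g - a - b - c - d = 1"
  shows "sinpi (b - c) * (rGamma (e - a) * rGamma (f - a) * rGamma (g - a)) * rK a b c d e f g
       + sinpi (c - a) * (rGamma (e - b) * rGamma (f - b) * rGamma (g - b)) * rK b a c d e f g
       + sinpi (a - b) * (rGamma (e - c) * rGamma (f - c) * rGamma (g - c)) * rK c a b d e f g = 0"
proof -
  define A B C D E F G where
    "A t = a + t" and "B t = b + 10 * t" and "C t = c + 100 * t" and "D t = d + 1000 * t"
    and "E t = e + 10000 * t" and "F t = f + 100000 * t" and "G t = g - 108889 * t" for t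
  note defs = A_def B_def C_def D_def E_def F_def G_def
  have bal': "E t + F t + G t - A t - B t - C t - D t = 1" for t
    using bal by (simp add: defs algebra_simps)
  have hol: "A holomorphic_on UNIV" "B holomorphic_on UNIV" "C holomorphic_on UNIV" "D holomorphic_on UNIV"
    "E holomorphic_on UNIV" "F holomorphic_on UNIV" "G holomorphic_on UNIV"
    unfolding defs by (intro holomorphic_intros)+
  define H where "H t = sinpi (B t - C t) * (rGamma (E t - A t) * rGamma (F t - A t) * rGamma (G t - A t)) * rK (A t) (B t) (C t) (D t) (E t) (F t) (G t)
       + sinpi (C t - A t) * (rGamma (E t - B t) * rGamma (F t - B t) * rGamma (G t - B t)) * rK (B t) (A t) (C t) (D t) (E t) (F t) (G t)
       + sinpi (A t - B t) * (rGamma (E t - C t) * rGamma (F t - C t) * rGamma (G t - C t)) * rK (C t) (A t) (B t) (D t) (E t) (F t) (G t)" for t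
  define \<Phi> where "\<Phi> = [A, B, C, E, F, G, \<lambda>t. A t - B t, \<lambda>t. A t - C t, \<lambda>t. B t - C t, \<lambda>t. A t - D t, \<lambda>t. B t - D t, \<lambda>t. C t - D t]"
  define U where "U = {t. \<bar>Re (1 - D t)\<bar> < 1}"
  have "H 0 = 0"
  proof (rule entire_zero_off_integers[where E = H and t = 0 and \<Phi> = \<Phi> and U = U])
    show "H holomorphic_on UNIV"
      unfolding H_def
      by (intro holomorphic_intros holomorphic_rK hol) (use bal' in \<open>simp_all add: algebra_simps\<close>)
    show "\<forall>\<phi>\<in>set \<Phi>. \<phi> 1 \<noteq> \<phi> 0 \<and> (\<forall>t. \<phi> t = \<phi> 0 + (\<phi> 1 - \<phi> 0) * t)"
      unfolding \<Phi>_def by (simp add: defs algebra_simps)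
    show "open U" unfolding U_def defs by (intro open_Collect_less continuous_intros)
    \<comment> \<open>At this point D t = 1, so Re (1 - D t) = 0 lies in the middle of the
      strip.\<close>
    show "(1 - d) / 1000 \<in> U"
      unfolding U_def defs by (simp add: field_simps)
    show "H t = 0" if "t \<in> U" "\<forall>\<phi>\<in>set \<Phi>. \<phi> t \<notin> \<int>" for t
      using rK_three_term_generic[OF bal', of t] that unfolding H_def U_def \<Phi>_def by simp
  qed
  then show ?thesis by (simp add: H_def defs)
qed

text \<open>\<open>rK_three_term\<close> only varies which of the upper parameters comes first.
  Taken at the Whipple image, with a, b and e - c in that role, and transformed back term by term,
  it links two functions of one parameter set to a function of the set e - a, e - b, e - c, e -
  d.\<close>

lemma rK_three_term_mixed:
  assumes bal: "e + f + g - a - b - c - d = 1"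
  shows "sinpi (b + c - e) * (rGamma (e - a) * rGamma (1 + b - f) * rGamma (1 + b - g)) * rK a b c d e f g
       + sinpi (e - a - c) * (rGamma (e - b) * rGamma (1 + a - f) * rGamma (1 + a - g)) * rK b a c d e f g
       + sinpi (a - b) * (rGamma c * rGamma (f - d) * rGamma (g - d)) * rK (e - c) (e - a) (e - b) (e - d) e (1 + e - f) (1 + e - g) = 0"
proof -
  have g: "g = 1 + a + b + c + d - e - f" using bal by (simp add: algebra_simps)
  have bal': "e + (1 + a + b - f) + (1 + a + b - g) - a - b - (e - c) - (e - d) = 1"
    "e + f + g - b - a - c - d = 1"
    "e + (1 + a + b - f) + (1 + a + b - g) - (e - c) - (e - d) - a - b = 1"
    using bal by (simp_all add: algebra_simps)
  have 1: "rK a b (e - c) (e - d) e (1 + a + b - f) (1 + a + b - g) = rK a b c d e f g"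
    by (rule rK_Whipple[OF bal, symmetric])
  have 2: "rK b a (e - c) (e - d) e (1 + a + b - f) (1 + a + b - g) = rK b a c d e f g"
    using rK_Whipple[OF bal'(2)] by (simp add: add_ac)
  have "rK (e - c) a b (e - d) e (1 + a + b - f) (1 + a + b - g) = rK (e - c) (e - d) a b e (1 + a + b - f) (1 + a + b - g)"
    using rK_symms by metis
  also have "\<dots> = rK (e - c) (e - d) (e - a) (e - b) e (1 + (e - c) + (e - d) - (1 + a + b - f)) (1 + (e - c) + (e - d) - (1 + a + b - g))"
    by (rule rK_Whipple[OF bal'(3)])
  also have "1 + (e - c) + (e - d) - (1 + a + b - f) = 1 + e - g" by (simp add: g)
  also have "1 + (e - c) + (e - d) - (1 + a + b - g) = 1 + e - f" by (simp add: g)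
  also have "rK (e - c) (e - d) (e - a) (e - b) e (1 + e - g) (1 + e - f) = rK (e - c) (e - a) (e - b) (e - d) e (1 + e - f) (1 + e - g)"
    using rK_symms by metis
  finally have 3: "rK (e - c) a b (e - d) e (1 + a + b - f) (1 + a + b - g) = rK (e - c) (e - a) (e - b) (e - d) e (1 + e - f) (1 + e - g)" .
  have e: "b - (e - c) = b + c - e" "e - c - a = e - a - c" "e - (e - c) = c"
     "1 + a + b - f - a = 1 + b - f" "1 + a + b - g - a = 1 + b - g" "1 + a + b - f - b = 1 + a - f" "1 + a + b - g - b = 1 + a - g"
     "1 + a + b - f - (e - c) = g - d" "1 + a + b - g - (e - c) = f - d"
    by (simp_all add: g)
  show ?thesis
    using rK_three_term[OF bal'(1)] unfolding 1 2 3 e by (simp only: mult_ac)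
qed

section \<open>Elimination and the coefficients B5\<close>

lemma B5_expand:
  "B5 (a, b, c, d, e, f, g) = 1 / of_real pi ^ 4 * sinpi b * (sinpi (e - b) *
     (sinpi (b - a) * sinpi (c - a) * sinpi (d - a) + sinpi (e - 2 * a) * sinpi (f - a) * sinpi (g - a)))"
  by (simp add: Sin_def mult.assoc)

lemma B5_relation_w:
  assumes bal: "e + f + g - a - b - c - d = 1"
  shows "B5 (e - a, b, 1 + b - f, g - a, 1 + b - a, 1 + b + c - f, 1 + b + d - f) * sinpi (a - b)
    - B5 (a, b, c, d, e, f, g) * sinpi (e - 1)
    - B5 (1 + b - e, b, f - c, g - c, 1 + a + b - e, 1 + b - c, 1 + b + d - e) * sinpi (a + b - e) = 0" (is "?l = 0")
proof -
  have "?l = 1 / of_real pi ^ 4 * sinpi b * (sinpi (a - b) * sinpi (1 + b - a - b) * sinpi (b - (e - a)) * sinpi (1 + b - f - (e - a)) * sinpi (g - a - (e - a))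
      + sinpi (a - b) * sinpi (1 + b - a - b) * sinpi (1 + b - a - 2 * (e - a)) * sinpi (1 + b + c - f - (e - a)) * sinpi (1 + b + d - f - (e - a))
      - sinpi (e - 1) * sinpi (e - b) * sinpi (b - a) * sinpi (c - a) * sinpi (d - a)
      - sinpi (e - 1) * sinpi (e - b) * sinpi (e - 2 * a) * sinpi (f - a) * sinpi (g - a)
      - sinpi (a + b - e) * sinpi (1 + a + b - e - b) * sinpi (b - (1 + b - e)) * sinpi (f - c - (1 + b - e)) * sinpi (g - c - (1 + b - e))
      - sinpi (a + b - e) * sinpi (1 + a + b - e - b) * sinpi (1 + a + b - e - 2 * (1 + b - e)) * sinpi (1 + b - c - (1 + b - e)) * sinpi (1 + b + d - e - (1 + b - e)))"
    unfolding B5_expand by algebra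
  then show ?thesis unfolding trig_B5_w[OF bal] by simp
qed

lemma B5_relation_v:
  assumes bal: "e + f + g - a - b - c - d = 1"
  shows "- (sinpi (e - b - c) * sinpi (e - a) * sinpi (g - a) * sinpi (f - b) * sinpi (f - a - c) * B5 (e - a, b, 1 + b - f, g - a, 1 + b - a, 1
        + b + c - f, 1 + b + d - f))
    + sinpi (e - b - c) * sinpi c * sinpi (e - a) * sinpi (e - d) * sinpi (1 + b + c - e - f) * B5 (a, b, c, d, e, f, g)
    + sinpi (g - d) * sinpi c * sinpi (g - a) * sinpi (a + b - e) * sinpi (f - e) * B5 (1 + b - e, b, f - c, g - c, 1 + a + b - e, 1 + b - c, 1 + b + d - e)
    - sinpi (b + c - f) * sinpi (f - d) * sinpi (g - d) * sinpi (e - b) * sinpi (c - a) * B5 (1 + b - e, b, f - c, g - c, 1 + a + b - e, 1 + b - c, 1 + b + d - e) = 0" (is "?l = 0")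
proof -
  have "?l = 1 / of_real pi ^ 4 * sinpi b * (- sinpi (e - b - c) * sinpi (e - a) * sinpi (g - a) * sinpi (f - b) * sinpi (f - a - c) * sinpi (1
        + b - a - b) * sinpi (b - (e - a)) * sinpi (1 + b - f - (e - a)) * sinpi (g - a - (e - a))
      - sinpi (e - b - c) * sinpi (e - a) * sinpi (g - a) * sinpi (f - b) * sinpi (f - a - c) * sinpi (1 + b - a - b) * sinpi (1 + b - a - 2 * (e - a)) * sinpi (1 + b + c - f - (e - a)) * sinpi (1 + b + d - f - (e - a))
      + sinpi (e - b - c) * sinpi (c) * sinpi (e - a) * sinpi (e - d) * sinpi (1 + b + c - e - f) * sinpi (e - b) * sinpi (b - a) * sinpi (c - a) * sinpi (d - a)
      + sinpi (e - b - c) * sinpi (c) * sinpi (e - a) * sinpi (e - d) * sinpi (1 + b + c - e - f) * sinpi (e - b) * sinpi (e - 2 * a) * sinpi (f - a) * sinpi (g - a)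
      + sinpi (g - d) * sinpi (c) * sinpi (g - a) * sinpi (a + b - e) * sinpi (f - e) * sinpi (1 + a + b - e - b) * sinpi (b - (1 + b - e)) * sinpi (f - c - (1 + b - e)) * sinpi (g - c - (1 + b - e))
      + sinpi (g - d) * sinpi (c) * sinpi (g - a) * sinpi (a + b - e) * sinpi (f - e) * sinpi (1 + a + b - e - b) * sinpi (1 + a + b - e - 2 * (1 + b - e)) * sinpi (1 + b - c - (1 + b - e)) * sinpi (1 + b + d - e - (1 + b - e))
      - sinpi (b + c - f) * sinpi (f - d) * sinpi (g - d) * sinpi (e - b) * sinpi (c - a) * sinpi (1 + a + b - e - b) * sinpi (b - (1 + b - e)) * sinpi (f - c - (1 + b - e)) * sinpi (g - c - (1 + b - e))
      - sinpi (b + c - f) * sinpi (f - d) * sinpi (g - d) * sinpi (e - b) * sinpi (c - a) * sinpi (1 + a + b - e - b) * sinpi (1 + a + b - e - 2 * (1 + b - e)) * sinpi (1 + b - c - (1 + b - e)) * sinpi (1 + b + d - e - (1 + b - e)))"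
    unfolding B5_expand by algebra
  then show ?thesis unfolding trig_B5_v[OF bal] by simp
qed

text \<open>The auxiliary functions are \<open>V\<close>, \<open>W\<close> and \<open>W'\<close>.
  \<open>R1\<close> and \<open>R2\<close> express \<open>L0\<close> and \<open>L5\<close> through
  \<open>V\<close> and \<open>W\<close>, \<open>R3\<close> expresses \<open>L4\<close> through
  \<open>V\<close> and \<open>W'\<close>, and \<open>R4\<close> trades \<open>W'\<close> for
  \<open>V\<close> and \<open>W\<close>. The genericity assumption allows division by the two sines
  that multiply the result.\<close>

lemma rK_B5_relation_generic:
  assumes bal: "e + f + g - a - b - c - d = 1" and gen: "b + c - f \<notin> \<int>" "e - b - c \<notin> \<int>"
  shows "rGamma (e - a) * rGamma (f - a) * rGamma (g - a) * (rGamma b * rGamma (1 + b - e) * rGamma (1 + b - f) * rGamma (1 + b - g)) *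
      B5 (e - a, b, 1 + b - f, g - a, 1 + b - a, 1 + b + c - f, 1 + b + d - f) * rK a b c d e f g
    + rGamma a * rGamma (f - d) * rGamma (g - d) * (rGamma b * rGamma (1 + b - e) * rGamma (f - c) * rGamma (g - c)) *
      B5 (1 + b - e, b, f - c, g - c, 1 + a + b - e, 1 + b - c, 1 + b + d - e) * rK (e - a) (e - b) (e - c) (e - d) (1 + e - f) (1 + e - g) e
    + rGamma a * rGamma b * rGamma c * rGamma d * (rGamma (e - a) * rGamma (e - c) * rGamma (e - d)) *
      B5 (a, b, c, d, e, f, g) * rK (1 + b - e) (1 + c - e) (1 + d - e) (1 + a - e) (1 + f - e) (1 + g - e) (2 - e) = 0"
proof -
  have g: "g = 1 + a + b + c + d - e - f" using bal by (simp add: algebra_simps)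
  define L0 where "L0 = rK a b c d e f g"
  define L4 where "L4 = rK (e - a) (e - b) (e - c) (e - d) (1 + e - f) (1 + e - g) e"
  define L5 where "L5 = rK (1 + b - e) (1 + c - e) (1 + d - e) (1 + a - e) (1 + f - e) (1 + g - e) (2 - e)"
  define V where "V = rK b a c d e f g"
  define W where "W = rK (f - c) (f - a) (f - b) (f - d) f (1 + f - e) (1 + f - g)"
  define W' where "W' = rK (e - c) (e - a) (e - b) (e - d) e (1 + e - f) (1 + e - g)"
  define B0 where "B0 = B5 (e - a, b, 1 + b - f, g - a, 1 + b - a, 1 + b + c - f, 1 + b + d - f)"
  define B4 where "B4 = B5 (1 + b - e, b, f - c, g - c, 1 + a + b - e, 1 + b - c, 1 + b + d - e)"
  define B where "B = B5 (a, b, c, d, e, f, g)"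
  have R1: "sinpi (b + c - f) * (rGamma (f - a) * rGamma (1 + b - e) * rGamma (1 + b - g)) * L0
       + sinpi (f - a - c) * (rGamma (f - b) * rGamma (1 + a - e) * rGamma (1 + a - g)) * V
       + sinpi (a - b) * (rGamma c * rGamma (e - d) * rGamma (g - d)) * W = 0"
  proof -
    have "f + e + g - a - b - c - d = 1" using bal by (simp add: algebra_simps)
    from rK_three_term_mixed[OF this] show ?thesis
      unfolding L0_def V_def W_def rK_symms(3)[of _ _ _ _ f e] .
  qed
  \<comment> \<open>The mixed relation at the \<open>rK_swap\<close> form of \<open>V\<close>, with
    the lower parameters reordered.\<close>
  have R2: "sinpi (1 + b + c - e - f) * (rGamma (1 - c) * rGamma (1 + a - e) * rGamma (1 + d - e)) * V
       + sinpi (f - b - c) * (rGamma (e - c) * rGamma a * rGamma d) * L5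
       + sinpi (e - 1) * (rGamma (1 + b - f) * rGamma (g - a) * rGamma (g - d)) * W = 0"
  proof -
    have bal': "(1 + b - c) + (1 + b - a) + (1 + b - d) - b - (1 + b - e) - (1 + b - f) - (1 + b - g) = 1"
      using bal by (simp add: algebra_simps)
    have v: "rK b (1 + b - e) (1 + b - f) (1 + b - g) (1 + b - c) (1 + b - a) (1 + b - d) = V"
      unfolding V_def using rK_swap[of b a c d e f g] rK_symms(3) by metis
    have "rK (1 + b - e) b (1 + b - f) (1 + b - g) (1 + b - c) (1 + b - a) (1 + b - d)
        = rK (1 + b - e) (1 + c - e) (1 + a - e) (1 + d - e) (2 - e) (1 + f - e) (1 + g - e)"
      by (subst rK_swap) (simp add: algebra_simps)
    also have "\<dots> = L5" unfolding L5_def using rK_symms by metis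
    finally have l: "rK (1 + b - e) b (1 + b - f) (1 + b - g) (1 + b - c) (1 + b - a) (1 + b - d) = L5" .
    have "rK (1 + b - c - (1 + b - f)) (1 + b - c - b) (1 + b - c - (1 + b - e)) (1 + b - c - (1 + b - g)) (1 + b - c) (1 + (1 + b - c) - (1
        + b - a)) (1 + (1 + b - c) - (1 + b - d))
       = rK (f - c) (f - b) (f - a) (f - d) f (1 + f - e) (1 + f - g)"
      by (subst rK_swap) (simp add: algebra_simps)
    also have "\<dots> = W" unfolding W_def using rK_symms by metis
    finally have w: "rK (1 + b - c - (1 + b - f)) (1 + b - c - b) (1 + b - c - (1 + b - e)) (1 + b - c - (1 + b - g)) (1 + b - c) (1 + (1
        + b - c) - (1 + b - a)) (1 + (1 + b - c) - (1 + b - d)) = W" .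
    have e: "1 + b - e + (1 + b - f) - (1 + b - c) = 1 + b + c - e - f" "1 + b - c - b = 1 - c" "1 + (1 + b - e) - (1 + b - a) = 1 + a - e"
       "1 + (1 + b - e) - (1 + b - d) = 1 + d - e" "1 - c - (1 + b - f) = f - b - c" "1 + b - c - (1 + b - e) = e - c" 
       "1 + b - (1 + b - a) = a" "1 + b - (1 + b - d) = d" "b - (1 + b - e) = e - 1" "1 + b - a - (1 + b - g) = g - a" "1 + b - d - (1 + b - g) = g - d"
      by simp_all
    show ?thesis using rK_three_term_mixed[OF bal'] unfolding v l w unfolding e .
  qed
  \<comment> \<open>The mixed relation at the set e - a, e - c, e - b, e - d. Its third function
    returns to the original set because e - (e - z) = z, and is \<open>V\<close>.\<close>
  have R3: "sinpi (e - b - c) * (rGamma a * rGamma (f - c) * rGamma (g - c)) * L4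
       + sinpi (a + b - e) * (rGamma c * rGamma (f - a) * rGamma (g - a)) * W'
       + sinpi (c - a) * (rGamma (e - b) * rGamma (1 + d - f) * rGamma (1 + d - g)) * V = 0"
  proof -
    have bal': "e + (1 + e - f) + (1 + e - g) - (e - a) - (e - c) - (e - b) - (e - d) = 1"
      using bal by (simp add: algebra_simps)
    have l: "rK (e - a) (e - c) (e - b) (e - d) e (1 + e - f) (1 + e - g) = L4"
      unfolding L4_def using rK_symms by metis
    have w: "rK (e - c) (e - a) (e - b) (e - d) e (1 + e - f) (1 + e - g) = W'" by (simp add: W'_def)
    have "rK (e - (e - b)) (e - (e - a)) (e - (e - c)) (e - (e - d)) e (1 + e - (1 + e - f)) (1 + e - (1 + e - g)) = V"
      by (simp add: V_def)
    note v = this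
    have e: "e - c + (e - b) - e = e - b - c" "e - (e - a) = a" "1 + (e - c) - (1 + e - f) = f - c" "1 + (e - c) - (1 + e - g) = g - c"
       "a - (e - b) = a + b - e" "e - (e - c) = c" "1 + (e - a) - (1 + e - f) = f - a" "1 + (e - a) - (1 + e - g) = g - a"
       "e - a - (e - c) = c - a" "1 + e - f - (e - d) = 1 + d - f" "1 + e - g - (e - d) = 1 + d - g"
      by simp_all
    show ?thesis using rK_three_term_mixed[OF bal'] unfolding v l w unfolding e .
  qed
  \<comment> \<open>The mixed relation at the \<open>rK_swap\<close> forms of \<open>W\<close> and
    \<open>W'\<close>, which have the same upper and the same lower parameters and differ in which
    upper one comes first.\<close>
  have R4: "sinpi (e - b - c) * (rGamma (1 + b - f) * rGamma (e - a) * rGamma (e - d)) * W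
       + sinpi (b + c - f) * (rGamma (1 + b - e) * rGamma (f - a) * rGamma (f - d)) * W'
       + sinpi (f - e) * (rGamma (1 - c) * rGamma (1 + a - g) * rGamma (1 + d - g)) * V = 0"
  proof -
    have bal': "(1 + b - c) + (1 + a - c) + (1 + d - c) - (f - c) - (e - c) - (1 - c) - (g - c) = 1"
      using bal by (simp add: algebra_simps)
    have "rK (f - c) (e - c) (1 - c) (g - c) (1 + b - c) (1 + a - c) (1 + d - c)
        = rK (f - c) (f - b) (f - a) (f - d) (1 + f - e) f (1 + f - g)"
      by (subst rK_swap) (simp add: algebra_simps)
    also have "\<dots> = W" unfolding W_def using rK_symms by metis
    finally have w: "rK (f - c) (e - c) (1 - c) (g - c) (1 + b - c) (1 + a - c) (1 + d - c) = W" .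
    have "rK (e - c) (f - c) (1 - c) (g - c) (1 + b - c) (1 + a - c) (1 + d - c)
        = rK (e - c) (e - b) (e - a) (e - d) (1 + e - f) e (1 + e - g)"
      by (subst rK_swap) (simp add: algebra_simps)
    also have "\<dots> = W'" unfolding W'_def using rK_symms by metis
    finally have w': "rK (e - c) (f - c) (1 - c) (g - c) (1 + b - c) (1 + a - c) (1 + d - c) = W'" .
    have "rK (1 + b - c - (1 - c)) (1 + b - c - (f - c)) (1 + b - c - (e - c)) (1 + b - c - (g - c)) (1 + b - c) (1 + (1 + b - c) - (1 + a - c)) (1
        + (1 + b - c) - (1 + d - c))
       = rK b c a d f e g"
      by (subst rK_swap) (simp add: algebra_simps)
    also have "\<dots> = V" unfolding V_def using rK_symms by metis
    finally have v: "rK (1 + b - c - (1 - c)) (1 + b - c - (f - c)) (1 + b - c - (e - c)) (1 + b - c - (g - c)) (1 + b - c) (1 + (1 + b - c) - (1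
        + a - c)) (1 + (1 + b - c) - (1 + d - c)) = V" .
    have e: "e - c + (1 - c) - (1 + b - c) = e - b - c" "1 + b - c - (f - c) = 1 + b - f" "1 + (e - c) - (1 + a - c) = e - a"
       "1 + (e - c) - (1 + d - c) = e - d" "1 + b - f - (1 - c) = b + c - f" "1 + b - c - (e - c) = 1 + b - e" 
       "1 + (f - c) - (1 + a - c) = f - a" "1 + (f - c) - (1 + d - c) = f - d" "f - c - (e - c) = f - e" "1 + a - c - (g - c) = 1 + a - g" "1
        + d - c - (g - c) = 1 + d - g"
      by simp_all
    show ?thesis using rK_three_term_mixed[OF bal'] unfolding v w w' unfolding e .
  qed
  have neg: "sinpi (f - b - c) = - sinpi (b + c - f)"
    using sin_minus[of "of_real pi * (b + c - f)"] by (simp add: algebra_simps)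
  let ?T = "rGamma (e - a) * rGamma (f - a) * rGamma (g - a) * (rGamma b * rGamma (1 + b - e) * rGamma (1 + b - f) * rGamma (1 + b - g)) * B0 * L0
    + rGamma a * rGamma (f - d) * rGamma (g - d) * (rGamma b * rGamma (1 + b - e) * rGamma (f - c) * rGamma (g - c)) * B4 * L4
    + rGamma a * rGamma b * rGamma c * rGamma d * (rGamma (e - a) * rGamma (e - c) * rGamma (e - d)) * B * L5"
  \<comment> \<open>Up to sign \<open>?Wc\<close> is the coefficient of \<open>W\<close> that
    survives the elimination, and \<open>?Vc\<close> below is that of \<open>V\<close>.\<close>
  let ?Wc = "rGamma (e - a) * rGamma (g - a) * rGamma b * rGamma (1 + b - f) * rGamma c * rGamma (e - d) * rGamma (g - d) * sinpi (e - b - c) *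
     (B0 * sinpi (a - b) - B * sinpi (e - 1) - B4 * sinpi (a + b - e))"
  let ?Vc = "- (sinpi (e - b - c) * (rGamma (e - a) * rGamma (g - a) * rGamma b * rGamma (1 + b - f)) * B0 * sinpi (f - a - c) * (rGamma (f - b)
        * rGamma (1 + a - e) * rGamma (1 + a - g)))
     + sinpi (e - b - c) * (rGamma b * rGamma c * rGamma (e - a) * rGamma (e - d)) * B * sinpi (1 + b + c - e - f) * (rGamma (1 - c) * rGamma (1 + a - e) * rGamma (1 + d - e))
     + B4 * sinpi (a + b - e) * rGamma c * rGamma (g - a) * rGamma (g - d) * rGamma b * sinpi (f - e) * (rGamma (1 - c) * rGamma (1 + a - g) * rGamma (1 + d - g))
     - sinpi (b + c - f) * (rGamma (f - d) * rGamma (g - d) * rGamma b * rGamma (1 + b - e)) * B4 * sinpi (c - a) * (rGamma (e - b) * rGamma (1 + d - f) * rGamma (1 + d - g))"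
  \<comment> \<open>The multipliers of \<open>R1\<close>, \<open>R2\<close> and \<open>R3\<close>
    give \<open>L0\<close>, \<open>L5\<close> and \<open>L4\<close> their intended coefficients
    times the same product of two sines. The multiplier of \<open>R4\<close> is forced by the
    cancellation of \<open>W'\<close>.\<close>
  have "sinpi (b + c - f) * sinpi (e - b - c) * ?T =
      sinpi (e - b - c) * (rGamma (e - a) * rGamma (g - a) * rGamma b * rGamma (1 + b - f)) * B0 *
        (sinpi (b + c - f) * (rGamma (f - a) * rGamma (1 + b - e) * rGamma (1 + b - g)) * L0
       + sinpi (f - a - c) * (rGamma (f - b) * rGamma (1 + a - e) * rGamma (1 + a - g)) * V
       + sinpi (a - b) * (rGamma c * rGamma (e - d) * rGamma (g - d)) * W)
    - sinpi (e - b - c) * (rGamma b * rGamma c * rGamma (e - a) * rGamma (e - d)) * B *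
        (sinpi (1 + b + c - e - f) * (rGamma (1 - c) * rGamma (1 + a - e) * rGamma (1 + d - e)) * V
       + - sinpi (b + c - f) * (rGamma (e - c) * rGamma a * rGamma d) * L5
       + sinpi (e - 1) * (rGamma (1 + b - f) * rGamma (g - a) * rGamma (g - d)) * W)
    + sinpi (b + c - f) * (rGamma (f - d) * rGamma (g - d) * rGamma b * rGamma (1 + b - e)) * B4 *
        (sinpi (e - b - c) * (rGamma a * rGamma (f - c) * rGamma (g - c)) * L4
       + sinpi (a + b - e) * (rGamma c * rGamma (f - a) * rGamma (g - a)) * W'
       + sinpi (c - a) * (rGamma (e - b) * rGamma (1 + d - f) * rGamma (1 + d - g)) * V)
    - B4 * sinpi (a + b - e) * rGamma c * rGamma (g - a) * rGamma (g - d) * rGamma b *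
        (sinpi (e - b - c) * (rGamma (1 + b - f) * rGamma (e - a) * rGamma (e - d)) * W
       + sinpi (b + c - f) * (rGamma (1 + b - e) * rGamma (f - a) * rGamma (f - d)) * W'
       + sinpi (f - e) * (rGamma (1 - c) * rGamma (1 + a - g) * rGamma (1 + d - g)) * V)
    + (W * (- ?Wc) + V * ?Vc)"
    by algebra
  also have "\<dots> = W * (- ?Wc) + V * ?Vc"
    unfolding R1 R2[unfolded neg] R3 R4 by simp
  also have "?Wc = 0"
    using B5_relation_w[OF bal] unfolding B0_def B4_def B_def by simp
  also have "?Vc = 0"
  proof -
    have S: "rGamma (z - x) * rGamma (1 + x - z) = sinpi (z - x) / of_real pi" for x z
      using rGamma_reflection_complex[of "z - x"] by (simp add: algebra_simps)
    have Sc: "rGamma c * rGamma (1 - c) = sinpi c / of_real pi" by (rule rGamma_reflection_complex)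
    \<comment> \<open>Apart from the common \<open>rGamma b\<close>, the reciprocal Gamma factors of
      each product form three pairs with arguments adding up to 1, so reflection leaves sines over
      pi^3.\<close>
    have "?Vc = rGamma b * (
       - (sinpi (e - b - c) * (rGamma (e - a) * rGamma (1 + a - e)) * (rGamma (g - a) * rGamma (1 + a - g)) * (rGamma (f - b) * rGamma (1 + b - f)) * sinpi (f - a - c) * B0)
       + sinpi (e - b - c) * (rGamma c * rGamma (1 - c)) * (rGamma (e - a) * rGamma (1 + a - e)) * (rGamma (e - d) * rGamma (1 + d - e)) * sinpi (1 + b + c - e - f) * B
       + (rGamma (g - d) * rGamma (1 + d - g)) * (rGamma c * rGamma (1 - c)) * (rGamma (g - a) * rGamma (1 + a - g)) * sinpi (a + b - e) * sinpi (f - e) * B4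
       - sinpi (b + c - f) * (rGamma (f - d) * rGamma (1 + d - f)) * (rGamma (g - d) * rGamma (1 + d - g)) * (rGamma (e - b) * rGamma (1 + b - e)) * sinpi (c - a) * B4)"
      by algebra
    also have "\<dots> = rGamma b / of_real pi ^ 3 * (
       - (sinpi (e - b - c) * sinpi (e - a) * sinpi (g - a) * sinpi (f - b) * sinpi (f - a - c) * B0)
       + sinpi (e - b - c) * sinpi c * sinpi (e - a) * sinpi (e - d) * sinpi (1 + b + c - e - f) * B
       + sinpi (g - d) * sinpi c * sinpi (g - a) * sinpi (a + b - e) * sinpi (f - e) * B4
       - sinpi (b + c - f) * sinpi (f - d) * sinpi (g - d) * sinpi (e - b) * sinpi (c - a) * B4)"
      unfolding S Sc divide_inverse power_inverse [symmetric] by algebra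
    also have "\<dots> = 0"
      unfolding B0_def B4_def B_def B5_relation_v[OF bal] by simp
    finally show ?thesis .
  qed
  finally have "?T = 0" using sinpi_nonzero[OF gen(1)] sinpi_nonzero[OF gen(2)] by simp
  then show ?thesis by (simp only: L0_def L4_def L5_def B0_def B4_def B_def)
qed

lemma holomorphic_B5:
  assumes "a holomorphic_on UNIV" "b holomorphic_on UNIV" "c holomorphic_on UNIV" "d holomorphic_on UNIV"
      "e holomorphic_on UNIV" "f holomorphic_on UNIV" "g holomorphic_on UNIV"
  shows "(\<lambda>t. B5 (a t, b t, c t, d t, e t, f t, g t)) holomorphic_on UNIV"
  unfolding B5_expand by (intro holomorphic_intros assms) auto

lemma rK_B5_relation:
  assumes bal: "e + f + g - a - b - c - d = 1"
  shows "rGamma (e - a) * rGamma (f - a) * rGamma (g - a) * (rGamma b * rGamma (1 + b - e) * rGamma (1 + b - f) * rGamma (1 + b - g)) *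
      B5 (e - a, b, 1 + b - f, g - a, 1 + b - a, 1 + b + c - f, 1 + b + d - f) * rK a b c d e f g
    + rGamma a * rGamma (f - d) * rGamma (g - d) * (rGamma b * rGamma (1 + b - e) * rGamma (f - c) * rGamma (g - c)) *
      B5 (1 + b - e, b, f - c, g - c, 1 + a + b - e, 1 + b - c, 1 + b + d - e) * rK (e - a) (e - b) (e - c) (e - d) (1 + e - f) (1 + e - g) e
    + rGamma a * rGamma b * rGamma c * rGamma d * (rGamma (e - a) * rGamma (e - c) * rGamma (e - d)) *
      B5 (a, b, c, d, e, f, g) * rK (1 + b - e) (1 + c - e) (1 + d - e) (1 + a - e) (1 + f - e) (1 + g - e) (2 - e) = 0"
proof -
  define A B C D E F G where
    "A t = a + t" and "B t = b + 10 * t" and "C t = c + 100 * t" and "D t = d + 1000 * t"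
    and "E t = e + 10000 * t" and "F t = f + 100000 * t" and "G t = g - 108889 * t" for t
  note defs = A_def B_def C_def D_def E_def F_def G_def
  have bal': "E t + F t + G t - A t - B t - C t - D t = 1" for t
    using bal by (simp add: defs algebra_simps)
  have hol: "A holomorphic_on UNIV" "B holomorphic_on UNIV" "C holomorphic_on UNIV" "D holomorphic_on UNIV"
    "E holomorphic_on UNIV" "F holomorphic_on UNIV" "G holomorphic_on UNIV"
    unfolding defs by (intro holomorphic_intros)+
  define H where "H t = rGamma (E t - A t) * rGamma (F t - A t) * rGamma (G t - A t) * (rGamma (B t) * rGamma (1 + B t - E t) * rGamma (1
        + B t - F t) * rGamma (1 + B t - G t)) *
      B5 (E t - A t, B t, 1 + B t - F t, G t - A t, 1 + B t - A t, 1 + B t + C t - F t, 1 + B t + D t - F t) * rK (A t) (B t) (C t) (D t) (E t) (F t) (G t)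
    + rGamma (A t) * rGamma (F t - D t) * rGamma (G t - D t) * (rGamma (B t) * rGamma (1 + B t - E t) * rGamma (F t - C t) * rGamma (G t - C t)) *
      B5 (1 + B t - E t, B t, F t - C t, G t - C t, 1 + A t + B t - E t, 1 + B t - C t, 1 + B t + D t - E t) * rK (E t - A t) (E t - B t) (E t - C t) (E t - D t) (1 + E t - F t) (1 + E t - G t) (E t)
    + rGamma (A t) * rGamma (B t) * rGamma (C t) * rGamma (D t) * (rGamma (E t - A t) * rGamma (E t - C t) * rGamma (E t - D t)) *
      B5 (A t, B t, C t, D t, E t, F t, G t) * rK (1 + B t - E t) (1 + C t - E t) (1 + D t - E t) (1 + A t - E t) (1 + F t - E t) (1 + G t - E t) (2 - E t)" for t
  \<comment> \<open>Only the two sines divided out in the generic case must be nonzero. As the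
    relations used hold on all of V, \<open>U\<close> can be the whole plane.\<close>
  define \<Phi> where "\<Phi> = [\<lambda>t. B t + C t - F t, \<lambda>t. E t - B t - C t]"
  have "H 0 = 0"
  proof (rule entire_zero_off_integers[where E = H and t = 0 and \<Phi> = \<Phi> and U = UNIV])
    show "H holomorphic_on UNIV"
      unfolding H_def
      by (intro holomorphic_intros holomorphic_rK holomorphic_B5 hol) (use bal' in \<open>simp_all add: algebra_simps\<close>)
    show "\<forall>\<phi>\<in>set \<Phi>. \<phi> 1 \<noteq> \<phi> 0 \<and> (\<forall>t. \<phi> t = \<phi> 0 + (\<phi> 1 - \<phi> 0) * t)"
      unfolding \<Phi>_def by (simp add: defs algebra_simps)
    show "open (UNIV :: complex set)" "(0::complex) \<in> UNIV" by simp_all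
    show "H t = 0" if "\<forall>\<phi>\<in>set \<Phi>. \<phi> t \<notin> \<int>" for t
      using rK_B5_relation_generic[OF bal', of t] that unfolding H_def \<Phi>_def by simp
  qed
  then show ?thesis by (simp add: H_def defs del: B5.simps)
qed

section \<open>From rK back to K\<close>

lemma KK_conv_rK:
  assumes "KK_defined (a, b, c, d, e, f, g)" and bal: "e + f + g - a - b - c - d = 1"
  shows "KK (a, b, c, d, e, f, g) = rGamma a / sinpi a * rK a b c d e f g"
proof -
  have bal': "(1 + a - b) + (1 + a - c) + (1 + a - d) - a - (1 + a - e) - (1 + a - f) - (1 + a - g) = 1"
    using bal by (simp add: algebra_simps)
  have n: "e \<notin> \<int>\<^sub>\<le>\<^sub>0" "f \<notin> \<int>\<^sub>\<le>\<^sub>0" "g \<notin> \<int>\<^sub>\<le>\<^sub>0" "1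
        + a - b \<notin> \<int>\<^sub>\<le>\<^sub>0" "1 + a - c \<notin> \<int>\<^sub>\<le>\<^sub>0" "1 + a - d \<notin> \<int>\<^sub>\<le>\<^sub>0"
    using assms(1) by simp_all
  show ?thesis
    unfolding KK.simps rK_def rF43_eq_F43[OF n(1-3) bal] rF43_eq_F43[OF n(4-6) bal']
    by (simp add: distrib_left mult_ac)
qed

theorem proposition6p18:
  fixes a b c d e f g :: complex and x :: params
  assumes x: "x = (a, b, c, d, e, f, g)"
    and V: "x \<in> VV"
    and defined: "KK_defined (p0 x)" "KK_defined (n4 x)" "KK_defined (p5 x)"
  shows
    "A4 (1 - a) (e - a) (f - a) (g - a) * A4 b (1 + b - e) (1 + b - f) (1 + b - g) *
       B5 (e - a, b, 1 + b - f, g - a, 1 + b - a, 1 + b + c - f, 1 + b + d - f) * KK (p0 x)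
   + A4 a (1 + a - e) (f - d) (g - d) * A4 b (1 + b - e) (f - c) (g - c) *
       B5 (1 + b - e, b, f - c, g - c, 1 + a + b - e, 1 + b - c, 1 + b + d - e) * KK (n4 x)
   + A4 a b c d * A4 (e - a) (e - b) (e - c) (e - d) * B5 x * KK (p5 x) = 0"
proof -
  have bal: "e + f + g - a - b - c - d = 1" using V x by (simp add: VV_def)
  have bals: "1 + e - f + (1 + e - g) + e - (e - a) - (e - b) - (e - c) - (e - d) = 1"
    "1 + f - e + (1 + g - e) + (2 - e) - (1 + b - e) - (1 + c - e) - (1 + d - e) - (1 + a - e) = 1"
    using bal by (simp_all add: algebra_simps)
  let ?L0 = "rK a b c d e f g"
  let ?L4 = "rK (e - a) (e - b) (e - c) (e - d) (1 + e - f) (1 + e - g) e"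
  let ?L5 = "rK (1 + b - e) (1 + c - e) (1 + d - e) (1 + a - e) (1 + f - e) (1 + g - e) (2 - e)"
  have K0: "KK (p0 x) = rGamma a / sinpi a * ?L0"
    using defined(1) unfolding x p0.simps by (rule KK_conv_rK) (rule bal)
  have K4: "KK (n4 x) = rGamma (e - a) / sinpi (e - a) * ?L4"
    using defined(2) unfolding x n4.simps by (rule KK_conv_rK) (rule bals)
  have K5: "KK (p5 x) = rGamma (1 + b - e) / sinpi (1 + b - e) * ?L5"
    using defined(3) unfolding x p5.simps by (rule KK_conv_rK) (rule bals)
  have s: "sinpi a \<noteq> 0" "sinpi (e - a) \<noteq> 0" "sinpi (1 + b - e) \<noteq> 0"
    using defined unfolding x by simp_all
  \<comment> \<open>In each summand of the claim the \<open>A4\<close> factors contain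
    \<open>rGamma (1 - z)\<close>, where z is the first parameter of the K concerned: a, e - a or 1
    + b - e. Together with the prefactor from \<open>KK_conv_rK\<close> this gives 1/pi in all three
    cases, and the common factor drops out.\<close>
  have r: "rGamma y * (rGamma z / sinpi z) = 1 / of_real pi" if "y = 1 - z" "sinpi z \<noteq> 0" for y z :: complex
  proof -
    have "rGamma y * (rGamma z / sinpi z) = (rGamma z * rGamma (1 - z)) / sinpi z"
      using that(1) by simp
    then show ?thesis using that(2) unfolding rGamma_reflection_complex by simp
  qed
  have A0: "A4 (1 - a) (e - a) (f - a) (g - a) * Y * Z * (rGamma a / sinpi a * L)
     = 1 / of_real pi * (rGamma (e - a) * rGamma (f - a) * rGamma (g - a) * Y * Z * L)" for Y Z L
    unfolding A4_def r[of "1 - a" a, symmetric, OF refl s(1)] by (simp only: mult_ac)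
  have A1: "A4 a (1 + a - e) (f - d) (g - d) * Y * Z * (rGamma (e - a) / sinpi (e - a) * L)
     = 1 / of_real pi * (rGamma a * rGamma (f - d) * rGamma (g - d) * Y * Z * L)" for Y Z L
  proof -
    have "1 + a - e = 1 - (e - a)" by simp
    from r[OF this s(2), symmetric] show ?thesis unfolding A4_def by (simp only: mult_ac)
  qed
  have A2: "Y * A4 (e - a) (e - b) (e - c) (e - d) * Z * (rGamma (1 + b - e) / sinpi (1 + b - e) * L)
     = 1 / of_real pi * (Y * (rGamma (e - a) * rGamma (e - c) * rGamma (e - d)) * Z * L)" for Y Z L
  proof -
    have "e - b = 1 - (1 + b - e)" by simp
    from r[OF this s(3), symmetric] show ?thesis unfolding A4_def by (simp only: mult_ac)
  qed
  show ?thesis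
    unfolding K0 K4 K5 A0 A1 A2 distrib_left [symmetric]
    unfolding x using rK_B5_relation[OF bal] unfolding A4_def by (simp only: mult_zero_right)
qed

end
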